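(* Let $p$ be a prime and let $M$ be a non-singular symmetric $k\times k$ matrix with entries in $\mathbb{Z}_p$. Let $\mathcal{M}'$ be the random symmetric $(k+1)\times(k+1)$ matrix over $\mathbb{Z}_p$ whose top-left $k\times k$ corner is $M$, and whose last column has entries that are independent Haar distributed elements of $\mathbb{Z}_p$ (the last row being determined by symmetry). Then $$\Delta_S\big[\widetilde{\ker}(M)\big]=\widetilde{\ker}(\mathcal{M}')$$ as an equality of distributions (on isomorphism classes of finite abelian $p$-groups equipped with a perfect symmetric pairing to $\mathbb{Q}_p/\mathbb{Z}_p$, both sides lying in this set almost surely).
   Context: For a symmetric $k\times k$ matrix $M$ over $\mathbb{Z}_p$, $\ker(M)$ denotes the kernel of $M:(\mathbb{Q}_p/\mathbb{Z}_p)^k\to(\mathbb{Q}_p/\mathbb{Z}_p)^k$. It carries the symmetric pairing $\ker(M)\times\ker(M)\to\mathbb{Q}_p/\mathbb{Z}_p$, $(v,w)\mapsto v^TMw \bmod \mathbb{Z}_p$ (computed with lifts to $\mathbb{Q}_p^k$), which is perfect when $M$ is non-singular. $\widetilde{\ker}(M)$ denotes $\ker(M)$ together with this pairing, up to isomorphism preserving the pairing. Definition of $\Delta_S$. Let $(G,\langle\,,\rangle)$ be a finite abelian $p$-group with a perfect symmetric pairing to $\mathbb{Q}_p/\mathbb{Z}_p$. $\Delta_S(G,\langle\,,\rangle)$ is the random output of the following procedure. (1) Pick $g\in G$ uniformly at random. (2) Pick a symmetric pairing on $G\times\mathbb{Q}_p$ with values in $\mathbb{Q}_p/\mathbb{Z}_p$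 uniformly at random among those such that (A) its restriction to $G$ is the original pairing, and (B) $(g,1)\in(g,1)^{\perp}$. Concretely, such a pairing has no cross terms between $G$ and $\mathbb{Q}_p$, and on $\mathbb{Q}_p$ it has the form $\langle q_1,q_2\rangle=q\,q_1q_2 \bmod \mathbb{Z}_p$ for some $q\in\mathbb{Q}_p$; condition (B) says $q\equiv-\langle g,g\rangle \bmod \mathbb{Z}_p$, and $q$ is chosen according to the normalized Haar measure on this coset of $\mathbb{Z}_p$ in $\mathbb{Q}_p$. Then $\Delta_S(G,\langle\,,\rangle)$ is the isomorphism class of $(g,1)^{\perp}/(g,1)$ with its induced pairing, where $(g,1)$ in the quotient stands for the $\mathbb{Z}_p$-span of $(g,1)$ in $G\times\mathbb{Q}_p$. This is almost surely a finite group with a perfect symmetric pairing. *)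

theory Defs
  imports
    "HOL-Probability.Probability"
    "HOL-Algebra.Coset"
    "HOL-Computational_Algebra.Fraction_Field"
    "Jordan_Normal_Form.Determinant"
    "Berlekamp_Zassenhaus.Finite_Field"
begin

section \<open>The $p$-adic integers and numbers\<close>

text \<open>
  The prime \<open>p\<close> is the cardinality \<open>CARD('p)\<close> of a type of class \<^class>\<open>prime_card\<close>, so a
  free type variable \<open>'p :: prime_card\<close> quantifies over all primes.  The ring
  $\mathbb{Z}_p$ is the inverse limit of the rings $\mathbb{Z}/p^n$: a \<open>p\<close>-adic integer is
  its sequence of residues modulo \<open>p ^ n\<close>.  The condition below also forces
  \<open>x n \<in> {0..<p ^ n}\<close>.
\<close>

typedef (overloaded) ('p :: prime_card) padic_int =
  "{x :: nat \<Rightarrow> int. \<forall>n. x (Suc n) mod int CARD('p) ^ n = x n}"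
  morphisms residue Abs_padic_int
  by (rule exI[of _ "\<lambda>_. 0"]) simp

setup_lifting type_definition_padic_int

lemma card_pos [simp]: "0 < int CARD('p :: prime_card)"
  using prime_card[where 'a = 'p] by (simp add: prime_gt_0_nat)

lemma mod_Suc_power:
  "a mod int CARD('p :: prime_card) ^ Suc n mod int CARD('p) ^ n = a mod int CARD('p) ^ n"
  by (rule mod_mod_cancel) simp

lemma mod_eq_of_mod_eq: "(a :: int) mod c = b \<Longrightarrow> a mod c = b mod c"
  by auto

lemma residue_Suc_mod: "residue (x :: 'p :: prime_card padic_int) (Suc n) mod int CARD('p) ^ n = residue x n"
  using residue[of x] by blast

lemma residue_mod_self [simp]:
  "residue (x :: 'p :: prime_card padic_int) n mod int CARD('p) ^ n = residue x n"
  by (simp flip: residue_Suc_mod [of x n])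

lemma padic_int_eqI: "(\<And>n. residue x n = residue y n) \<Longrightarrow> x = y"
  by (rule residue_inject [THEN iffD1]) (rule ext)

instantiation padic_int :: (prime_card) comm_ring_1
begin

lift_definition zero_padic_int :: "'a padic_int" is "\<lambda>_. 0"
  by simp

lift_definition one_padic_int :: "'a padic_int" is "\<lambda>n. 1 mod int CARD('a) ^ n"
  by (simp only: mod_Suc_power simp_thms)

lift_definition plus_padic_int :: "'a padic_int \<Rightarrow> 'a padic_int \<Rightarrow> 'a padic_int"
  is "\<lambda>x y n. (x n + y n) mod int CARD('a) ^ n"
  by (simp only: mod_Suc_power) (intro allI mod_add_cong; rule mod_eq_of_mod_eq; simp)

lift_definition minus_padic_int :: "'a padic_int \<Rightarrow> 'a padic_int \<Rightarrow> 'a padic_int"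
  is "\<lambda>x y n. (x n - y n) mod int CARD('a) ^ n"
  by (simp only: mod_Suc_power) (intro allI mod_diff_cong; rule mod_eq_of_mod_eq; simp)

lift_definition uminus_padic_int :: "'a padic_int \<Rightarrow> 'a padic_int"
  is "\<lambda>x n. (- x n) mod int CARD('a) ^ n"
  by (simp only: mod_Suc_power) (intro allI mod_minus_cong; rule mod_eq_of_mod_eq; simp)

lift_definition times_padic_int :: "'a padic_int \<Rightarrow> 'a padic_int \<Rightarrow> 'a padic_int"
  is "\<lambda>x y n. (x n * y n) mod int CARD('a) ^ n"
  by (simp only: mod_Suc_power) (intro allI mod_mult_cong; rule mod_eq_of_mod_eq; simp)

instance
proof
  note reps = zero_padic_int.rep_eq one_padic_int.rep_eq plus_padic_int.rep_eq
    minus_padic_int.rep_eq uminus_padic_int.rep_eq times_padic_int.rep_eq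
  fix a b c :: "'a padic_int"
  show "a * b * c = a * (b * c)"
    by (rule padic_int_eqI) (simp add: reps mod_mult_left_eq mod_mult_right_eq mult.assoc)
  show "a * b = b * a"
    by (rule padic_int_eqI) (simp add: reps mult.commute)
  show "1 * a = a"
    by (rule padic_int_eqI) (simp add: reps mod_mult_left_eq)
  show "a + b + c = a + (b + c)"
    by (rule padic_int_eqI) (simp add: reps mod_add_left_eq mod_add_right_eq add.assoc)
  show "a + b = b + a"
    by (rule padic_int_eqI) (simp add: reps add.commute)
  show "0 + a = a"
    by (rule padic_int_eqI) (simp add: reps)
  show "- a + a = 0"
    by (rule padic_int_eqI) (simp add: reps mod_add_left_eq)
  show "a - b = a + - b"
    by (rule padic_int_eqI) (simp add: reps mod_add_right_eq)
  show "(a + b) * c = a * c + b * c"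
    by (rule padic_int_eqI)
      (simp add: reps mod_mult_left_eq mod_add_left_eq mod_add_right_eq distrib_right)
  show "(0 :: 'a padic_int) \<noteq> 1"
  proof transfer
    have "int CARD('a) > 1"
      using prime_card[where 'a = 'a] prime_gt_1_nat by auto
    then have "(1 :: int) mod int CARD('a) ^ 1 = 1"
      by simp
    then show "(\<lambda>_. 0) \<noteq> (\<lambda>n. (1 :: int) mod int CARD('a) ^ n)"
      by (auto dest: fun_cong [of _ _ 1])
  qed
qed

end

lemma residue_mod_power:
  fixes x :: "'p :: prime_card padic_int"
  shows "m \<le> n \<Longrightarrow> residue x n mod int CARD('p) ^ m = residue x m"
proof (induction n rule: dec_induct)
  case (step n)
  have "residue x (Suc n) mod int CARD('p) ^ m
      = residue x (Suc n) mod int CARD('p) ^ n mod int CARD('p) ^ m"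
    using step.hyps by (simp add: mod_mod_cancel le_imp_power_dvd)
  with step show ?case
    by (simp add: residue_Suc_mod)
qed simp

instance padic_int :: (prime_card) idom
proof
  fix x y :: "'a padic_int"
  assume "x \<noteq> 0" "y \<noteq> 0"
  have nz: "\<exists>n. residue z n \<noteq> 0" if "z \<noteq> 0" for z :: "'a padic_int"
    using that padic_int_eqI[of z 0] by (auto simp: zero_padic_int.rep_eq)
  obtain m n where m: "residue x m \<noteq> 0" and n: "residue y n \<noteq> 0"
    using nz[OF \<open>x \<noteq> 0\<close>] nz[OF \<open>y \<noteq> 0\<close>] by blast
  let ?p = "int CARD('a)"
  define a where "a = residue x (m + n)"
  define b where "b = residue y (m + n)"
  have p: "prime ?p"
    using prime_card[where 'a = 'a] by simp
  have a: "\<not> ?p ^ m dvd a" and b: "\<not> ?p ^ n dvd b"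
    using m n residue_mod_power[of m "m + n" x] residue_mod_power[of n "m + n" y]
    by (auto simp: a_def b_def)
  then have nz: "a \<noteq> 0" "b \<noteq> 0"
    by auto
  have "multiplicity ?p (a * b) = multiplicity ?p a + multiplicity ?p b"
    using p nz by (intro prime_elem_multiplicity_mult_distrib) auto
  also have "\<dots> < m + n"
    using a b by (intro add_strict_mono) (meson multiplicity_dvd' not_less)+
  finally have "\<not> ?p ^ (m + n) dvd a * b"
    using nz p by (subst power_dvd_iff_le_multiplicity) auto
  then have "residue (x * y) (m + n) \<noteq> 0"
    by (simp add: times_padic_int.rep_eq a_def b_def dvd_eq_mod_eq_0)
  then show "x * y \<noteq> 0"
    by (auto simp: zero_padic_int.rep_eq)
qed

instantiation padic_int :: (prime_card) topological_space
begin

definition open_padic_int :: "'a padic_int set \<Rightarrow> bool" where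
  "open_padic_int U \<longleftrightarrow> (\<forall>x\<in>U. \<exists>n. \<forall>z. x + of_nat CARD('a) ^ n * z \<in> U)"

instance
proof
  show "open (UNIV :: 'a padic_int set)"
    by (simp add: open_padic_int_def)
next
  fix S T :: "'a padic_int set"
  assume ST: "open S" "open T"
  show "open (S \<inter> T)"
    unfolding open_padic_int_def
  proof
    fix x
    assume "x \<in> S \<inter> T"
    then obtain m n where mn: "\<forall>z. x + of_nat CARD('a) ^ m * z \<in> S"
        "\<forall>z. x + of_nat CARD('a) ^ n * z \<in> T"
      using ST unfolding open_padic_int_def by blast
    have "x + of_nat CARD('a) ^ (m + n) * z \<in> S \<inter> T" for z
      using mn(1)[rule_format, of "of_nat CARD('a) ^ n * z"]
        mn(2)[rule_format, of "of_nat CARD('a) ^ m * z"]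
      by (simp add: power_add mult_ac)
    then show "\<exists>n. \<forall>z. x + of_nat CARD('a) ^ n * z \<in> S \<inter> T"
      by blast
  qed
next
  fix K :: "'a padic_int set set"
  assume "\<forall>S\<in>K. open S"
  then show "open (\<Union> K)"
    unfolding open_padic_int_def by (meson Union_iff)
qed

end

type_synonym 'p padic = "'p padic_int fract"

definition of_padic_int :: "'p :: prime_card padic_int \<Rightarrow> 'p padic" where
  "of_padic_int z = Fract z 1"

lemma of_padic_int_simps [simp]:
  "of_padic_int 0 = 0" "of_padic_int 1 = 1"
  "of_padic_int (a + b) = of_padic_int a + of_padic_int b"
  "of_padic_int (- a) = - of_padic_int a"
  "of_padic_int (a - b) = of_padic_int a - of_padic_int b"
  "of_padic_int (a * b) = of_padic_int a * of_padic_int b"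
  by (simp_all add: of_padic_int_def Zero_fract_def One_fract_def)

text \<open>Sets open in the \<open>p\<close>-adic topology of $\mathbb{Q}_p$, and its Borel sets.\<close>

definition padic_open :: "'p :: prime_card padic set \<Rightarrow> bool" where
  "padic_open U \<longleftrightarrow> (\<forall>x\<in>U. \<exists>n. \<forall>z. x + of_padic_int (of_nat CARD('p) ^ n * z) \<in> U)"

definition padic_borel :: "'p :: prime_card padic measure" where
  "padic_borel = sigma UNIV {U. padic_open U}"


section \<open>The group $\mathbb{Q}_p/\mathbb{Z}_p$\<close>

quotient_type (overloaded) 'p padic_mod =
  "'p :: prime_card padic" / "\<lambda>x y. x - y \<in> range of_padic_int"
  morphisms padic_lift padic_class
proof (rule equivpI)
  let ?R = "\<lambda>x y :: 'p padic. x - y \<in> range of_padic_int"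
  show "reflp ?R"
    by (auto intro!: reflpI image_eqI[of _ _ 0])
  show "symp ?R"
  proof (rule sympI)
    fix x y :: "'p padic"
    assume "?R x y"
    then obtain a where "x - y = of_padic_int a"
      by blast
    then have "y - x = of_padic_int (- a)"
      by (simp add: algebra_simps)
    then show "?R y x"
      by blast
  qed
  show "transp ?R"
  proof (rule transpI)
    fix x y z :: "'p padic"
    assume "?R x y" "?R y z"
    then obtain a b where "x - y = of_padic_int a" "y - z = of_padic_int b"
      by blast
    then have "x - z = of_padic_int (a + b)"
      by (simp add: algebra_simps)
    then show "?R x z"
      by blast
  qed
qed

instantiation padic_mod :: (prime_card) ab_group_add
begin

lift_definition zero_padic_mod :: "'a padic_mod" is 0 .

lift_definition plus_padic_mod :: "'a padic_mod \<Rightarrow> 'a padic_mod \<Rightarrow> 'a padic_mod"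
  is "(+)"
proof -
  fix a b c d :: "'a padic"
  assume "a - b \<in> range of_padic_int" "c - d \<in> range of_padic_int"
  then obtain x y where "a - b = of_padic_int x" "c - d = of_padic_int y"
    by blast
  then have "a + c - (b + d) = of_padic_int (x + y)"
    by (simp add: algebra_simps)
  then show "a + c - (b + d) \<in> range of_padic_int"
    by blast
qed

lift_definition uminus_padic_mod :: "'a padic_mod \<Rightarrow> 'a padic_mod" is uminus
proof -
  fix a b :: "'a padic"
  assume "a - b \<in> range of_padic_int"
  then obtain x where "a - b = of_padic_int x"
    by blast
  then have "- a - - b = of_padic_int (- x)"
    by (simp add: algebra_simps)
  then show "- a - - b \<in> range of_padic_int"
    by blast
qed

lift_definition minus_padic_mod :: "'a padic_mod \<Rightarrow> 'a padic_mod \<Rightarrow> 'a padic_mod"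
  is "(-)"
proof -
  fix a b c d :: "'a padic"
  assume "a - b \<in> range of_padic_int" "c - d \<in> range of_padic_int"
  then obtain x y where "a - b = of_padic_int x" "c - d = of_padic_int y"
    by blast
  then have "a - c - (b - d) = of_padic_int (x - y)"
    by (simp add: algebra_simps)
  then show "a - c - (b - d) \<in> range of_padic_int"
    by blast
qed

instance
proof
  fix a b c :: "'a padic_mod"
  have 0: "0 \<in> range (of_padic_int :: 'a padic_int \<Rightarrow> _)"
    by (auto intro!: image_eqI[of _ _ 0])
  show "a + b + c = a + (b + c)"
    using 0 by transfer (simp add: algebra_simps)
  show "a + b = b + a"
    using 0 by transfer (simp add: algebra_simps)
  show "0 + a = a"
    using 0 by transfer simp
  show "- a + a = 0"
    using 0 by transfer simp
  show "a - b = a + - b"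
    using 0 by transfer simp
qed

end

lift_definition padic_act ::
  "'p :: prime_card padic_int \<Rightarrow> 'p padic_mod \<Rightarrow> 'p padic_mod" (infixr \<open>\<cdot>\<^sub>p\<close> 75)
  is "\<lambda>a x. of_padic_int a * x"
proof -
  fix a :: "'p padic_int" and x y :: "'p padic"
  assume "x - y \<in> range of_padic_int"
  then obtain b where "x - y = of_padic_int b"
    by blast
  then have "of_padic_int a * x - of_padic_int a * y = of_padic_int (a * b)"
    by (simp flip: right_diff_distrib)
  then show "of_padic_int a * x - of_padic_int a * y \<in> range of_padic_int"
    by blast
qed


section \<open>Haar measure\<close>

lemma residue_bounds:
  "0 \<le> residue (x :: 'p :: prime_card padic_int) n" "residue x n < int CARD('p) ^ n"
  using pos_mod_bound[of "int CARD('p) ^ n" "residue x n"]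
    pos_mod_sign[of "int CARD('p) ^ n" "residue x n"] by simp_all

lemma residue_of_nat:
  "residue (of_nat m :: 'p :: prime_card padic_int) n = int m mod int CARD('p) ^ n"
  by (induction m)
    (simp_all add: zero_padic_int.rep_eq one_padic_int.rep_eq plus_padic_int.rep_eq mod_simps)

lemma residue_p_power_mult:
  "residue (of_nat CARD('p) ^ n * z :: 'p :: prime_card padic_int) m
    = int CARD('p) ^ n * residue z m mod int CARD('p) ^ m"
  using residue_of_nat[of "CARD('p) ^ n" m, where 'p = 'p]
  by (simp add: times_padic_int.rep_eq mod_mult_left_eq)

lemma residue_eq_iff:
  fixes x y :: "'p :: prime_card padic_int"
  shows "residue y n = residue x n \<longleftrightarrow> (\<exists>z. y = x + of_nat CARD('p) ^ n * z)"
proof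
  assume "\<exists>z. y = x + of_nat CARD('p) ^ n * z"
  then show "residue y n = residue x n"
    by (auto simp: plus_padic_int.rep_eq residue_p_power_mult)
next
  assume eq: "residue y n = residue x n"
  let ?p = "int CARD('p)"
  define d where "d = y - x"
  have d0: "residue d n = 0"
    by (simp add: d_def minus_padic_int.rep_eq eq)
  have dvd: "?p ^ n dvd residue d (m + n)" for m
    using residue_mod_power[of n "m + n" d] d0 by (simp add: dvd_eq_mod_eq_0)
  define z :: "'p padic_int" where "z = Abs_padic_int (\<lambda>m. residue d (m + n) div ?p ^ n)"
  have div_mod: "(a div ?p ^ n) mod ?p ^ m = (a mod ?p ^ (m + n)) div ?p ^ n"
    if "?p ^ n dvd a" for a m
  proof -
    from that obtain b where a: "a = ?p ^ n * b" by blast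
    show ?thesis
      by (simp add: a power_add mult.commute [of "?p ^ m"] mult_mod_right [symmetric])
  qed
  have "residue d (Suc m + n) div ?p ^ n mod ?p ^ m = residue d (m + n) div ?p ^ n" for m
    using div_mod[OF dvd[of "Suc m"], of m] residue_mod_power[of "m + n" "Suc m + n" d] by simp
  then have z: "residue z m = residue d (m + n) div ?p ^ n" for m
    unfolding z_def by (subst Abs_padic_int_inverse) auto
  have "d = of_nat CARD('p) ^ n * z"
  proof (rule padic_int_eqI)
    fix m
    have "residue (of_nat CARD('p) ^ n * z) m
        = (?p ^ n * (residue d (m + n) div ?p ^ n)) mod ?p ^ m"
      by (simp only: residue_p_power_mult z)
    also have "\<dots> = residue d m"
      using dvd[of m] residue_mod_power[of m "m + n" d] by simp
    finally show "residue d m = residue (of_nat CARD('p) ^ n * z) m" ..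
  qed
  then show "\<exists>z. y = x + of_nat CARD('p) ^ n * z"
    by (auto simp: d_def algebra_simps intro!: exI[of _ z])
qed

lemma open_padic_int_iff:
  "open (U :: 'p :: prime_card padic_int set) \<longleftrightarrow>
     (\<forall>x\<in>U. \<exists>n. {y. residue y n = residue x n} \<subseteq> U)"
  unfolding open_padic_int_def residue_eq_iff by blast

definition padic_cylinders :: "'p :: prime_card padic_int set set" where
  "padic_cylinders = range (\<lambda>(n, r). {x. residue x n = r})"

lemma open_cylinder: "open {x :: 'p :: prime_card padic_int. residue x n = r}"
  unfolding open_padic_int_iff by blast

lemma countable_cylinders: "countable (padic_cylinders :: 'p :: prime_card padic_int set set)"
  by (simp add: padic_cylinders_def)

lemma sets_borel_padic_int:
  "sets (borel :: 'p :: prime_card padic_int measure) = sigma_sets UNIV padic_cylinders"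
proof -
  have "sigma_sets UNIV {S :: 'p padic_int set. open S} = sigma_sets UNIV padic_cylinders"
  proof (rule sigma_sets_eqI)
    fix U :: "'p padic_int set"
    assume "U \<in> {S. open S}"
    then have op: "open U" by simp
    let ?C = "{C \<in> padic_cylinders. C \<subseteq> U}"
    have "x \<in> \<Union> ?C" if xU: "x \<in> U" for x
    proof -
      obtain n where "{y. residue y n = residue x n} \<subseteq> U"
        using op xU unfolding open_padic_int_iff by blast
      then show ?thesis
        by (intro UnionI[of "{y. residue y n = residue x n}"])
          (auto simp: padic_cylinders_def intro!: image_eqI[of _ _ "(n, residue x n)"])
    qed
    then have "U = \<Union> ?C"
      by (intro equalityI subsetI) auto
    moreover have "\<Union> ?C \<in> sigma_sets UNIV padic_cylinders"
      by (rule sigma_sets_UNION) (auto intro: countable_subset[OF _ countable_cylinders])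
    ultimately show "U \<in> sigma_sets UNIV padic_cylinders"
      by simp
  next
    fix A :: "'p padic_int set"
    assume "A \<in> padic_cylinders"
    then show "A \<in> sigma_sets UNIV {S. open S}"
      by (auto simp: padic_cylinders_def intro!: sigma_sets.Basic open_cylinder)
  qed
  then show ?thesis
    by (simp add: borel_def)
qed

lemma Int_stable_cylinders: "Int_stable (insert {} (padic_cylinders :: 'p :: prime_card padic_int set set))"
proof -
  have *: "{x :: 'p padic_int. residue x m = r} \<inter> {x. residue x n = s} \<in> insert {} padic_cylinders"
    if "m \<le> n" for m n r s
  proof (cases "s mod int CARD('p) ^ m = r")
    case True
    then have "{x :: 'p padic_int. residue x m = r} \<inter> {x. residue x n = s} = {x. residue x n = s}"
      using residue_mod_power[OF that, where 'p = 'p] by auto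
    moreover have "{x :: 'p padic_int. residue x n = s} \<in> padic_cylinders"
      unfolding padic_cylinders_def by (rule image_eqI[of _ _ "(n, s)"]) auto
    ultimately show ?thesis
      by simp
  next
    case False
    then have "{x :: 'p padic_int. residue x m = r} \<inter> {x. residue x n = s} = {}"
      using residue_mod_power[OF that, where 'p = 'p] by auto
    then show ?thesis
      by simp
  qed
  have "{x :: 'p padic_int. residue x m = r} \<inter> {x. residue x n = s} \<in> insert {} padic_cylinders" for m n r s
    using *[of m n r s] *[of n m s r] by (cases "m \<le> n") (simp_all add: Int_commute)
  then show ?thesis
    unfolding Int_stable_def by (auto simp: padic_cylinders_def)
qed

lemma padic_measure_eqI:
  fixes \<mu> \<nu> :: "'p :: prime_card padic_int measure"
  assumes "sets \<mu> = sets borel" "sets \<nu> = sets borel" "emeasure \<mu> UNIV \<noteq> \<infinity>"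
    and eq: "\<And>n r. 0 \<le> r \<Longrightarrow> r < int CARD('p) ^ n \<Longrightarrow>
      emeasure \<mu> {x. residue x n = r} = emeasure \<nu> {x. residue x n = r}"
  shows "\<mu> = \<nu>"
proof (rule measure_eqI_generator_eq[where E = "insert {} padic_cylinders" and \<Omega> = UNIV and A = "\<lambda>_. UNIV"])
  have gen: "sigma_sets UNIV (insert {} padic_cylinders) = sigma_sets UNIV (padic_cylinders :: 'p padic_int set set)"
    by (rule sigma_sets_eqI) (auto intro: sigma_sets.Empty)
  show "sets \<mu> = sigma_sets UNIV (insert {} padic_cylinders)" "sets \<nu> = sigma_sets UNIV (insert {} padic_cylinders)"
    using assms(1,2) by (simp_all add: gen sets_borel_padic_int)
  show "emeasure \<mu> X = emeasure \<nu> X" if "X \<in> insert {} padic_cylinders" for X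
  proof -
    have "emeasure \<mu> {x. residue x n = r} = emeasure \<nu> {x. residue x n = r}" for n r
    proof (cases "0 \<le> r \<and> r < int CARD('p) ^ n")
      case False
      then have "{x :: 'p padic_int. residue x n = r} = {}"
        using residue_bounds by blast
      then show ?thesis by simp
    qed (use eq in auto)
    with that show ?thesis
      by (auto simp: padic_cylinders_def)
  qed
  have "residue x 0 = 0" for x :: "'p padic_int"
    using residue_bounds[of x 0] by simp
  then show "range (\<lambda>_. UNIV) \<subseteq> insert {} (padic_cylinders :: 'p padic_int set set)"
    by (auto simp: padic_cylinders_def intro!: image_eqI[of _ _ "(0, 0)"])
qed (use assms Int_stable_cylinders in auto)

lemma measurable_padic_add: "(\<lambda>x. a + x :: 'p :: prime_card padic_int) \<in> borel \<rightarrow>\<^sub>M borel"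
proof (rule borel_measurableI)
  fix S :: "'p padic_int set"
  assume "open S"
  then have "open ((\<lambda>x. a + x) -` S)"
    unfolding open_padic_int_def by (auto simp flip: add.assoc)
  then show "(\<lambda>x. a + x) -` S \<inter> space borel \<in> sets borel"
    by simp
qed

lemma vimage_add_cylinder:
  assumes "0 \<le> r" "r < int CARD('p :: prime_card) ^ n"
  shows "(\<lambda>x. a + x) -` {x :: 'p padic_int. residue x n = r}
    = {x. residue x n = (r - residue a n) mod int CARD('p) ^ n}"
proof -
  let ?q = "int CARD('p) ^ n"
  have "(residue a n + residue x n) mod ?q = r \<longleftrightarrow> residue x n = (r - residue a n) mod ?q"
    for x :: "'p padic_int"
  proof
    assume "(residue a n + residue x n) mod ?q = r"
    then have "(r - residue a n) mod ?q = (residue a n + residue x n - residue a n) mod ?q"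
      by (metis mod_diff_left_eq)
    then show "residue x n = (r - residue a n) mod ?q"
      by simp
  next
    assume "residue x n = (r - residue a n) mod ?q"
    then show "(residue a n + residue x n) mod ?q = r"
      using assms by (simp add: mod_add_right_eq)
  qed
  then show ?thesis
    by (auto simp: plus_padic_int.rep_eq)
qed

definition normalized_haar :: "'p :: prime_card padic_int measure \<Rightarrow> bool" where
  "normalized_haar \<mu> \<longleftrightarrow> sets \<mu> = sets borel \<and> prob_space \<mu> \<and>
     (\<forall>a. distr \<mu> borel (\<lambda>x. a + x) = \<mu>)"

definition padic_haar :: "'p :: prime_card padic_int measure" where
  "padic_haar = (THE \<mu>. normalized_haar \<mu>)"

lemma emeasure_haar_cylinder:
  fixes \<mu> :: "'p :: prime_card padic_int measure"
  assumes "normalized_haar \<mu>" and r: "0 \<le> r" "r < int CARD('p) ^ n"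
  shows "emeasure \<mu> {x. residue x n = r} = 1 / of_nat (CARD('p) ^ n)"
proof -
  let ?q = "int CARD('p) ^ n"
  interpret prob_space \<mu>
    using assms by (simp add: normalized_haar_def)
  have sets: "sets \<mu> = sets borel" and inv: "distr \<mu> borel (\<lambda>x. a + x) = \<mu>" for a
    using assms by (auto simp: normalized_haar_def)
  have space: "space \<mu> = UNIV"
    using sets_eq_imp_space_eq[OF sets] by simp
  have cyl [measurable]: "{x :: 'p padic_int. residue x n = s} \<in> sets \<mu>" for s
    by (simp add: sets open_cylinder)
  have eq: "emeasure \<mu> {x. residue x n = s} = emeasure \<mu> {x. residue x n = 0}"
    if s: "0 \<le> s" "s < ?q" for s
  proof -
    have "residue (of_nat (nat s) :: 'p padic_int) n = s"
      using s by (simp only: residue_of_nat) simp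
    then have "(\<lambda>x. of_nat (nat s) + x) -` {x :: 'p padic_int. residue x n = s} = {x. residue x n = 0}"
      using vimage_add_cylinder[OF s, of "of_nat (nat s)"] by simp
    moreover have "emeasure (distr \<mu> borel (\<lambda>x. of_nat (nat s) + x)) {x. residue x n = s}
        = emeasure \<mu> ((\<lambda>x. of_nat (nat s) + x) -` {x. residue x n = s} \<inter> space \<mu>)"
      by (rule emeasure_distr)
        (use measurable_padic_add sets in \<open>auto simp: open_cylinder cong: measurable_cong_sets\<close>)
    ultimately show ?thesis
      by (simp add: inv space)
  qed
  have "(\<Union>s\<in>{0..<?q}. {x :: 'p padic_int. residue x n = s}) = UNIV"
    using residue_bounds[of _ n, where 'p = 'p] by auto
  then have "1 = emeasure \<mu> (\<Union>s\<in>{0..<?q}. {x. residue x n = s})"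
    using emeasure_space_1 by (simp add: space)
  also have "\<dots> = (\<Sum>s\<in>{0..<?q}. emeasure \<mu> {x. residue x n = s})"
    by (subst sum_emeasure) (auto simp: disjoint_family_on_def cyl)
  also have "\<dots> = of_nat (CARD('p) ^ n) * emeasure \<mu> {x. residue x n = 0}"
  proof -
    have "(\<Sum>s\<in>{0..<?q}. emeasure \<mu> {x. residue x n = s})
        = (\<Sum>s\<in>{0..<?q}. emeasure \<mu> {x. residue x n = 0})"
      by (rule sum.cong) (auto intro: eq)
    moreover have "card {0..<?q} = CARD('p) ^ n"
      by (simp add: nat_power_eq)
    ultimately show ?thesis
      by (simp only: sum_constant)
  qed
  finally have *: "of_nat (CARD('p) ^ n) * emeasure \<mu> {x. residue x n = 0} = 1" ..
  define c :: ennreal where "c = of_nat (CARD('p) ^ n)"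
  have "c \<noteq> 0" "c \<noteq> \<top>"
    by (simp_all add: c_def del: of_nat_power)
  then have "c * emeasure \<mu> {x. residue x n = 0} / c = emeasure \<mu> {x. residue x n = 0}"
    by (simp add: mult.commute [of c] ennreal_mult_divide_eq)
  then have "emeasure \<mu> {x. residue x n = 0} = 1 / c"
    using * by (simp add: c_def)
  then show ?thesis
    using eq[OF r] by (simp add: c_def)
qed

lemma normalized_haar_unique:
  assumes "normalized_haar \<mu>" "normalized_haar \<nu>"
  shows "\<mu> = \<nu>"
proof (rule padic_measure_eqI)
  show "sets \<mu> = sets borel" "sets \<nu> = sets borel"
    using assms by (auto simp: normalized_haar_def)
  then have "emeasure \<mu> UNIV = 1"
    using assms prob_space.emeasure_space_1[of \<mu>] sets_eq_imp_space_eq[of \<mu> borel]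
    by (auto simp: normalized_haar_def)
  then show "emeasure \<mu> UNIV \<noteq> \<infinity>"
    by simp
qed (simp add: emeasure_haar_cylinder assms)

lemma digit_sum:
  fixes d :: "nat \<Rightarrow> int"
  assumes p: "1 < p" and d: "\<And>i. i < n \<Longrightarrow> d i \<in> {0..<p}"
  shows "(\<Sum>i<n. d i * p ^ i) \<in> {0..<p ^ n}"
    and "0 \<le> r \<Longrightarrow> r < p ^ n \<Longrightarrow>
      (\<Sum>i<n. d i * p ^ i) = r \<longleftrightarrow> (\<forall>i<n. d i = r div p ^ i mod p)"
proof -
  have *: "(\<Sum>i<n. d i * p ^ i) \<in> {0..<p ^ n} \<and>
      (\<forall>r. 0 \<le> r \<and> r < p ^ n \<longrightarrow>
        (\<Sum>i<n. d i * p ^ i) = r \<longleftrightarrow> (\<forall>i<n. d i = r div p ^ i mod p))"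
    using d
  proof (induction n)
    case (Suc n)
    let ?S = "\<Sum>i<n. d i * p ^ i"
    have IH: "0 \<le> ?S" "?S < p ^ n"
        "\<And>r. 0 \<le> r \<Longrightarrow> r < p ^ n \<Longrightarrow> ?S = r \<longleftrightarrow> (\<forall>i<n. d i = r div p ^ i mod p)"
      using Suc by auto
    have dn: "0 \<le> d n" "d n \<le> p - 1"
      using Suc.prems[of n] by auto
    have pn: "0 < p ^ n"
      using p by simp
    have "d n * p ^ n \<le> (p - 1) * p ^ n"
      using dn pn by (intro mult_right_mono) auto
    then have 1: "0 \<le> ?S + d n * p ^ n" "?S + d n * p ^ n < p ^ Suc n"
      using IH dn pn by (auto simp: algebra_simps)
    have 2: "?S + d n * p ^ n = r \<longleftrightarrow> (\<forall>i<Suc n. d i = r div p ^ i mod p)"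
      if r: "0 \<le> r" "r < p ^ Suc n" for r
    proof -
      have "r div p ^ n < p"
      proof (rule ccontr)
        assume "\<not> r div p ^ n < p"
        then have "p * p ^ n \<le> r div p ^ n * p ^ n"
          using pn by (intro mult_right_mono) auto
        also have "\<dots> \<le> r"
          using pn by (simp flip: minus_mod_eq_div_mult)
        finally show False
          using r by simp
      qed
      moreover have "0 \<le> r div p ^ n"
        using r pn by (simp add: pos_imp_zdiv_nonneg_iff)
      ultimately have top: "r div p ^ n mod p = r div p ^ n"
        by simp
      have low: "r mod p ^ n div p ^ i mod p = r div p ^ i mod p" if "i < n" for i
      proof -
        obtain j where j: "n = Suc (i + j)"
          using \<open>i < n\<close> less_imp_Suc_add by blast
        have "r mod p ^ n div p ^ i = r div p ^ i mod p ^ Suc j"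
        proof -
          have "r mod p ^ n = r mod (p ^ i * p ^ Suc j)"
            by (simp only: j add_Suc_right [symmetric] power_add)
          also have "\<dots> = p ^ i * (r div p ^ i mod p ^ Suc j) + r mod p ^ i"
            using p by (intro zmod_zmult2_eq) simp
          finally show ?thesis
            using p by (simp add: div_add1_eq del: power_Suc)
        qed
        then show ?thesis
          by (simp add: mod_mod_cancel)
      qed
      have "?S + d n * p ^ n = r \<longleftrightarrow> ?S = r mod p ^ n \<and> d n = r div p ^ n"
      proof
        assume "?S + d n * p ^ n = r"
        then show "?S = r mod p ^ n \<and> d n = r div p ^ n"
          using IH(1,2) pn p by (auto simp: div_pos_pos_trivial)
      next
        assume "?S = r mod p ^ n \<and> d n = r div p ^ n"
        then show "?S + d n * p ^ n = r"
          by (simp only: mod_div_mult_eq)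
      qed
      also have "\<dots> \<longleftrightarrow> (\<forall>i<n. d i = r div p ^ i mod p) \<and> d n = r div p ^ n mod p"
        using IH(3)[of "r mod p ^ n"] pn low top by auto
      finally show ?thesis
        by (auto simp: less_Suc_eq)
    qed
    show ?case
      using 1 2 by auto
  qed simp
  show "(\<Sum>i<n. d i * p ^ i) \<in> {0..<p ^ n}"
    using * by blast
  show "0 \<le> r \<Longrightarrow> r < p ^ n \<Longrightarrow>
      (\<Sum>i<n. d i * p ^ i) = r \<longleftrightarrow> (\<forall>i<n. d i = r div p ^ i mod p)"
    using * by blast
qed

lemma normalized_haar_exists: "\<exists>\<mu> :: 'p :: prime_card padic_int measure. normalized_haar \<mu>"
proof -
  let ?p = "int CARD('p)"
  have p1: "1 < ?p"
    using prime_card[where 'a = 'p] prime_gt_1_nat by auto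
  define U where "U = uniform_count_measure {0..<?p}"
  define D where "D = (\<Pi>\<^sub>M i\<in>(UNIV :: nat set). U)"
  define f :: "(nat \<Rightarrow> int) \<Rightarrow> 'p padic_int"
    where "f d = Abs_padic_int (\<lambda>n. (\<Sum>i<n. d i * ?p ^ i) mod ?p ^ n)" for d
  have "prob_space U"
    unfolding U_def using p1 by (intro prob_space_uniform_count_measure) auto
  then interpret D: product_prob_space "\<lambda>_. U" "UNIV :: nat set"
    by (simp add: product_prob_space_def product_prob_space_axioms_def product_sigma_finite_def
        prob_space_imp_sigma_finite)
  have f: "residue (f d) n = (\<Sum>i<n. d i * ?p ^ i) mod ?p ^ n" for d n
    unfolding f_def by (subst Abs_padic_int_inverse) (auto simp: mod_Suc_power simp del: power_Suc)
  have spD: "d i \<in> {0..<?p}" if "d \<in> space D" for d i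
    using that by (auto simp: D_def U_def space_PiM space_uniform_count_measure)
  have pre: "f -` {x. residue x n = r} \<inter> space D = {d \<in> space D. \<forall>i\<in>{..<n}. d i \<in> {r div ?p ^ i mod ?p}}"
    if "0 \<le> r" "r < ?p ^ n" for n r
  proof -
    have "residue (f d) n = r \<longleftrightarrow> (\<forall>i<n. d i = r div ?p ^ i mod ?p)" if "d \<in> space D" for d
    proof -
      have "residue (f d) n = (\<Sum>i<n. d i * ?p ^ i)"
        using digit_sum(1)[OF p1, of n d] spD[OF that] by (simp add: f)
      then show ?thesis
        using digit_sum(2)[OF p1, of n d r] spD[OF that] \<open>0 \<le> r\<close> \<open>r < ?p ^ n\<close> by simp
    qed
    then show ?thesis
      by auto
  qed
  have single: "{r div ?p ^ i mod ?p} \<in> sets U" for r i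
    using p1 by (auto simp: U_def sets_uniform_count_measure)
  have pre_sets: "f -` {x. residue x n = r} \<inter> space D \<in> sets D"
    if "0 \<le> r" "r < ?p ^ n" for n r
    unfolding pre[OF that] unfolding D_def
    by (intro sets.sets_Collect_finite_All sets_Collect_single finite_lessThan UNIV_I single)
  have meas: "f \<in> D \<rightarrow>\<^sub>M borel"
  proof (rule measurable_sigma_sets[OF sets_borel_padic_int])
    fix A :: "'p padic_int set"
    assume "A \<in> padic_cylinders"
    then obtain n r where A: "A = {x. residue x n = r}"
      by (auto simp: padic_cylinders_def)
    show "f -` A \<inter> space D \<in> sets D"
    proof (cases "0 \<le> r \<and> r < ?p ^ n")
      case False
      then have "A = {}"
        using residue_bounds[of _ n, where 'p = 'p] by (auto simp: A)
      then show ?thesis by simp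
    qed (use pre_sets in \<open>auto simp: A\<close>)
  qed auto
  define \<mu> where "\<mu> = distr D borel f"
  have D_prob: "prob_space D"
    unfolding D_def by (rule D.prob_space_axioms)
  have \<mu>: "emeasure \<mu> {x. residue x n = r} = ennreal (1 / CARD('p)) ^ n"
    if r: "0 \<le> r" "r < ?p ^ n" for n r
  proof -
    have "emeasure \<mu> {x. residue x n = r} = emeasure D (f -` {x. residue x n = r} \<inter> space D)"
      unfolding \<mu>_def using meas by (intro emeasure_distr) (auto simp: open_cylinder)
    also have "\<dots> = (\<Prod>i\<in>{..<n}. emeasure U {r div ?p ^ i mod ?p})"
      unfolding pre[OF r] unfolding D_def
      by (rule D.emeasure_PiM_Collect) (auto simp: single)
    also have "\<dots> = (\<Prod>i\<in>{..<n}. ennreal (1 / CARD('p)))"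
    proof (rule prod.cong)
      fix i
      have "{r div ?p ^ i mod ?p} \<subseteq> {0..<?p}"
        using p1 by simp
      then show "emeasure U {r div ?p ^ i mod ?p} = ennreal (1 / CARD('p))"
        unfolding U_def by (subst emeasure_uniform_count_measure) simp_all
    qed simp
    finally show ?thesis
      by simp
  qed
  have "normalized_haar \<mu>"
    unfolding normalized_haar_def
  proof (intro conjI allI)
    show sets: "sets \<mu> = sets borel"
      by (simp add: \<mu>_def)
    show prob: "prob_space \<mu>"
      unfolding \<mu>_def by (rule prob_space.prob_space_distr[OF D_prob meas])
    fix a :: "'p padic_int"
    have sp: "space \<mu> = UNIV"
      by (simp add: \<mu>_def)
    have ma: "(\<lambda>x. a + x) \<in> \<mu> \<rightarrow>\<^sub>M borel"
      using measurable_padic_add sets by (simp cong: measurable_cong_sets)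
    show "distr \<mu> borel (\<lambda>x. a + x) = \<mu>"
    proof (rule padic_measure_eqI)
      have "emeasure (distr \<mu> borel (\<lambda>x. a + x)) UNIV = 1"
        using prob_space.emeasure_space_1[OF prob_space.prob_space_distr[OF prob ma]] by simp
      then show "emeasure (distr \<mu> borel (\<lambda>x. a + x)) UNIV \<noteq> \<infinity>"
        by simp
      fix n r
      assume r: "0 \<le> r" "r < ?p ^ n"
      have "emeasure (distr \<mu> borel (\<lambda>x. a + x)) {x. residue x n = r}
          = emeasure \<mu> ((\<lambda>x. a + x) -` {x. residue x n = r} \<inter> space \<mu>)"
        using ma by (intro emeasure_distr) (auto simp: open_cylinder)
      then show "emeasure (distr \<mu> borel (\<lambda>x. a + x)) {x. residue x n = r}
          = emeasure \<mu> {x. residue x n = r}"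
        using r p1 by (simp add: sp vimage_add_cylinder[OF r] \<mu> del: vimage_Collect_eq)
    qed (simp_all add: sets)
  qed
  then show ?thesis ..
qed

theorem normalized_haar_padic_haar:
  "normalized_haar (padic_haar :: 'p :: prime_card padic_int measure)"
proof -
  obtain \<mu> :: "'p padic_int measure" where \<mu>: "normalized_haar \<mu>"
    using normalized_haar_exists by blast
  then have "padic_haar = \<mu>"
    unfolding padic_haar_def by (rule the_equality) (rule normalized_haar_unique[OF _ \<mu>])
  with \<mu> show ?thesis
    by simp
qed

text \<open>
  The normalized Haar measure on the coset \<open>c\<close> of $\mathbb{Z}_p$ in $\mathbb{Q}_p$, as a
  Borel measure on that coset: the translate of the Haar measure of $\mathbb{Z}_p$ by an element of the
  coset, which by invariance does not depend on that element.
\<close>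

definition padic_haar_coset :: "'p :: prime_card padic_mod \<Rightarrow> 'p padic measure" where
  "padic_haar_coset c =
     distr padic_haar (restrict_space padic_borel {x. padic_class x = c})
       (\<lambda>z. padic_lift c + of_padic_int z)"


section \<open>Groups with a pairing to $\mathbb{Q}_p/\mathbb{Z}_p$\<close>

record ('a, 'p :: prime_card) paired_group = "'a monoid" +
  pairing :: "'a \<Rightarrow> 'a \<Rightarrow> 'p padic_mod"

text \<open>
  In the last clause perfectness is the bijectivity of \<open>x \<mapsto> \<langle>x, _\<rangle>\<close> onto the homomorphisms
  from the group to $\mathbb{Q}_p/\mathbb{Z}_p$.
\<close>

definition perfect_paired_p_group :: "('a, 'p :: prime_card) paired_group \<Rightarrow> bool" where
  "perfect_paired_p_group G \<longleftrightarrow>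
     comm_group G \<and> finite (carrier G) \<and> (\<exists>n. order G = CARD('p) ^ n) \<and>
     (\<forall>x\<in>carrier G. \<forall>y\<in>carrier G. pairing G x y = pairing G y x) \<and>
     (\<forall>x\<in>carrier G. \<forall>y\<in>carrier G. \<forall>z\<in>carrier G.
        pairing G (x \<otimes>\<^bsub>G\<^esub> y) z = pairing G x z + pairing G y z) \<and>
     (\<forall>\<phi>. (\<forall>x\<in>carrier G. \<forall>y\<in>carrier G. \<phi> (x \<otimes>\<^bsub>G\<^esub> y) = \<phi> x + \<phi> y) \<longrightarrow>
        (\<exists>!x. x \<in> carrier G \<and> (\<forall>y\<in>carrier G. pairing G x y = \<phi> y)))"

definition paired_iso ::
  "('a, 'p :: prime_card) paired_group \<Rightarrow> ('b, 'p) paired_group \<Rightarrow> bool" where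
  "paired_iso G H \<longleftrightarrow> (\<exists>h\<in>iso G H. \<forall>x\<in>carrier G. \<forall>y\<in>carrier G.
     pairing H (h x) (h y) = pairing G x y)"

text \<open>
  Isomorphism classes of finite groups with pairing.  Every finite group has a copy whose
  elements are natural numbers, so its class is represented by the set of these copies;
  see \<open>iso_class_eq_iff\<close> below.  The class of an infinite group is the empty set, a cemetery
  point that is not the class of any finite group.
\<close>

definition iso_class ::
  "('a, 'p :: prime_card) paired_group \<Rightarrow> (nat, 'p) paired_group set" where
  "iso_class G = {H. group H \<and> finite (carrier H) \<and> paired_iso G H}"

lemma iso_class_eq_iff:
  fixes G :: "('a, 'p :: prime_card) paired_group" and H :: "('b, 'p) paired_group"
  assumes "group G" "finite (carrier G)" "group H" "finite (carrier H)"
  shows "iso_class G = iso_class H \<longleftrightarrow> paired_iso G H"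
proof -
  have trans: "paired_iso A C" if AB: "paired_iso A B" and BC: "paired_iso B C"
    for A :: "('x, 'p) paired_group" and B :: "('y, 'p) paired_group" and C :: "('z, 'p) paired_group"
  proof -
    obtain f where f: "f \<in> iso A B" "\<And>x y. x \<in> carrier A \<Longrightarrow> y \<in> carrier A \<Longrightarrow> pairing B (f x) (f y) = pairing A x y"
      using AB by (auto simp: paired_iso_def)
    obtain g where g: "g \<in> iso B C" "\<And>x y. x \<in> carrier B \<Longrightarrow> y \<in> carrier B \<Longrightarrow> pairing C (g x) (g y) = pairing B x y"
      using BC by (auto simp: paired_iso_def)
    have "f x \<in> carrier B" if "x \<in> carrier A" for x
      using f(1) that by (auto simp: iso_def hom_def)
    then show ?thesis
      unfolding paired_iso_def using iso_set_trans[OF f(1) g(1)] f(2) g(2)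
      by (intro bexI[of _ "g \<circ> f"]) (auto simp: o_def compose_def)
  qed
  have sym: "paired_iso B A" if "group A" and AB: "paired_iso A B"
    for A :: "('x, 'p) paired_group" and B :: "('y, 'p) paired_group"
  proof -
    interpret A: group A by fact
    obtain f where f: "f \<in> iso A B"
        "\<And>x y. x \<in> carrier A \<Longrightarrow> y \<in> carrier A \<Longrightarrow> pairing B (f x) (f y) = pairing A x y"
      using AB by (auto simp: paired_iso_def)
    have bij: "bij_betw f (carrier A) (carrier B)"
      using f(1) by (auto simp: iso_def)
    show ?thesis
      unfolding paired_iso_def
    proof (intro bexI ballI)
      show "inv_into (carrier A) f \<in> iso B A"
        using f(1) by (rule A.iso_set_sym)
      fix x y
      assume "x \<in> carrier B" "y \<in> carrier B"
      then show "pairing A (inv_into (carrier A) f x) (inv_into (carrier A) f y) = pairing B x y"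
        using f(2)[of "inv_into (carrier A) f x" "inv_into (carrier A) f y"] bij
        by (simp add: bij_betw_def f_inv_into_f inv_into_into)
    qed
  qed
  have copy: "\<exists>K. K \<in> iso_class G"
  proof -
    interpret G: group G by fact
    obtain f :: "'a \<Rightarrow> nat" where f: "inj_on f (carrier G)"
      using finite_imp_inj_to_nat_seg[OF assms(2)] by blast
    define g where "g = inv_into (carrier G) f"
    have g [simp]: "g (f x) = x" if "x \<in> carrier G" for x
      using f that by (simp add: g_def)
    define K :: "(nat, 'p) paired_group" where
      "K = \<lparr>carrier = f ` carrier G, mult = (\<lambda>x y. f (g x \<otimes>\<^bsub>G\<^esub> g y)), one = f \<one>\<^bsub>G\<^esub>,
            pairing = (\<lambda>x y. pairing G (g x) (g y))\<rparr>"
    have "group K"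
    proof (rule groupI)
      fix x assume "x \<in> carrier K"
      then obtain a where "a \<in> carrier G" "x = f a"
        by (auto simp: K_def)
      then show "\<exists>y\<in>carrier K. y \<otimes>\<^bsub>K\<^esub> x = \<one>\<^bsub>K\<^esub>"
        by (intro bexI[of _ "f (inv\<^bsub>G\<^esub> a)"]) (auto simp: K_def)
    qed (auto simp: K_def G.m_assoc)
    moreover have "f \<in> iso G K"
      using f by (auto simp: iso_def hom_def K_def bij_betw_def)
    then have "paired_iso G K"
      unfolding paired_iso_def by (rule bexI[rotated]) (simp add: K_def)
    ultimately show ?thesis
      using assms(2) by (auto simp: iso_class_def K_def)
  qed
  show ?thesis
  proof
    assume eq: "iso_class G = iso_class H"
    from copy obtain K where K: "K \<in> iso_class G" ..
    then have "K \<in> iso_class H"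
      using eq by simp
    with K have "paired_iso G K" "paired_iso H K"
      by (simp_all add: iso_class_def)
    then show "paired_iso G H"
      using sym[OF assms(3)] trans by blast
  next
    assume GH: "paired_iso G H"
    then have HG: "paired_iso H G"
      by (rule sym[OF assms(1)])
    show "iso_class G = iso_class H"
      using trans[OF GH] trans[OF HG] by (auto simp: iso_class_def)
  qed
qed

definition perfect_classes :: "(nat, 'p :: prime_card) paired_group set set" where
  "perfect_classes = iso_class ` {H :: (nat, 'p) paired_group. perfect_paired_p_group H}"


section \<open>The kernel of a symmetric matrix\<close>

definition mat_act ::
  "'p :: prime_card padic_int mat \<Rightarrow> 'p padic_mod vec \<Rightarrow> 'p padic_mod vec" where
  "mat_act M v = vec (dim_row M) (\<lambda>i. \<Sum>j<dim_col M. M $$ (i, j) \<cdot>\<^sub>p vec_index v j)"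

text \<open>
  The pairing lifts both vectors to $\mathbb{Q}_p$ by arbitrarily chosen representatives
  (\<open>padic_lift\<close>); for symmetric \<open>M\<close> the result does not depend on them on the kernel.
\<close>

definition ker_paired ::
  "'p :: prime_card padic_int mat \<Rightarrow> ('p padic_mod vec, 'p) paired_group" where
  "ker_paired M =
     \<lparr>carrier = {v \<in> carrier_vec (dim_col M). mat_act M v = 0\<^sub>v (dim_row M)},
      mult = (+),
      one = 0\<^sub>v (dim_col M),
      pairing = (\<lambda>v w. padic_class (scalar_prod (map_vec padic_lift v)
                         (map_mat of_padic_int M *\<^sub>v map_vec padic_lift w)))\<rparr>"

text \<open>
  The \<open>(k + 1) \<times> (k + 1)\<close> matrix whose top-left corner is the \<open>k \<times> k\<close> matrix \<open>M\<close> and whose last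
  column, and hence last row, is \<open>v 0, \<dots>, v k\<close>.
\<close>

definition bordered_mat :: "nat \<Rightarrow> 'a mat \<Rightarrow> (nat \<Rightarrow> 'a) \<Rightarrow> 'a mat" where
  "bordered_mat k M v = mat (k + 1) (k + 1)
     (\<lambda>(i, j). if i < k \<and> j < k then M $$ (i, j) else if j = k then v i else v j)"


section \<open>The random operator \<open>\<Delta>\<^sub>S\<close>\<close>

text \<open>
  The action of $\mathbb{Z}_p$ on a finite abelian \<open>p\<close>-group: the powers of \<open>g\<close> with exponents
  \<open>a mod p ^ n\<close> are eventually constant.
\<close>

definition padic_pow ::
  "('a, 'm) monoid_scheme \<Rightarrow> 'a \<Rightarrow> 'p :: prime_card padic_int \<Rightarrow> 'a" where
  "padic_pow G g a = (THE h. \<forall>\<^sub>F n in sequentially. g [^]\<^bsub>G\<^esub> residue a n = h)"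

text \<open>
  The symmetric pairings on $G \times \mathbb{Q}_p$ extending that of \<open>G\<close> are parametrized by
  $q \in \mathbb{Q}_p$: there are no cross terms, as \<open>G\<close> is torsion and $\mathbb{Q}_p$ is
  divisible.  The element \<open>(g, 1)\<close> is orthogonal to itself if and only if
  \<open>padic_class q = - pairing G g g\<close>; for such \<open>q\<close> the \<open>the_elem\<close> below is applied to a
  singleton.
\<close>

definition padic_group :: "'p :: prime_card padic monoid" where
  "padic_group = \<lparr>carrier = UNIV, mult = (+), one = 0\<rparr>"

definition ext_group :: "('a, 'p :: prime_card) paired_group \<Rightarrow> ('a \<times> 'p padic) monoid" where
  "ext_group G = G \<times>\<times> padic_group"

definition ext_pairing ::
  "('a, 'p :: prime_card) paired_group \<Rightarrow> 'p padic \<Rightarrow> 'a \<times> 'p padic \<Rightarrow> 'a \<times> 'p padic \<Rightarrow>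
     'p padic_mod" where
  "ext_pairing G q = (\<lambda>(x, s) (y, t). pairing G x y + padic_class (q * s * t))"

definition ext_perp ::
  "('a, 'p :: prime_card) paired_group \<Rightarrow> 'p padic \<Rightarrow> 'a \<Rightarrow> ('a \<times> 'p padic) set" where
  "ext_perp G q g = {u \<in> carrier (ext_group G). ext_pairing G q u (g, 1) = 0}"

definition ext_span ::
  "('a, 'p :: prime_card) paired_group \<Rightarrow> 'a \<Rightarrow> ('a \<times> 'p padic) set" where
  "ext_span G g = range (\<lambda>a. (padic_pow G g a, of_padic_int a))"

definition perp_quotient ::
  "('a, 'p :: prime_card) paired_group \<Rightarrow> 'a \<Rightarrow> 'p padic \<Rightarrow>
     (('a \<times> 'p padic) set, 'p) paired_group" where
  "perp_quotient G g q =
     (let Q = ext_group G\<lparr>carrier := ext_perp G q g\<rparr> Mod ext_span G g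
      in \<lparr>carrier = carrier Q, mult = mult Q, one = one Q,
          pairing = (\<lambda>A B. the_elem {ext_pairing G q u w |u w. u \<in> A \<and> w \<in> B})\<rparr>)"

definition Delta_S ::
  "('a, 'p :: prime_card) paired_group \<Rightarrow> (nat, 'p) paired_group set measure" where
  "Delta_S G =
     measure_pmf (pmf_of_set (carrier G)) \<bind>
       (\<lambda>g. distr (padic_haar_coset (- pairing G g g)) (count_space UNIV)
              (\<lambda>q. iso_class (perp_quotient G g q)))"

end

theory Submission
  imports Defs "HOL-Algebra.Sylow" "HOL-Algebra.Multiplicative_Group"
begin

text \<open>
  Let \<open>b\<close> be the first \<open>k\<close> entries and \<open>c\<close> the last entry of the new column, and put
  $h = M^{-1} b$.  Its class \<open>g\<close> modulo $\mathbb{Z}_p^k$ lies in the kernel of \<open>M\<close>, and with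
  $q = c - h^T M h$ the map $(x, s) \mapsto (x - s h, s)$ induces an isomorphism of
  $(g, 1)^\perp / (g, 1)$ onto the kernel of the bordered matrix that respects the pairings.
  If \<open>b\<close> is Haar distributed then \<open>g\<close> is uniform, because $b \mapsto g$ is a homomorphism onto
  a finite group; given \<open>b\<close>, the number \<open>q\<close> is Haar distributed on its coset, because \<open>c\<close> is on
  $\mathbb{Z}_p$.  The determinant of the bordered matrix is affine in \<open>c\<close> with slope
  $\det M$, so it vanishes with probability zero, and away from its zeros the isomorphism class
  of the kernel is a locally constant function of the matrix.
\<close>

section \<open>Arithmetic of $p$-adic numbers\<close>

no_notation vec_nth (infixl "$" 90)
no_notation inner (infix "\<bullet>" 70)

text \<open>Completing the square explains the shape of the map. Over $Q_p$ the substitution $y = x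
  - s h$ turns the bordered form into $x^T M x + q s^2$, and the lattice $Z_p^{k+1}$ becomes the
  span of $Z_p^k$ and $(h, 1)$. The kernel of a symmetric matrix consists of the vectors that pair
  integrally with the lattice, modulo the lattice. Pairing integrally with $Z_p^k$ and dividing by
  it gives the product of the kernel of \<open>M\<close> with $Q_p$; pairing integrally with $(h,
  1)$ is orthogonality to $(g, 1)$, and dividing by $(h, 1)$ is the quotient by its span. The
  probabilistic obstacle is measurability. Isomorphism classes carry the discrete sigma-algebra, so
  preimages of arbitrary sets of classes have to be measurable. Local constancy makes such a
  preimage open among the non-singular matrices, and open sets are countable unions of cylinders;
  all singular matrices are sent to the single point \<open>{}\<close>. A power \<open>p ^ d\<close>
  divisible by \<open>det M\<close> serves throughout: it kills the kernel, and $g$ depends only on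
  $b$ modulo \<open>p ^ d\<close>.\<close>

lemma residue_mult_eq_0:
  "residue (of_nat CARD('p) ^ n * z :: 'p :: prime_card padic_int) n = 0"
  by (simp add: residue_p_power_mult)

text \<open>Each residue of \<open>u\<close> at a positive level is prime to \<open>p\<close>, hence
  invertible modulo \<open>p ^ n\<close>; uniqueness of these inverses makes them a compatible
  sequence.\<close>

lemma residue_1_nonzero_is_unit:
  fixes u :: "'p :: prime_card padic_int"
  assumes "residue u 1 \<noteq> 0"
  shows "\<exists>w. u * w = 1"
proof -
  let ?p = "int CARD('p)"
  have p: "prime ?p"
    using prime_card[where 'a = 'p] by simp
  have cop: "coprime (residue u n) (?p ^ n)" for n
  proof (cases "n = 0")
    case False
    have "\<not> ?p dvd residue u n"
      using residue_mod_power[of 1 n u] assms False by (auto simp: dvd_eq_mod_eq_0)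
    then show ?thesis
      using p by (meson coprime_commute coprime_power_right_iff prime_imp_coprime)
  qed simp
  \<comment> \<open>The bounds single out one inverse modulo \<open>p ^ n\<close>; compatibility
    relies on that.\<close>
  define f where "f n = (SOME x. 0 \<le> x \<and> x < ?p ^ n \<and> (residue u n * x) mod ?p ^ n = 1 mod ?p ^ n)" for n
  have ex: "\<exists>x. 0 \<le> x \<and> x < ?p ^ n \<and> (residue u n * x) mod ?p ^ n = 1 mod ?p ^ n" for n
  proof -
    obtain x where "[residue u n * x = 1] (mod ?p ^ n)"
      using cong_solve_coprime_int[OF cop] by blast
    then show ?thesis
      by (intro exI[of _ "x mod ?p ^ n"]) (simp add: cong_def mod_mult_right_eq)
  qed
  have f: "0 \<le> f n" "f n < ?p ^ n" "(residue u n * f n) mod ?p ^ n = 1 mod ?p ^ n" for n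
    using someI_ex[OF ex[of n]] by (auto simp: f_def)
  have "f (Suc n) mod ?p ^ n = f n" for n
  proof -
    have "[residue u (Suc n) * f (Suc n) = 1] (mod ?p ^ n)"
      using arg_cong[OF f(3)[of "Suc n"], of "\<lambda>x. x mod ?p ^ n"]
      by (simp only: mod_Suc_power cong_def)
    moreover have "[residue u (Suc n) = residue u n] (mod ?p ^ n)"
      using residue_Suc_mod[of u n] by (simp add: cong_def)
    ultimately have "[residue u n * f (Suc n) = residue u n * f n] (mod ?p ^ n)"
      using f(3)[of n] unfolding cong_def by (metis mod_mult_left_eq)
    then have "[f (Suc n) = f n] (mod ?p ^ n)"
      using cop cong_mult_lcancel by blast
    then show ?thesis
      using f(1,2)[of n] by (simp add: cong_def)
  qed
  then have "residue (Abs_padic_int f :: 'p padic_int) = f"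
    by (subst Abs_padic_int_inverse) auto
  then have "u * Abs_padic_int f = 1"
    by (intro padic_int_eqI) (simp add: times_padic_int.rep_eq one_padic_int.rep_eq f)
  then show ?thesis ..
qed

text \<open>\<open>a\<close> is a power of \<open>p\<close> times a unit. Applied to a determinant,
  this yields the exponent \<open>d\<close> that kills the kernel.\<close>

lemma dvd_p_power:
  fixes a :: "'p :: prime_card padic_int"
  assumes "a \<noteq> 0"
  shows "\<exists>d. a dvd of_nat CARD('p) ^ d"
proof -
  have "\<exists>n. residue a n \<noteq> 0"
    using assms padic_int_eqI[of a 0] by (auto simp: zero_padic_int.rep_eq)
  \<comment> \<open>\<open>n\<close> is the first level at which \<open>a\<close> is visible. It is
    positive because every residue modulo \<open>p ^ 0\<close> vanishes, and the valuation of
    \<open>a\<close> is \<open>n - 1\<close>.\<close>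
  then obtain n where n: "residue a n \<noteq> 0" "\<And>m. m < n \<Longrightarrow> residue a m = 0"
    using exists_least_iff[of "\<lambda>n. residue a n \<noteq> 0"] by blast
  have "n \<noteq> 0"
    using n(1) residue_bounds[of a 0] by (cases n) auto
  then obtain m where m: "n = Suc m"
    by (cases n) auto
  have "residue a m = residue 0 m"
    using n(2)[of m] m by (simp add: zero_padic_int.rep_eq)
  then obtain u where u: "a = of_nat CARD('p) ^ m * u"
    using residue_eq_iff[of a m 0] by auto
  have "residue u 1 \<noteq> 0"
  proof
    assume "residue u 1 = 0"
    then have "residue u 1 = residue 0 1"
      by (simp add: zero_padic_int.rep_eq)
    then obtain z where "u = of_nat CARD('p) * z"
      using residue_eq_iff[of u 1 0] by auto
    then have "a = of_nat CARD('p) ^ n * z"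
      by (simp add: u m mult_ac)
    then show False
      using n(1) residue_mult_eq_0 by metis
  qed
  then obtain w where "u * w = 1"
    using residue_1_nonzero_is_unit by blast
  then have "of_nat CARD('p) ^ m = a * w"
    by (simp add: u mult.assoc)
  then show ?thesis
    by (intro exI[of _ m]) simp
qed

text \<open>Used to see that a small perturbation of a matrix multiplies its determinant by a
  unit.\<close>

lemma one_plus_p_is_unit: "\<exists>w. (1 + of_nat CARD('p) * z) * w = (1 :: 'p :: prime_card padic_int)"
proof (rule residue_1_nonzero_is_unit)
  have "residue (1 + of_nat CARD('p) * z) 1 = residue (1 :: 'p padic_int) 1"
    using residue_eq_iff[of "1 + of_nat CARD('p) * z" 1 1] by (simp only: power_one_right) blast
  moreover have "1 < int CARD('p)"
    using prime_card[where 'a = 'p] prime_gt_1_nat by auto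
  ultimately show "residue (1 + of_nat CARD('p) * z) 1 \<noteq> 0"
    by (simp only: one_padic_int.rep_eq) simp
qed

lemma p_padic_neq_0 [simp]: "of_nat CARD('p) \<noteq> (0 :: 'p :: prime_card padic_int)"
proof
  assume "of_nat CARD('p) = (0 :: 'p padic_int)"
  \<comment> \<open>Level 2 is the first one at which \<open>p\<close> does not vanish.\<close>
  then have "int CARD('p) mod int CARD('p) ^ 2 = 0"
    by (metis residue_of_nat zero_padic_int.rep_eq)
  then show False
    using prime_card[where 'a = 'p] prime_gt_1_nat by (auto simp: power2_eq_square mod_eq_0_iff_dvd)
qed

section \<open>The embedding of $Z_p$ in $Q_p$ and the action on $Q_p/Z_p$\<close>

lemma of_padic_int_eq_iff [simp]: "of_padic_int a = of_padic_int b \<longleftrightarrow> a = b"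
  by (simp add: of_padic_int_def eq_fract)

lemma of_padic_int_eq_0_iff [simp]: "of_padic_int a = 0 \<longleftrightarrow> a = 0"
  using of_padic_int_eq_iff[of a 0] by (simp del: of_padic_int_eq_iff)

interpretation of_padic_int: idom_hom of_padic_int
  by standard auto

lemma of_padic_int_of_nat [simp]: "of_padic_int (of_nat n) = of_nat n"
  by (induction n) auto

lemma of_padic_int_power [simp]: "of_padic_int (a ^ n) = of_padic_int a ^ n"
  by (induction n) auto

definition padic_integers :: "'p :: prime_card padic set" where
  "padic_integers = range of_padic_int"

lemma padic_class_eq_iff: "padic_class x = padic_class y \<longleftrightarrow> x - y \<in> padic_integers"
  unfolding padic_integers_def by (fact padic_mod.abs_eq_iff)

lemma padic_class_add: "padic_class (x + y) = padic_class x + padic_class y"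
  by (simp add: plus_padic_mod.abs_eq)

lemma padic_class_diff: "padic_class (x - y) = padic_class x - padic_class y"
  by (simp add: minus_padic_mod.abs_eq)

lemma padic_class_minus: "padic_class (- x) = - padic_class x"
  by (simp add: uminus_padic_mod.abs_eq)

lemma padic_class_0 [simp]: "padic_class 0 = 0"
  by (simp add: zero_padic_mod_def)

lemma padic_class_sum: "padic_class (sum f A) = (\<Sum>i\<in>A. padic_class (f i))"
  by (induction A rule: infinite_finite_induct) (auto simp: padic_class_add)

lemma padic_class_eq_0_iff: "padic_class x = 0 \<longleftrightarrow> x \<in> padic_integers"
  using padic_class_eq_iff[of x 0] by simp

lemma padic_class_of_padic_int [simp]: "padic_class (of_padic_int a) = 0"
  by (simp add: padic_class_eq_0_iff padic_integers_def)

lemma padic_class_lift [simp]: "padic_class (padic_lift x) = x"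
  by (rule Quotient3_abs_rep[OF Quotient3_padic_mod])

lemma padic_act_class: "a \<cdot>\<^sub>p padic_class x = padic_class (of_padic_int a * x)"
  by (fact padic_act.abs_eq)

lemma padic_act_simps:
  "a \<cdot>\<^sub>p (x + y) = a \<cdot>\<^sub>p x + a \<cdot>\<^sub>p y" "(a + b) \<cdot>\<^sub>p x = a \<cdot>\<^sub>p x + b \<cdot>\<^sub>p x"
  "(a * b) \<cdot>\<^sub>p x = a \<cdot>\<^sub>p (b \<cdot>\<^sub>p x)" "1 \<cdot>\<^sub>p x = x" "0 \<cdot>\<^sub>p x = 0" "a \<cdot>\<^sub>p 0 = 0"
proof -
  obtain x' where x: "x = padic_class x'"
    by (metis padic_class_lift)
  obtain y' where y: "y = padic_class y'"
    by (metis padic_class_lift)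
  show "a \<cdot>\<^sub>p (x + y) = a \<cdot>\<^sub>p x + a \<cdot>\<^sub>p y" "(a + b) \<cdot>\<^sub>p x = a \<cdot>\<^sub>p x + b \<cdot>\<^sub>p x"
    "(a * b) \<cdot>\<^sub>p x = a \<cdot>\<^sub>p (b \<cdot>\<^sub>p x)" "1 \<cdot>\<^sub>p x = x" "0 \<cdot>\<^sub>p x = 0"
    by (simp_all add: x y padic_act_class algebra_simps flip: padic_class_add)
  show "a \<cdot>\<^sub>p 0 = 0"
    using padic_act_class[of a 0] by simp
qed

text \<open>On \<open>p ^ d\<close>-torsion only \<open>a\<close> modulo \<open>p ^ d\<close>
  matters, so a p-adic scalar acts like a natural number. This connects powers in a group with the
  p-adic action.\<close>

lemma padic_act_residue:
  fixes x :: "'p :: prime_card padic_mod"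
  assumes "of_nat CARD('p) ^ d \<cdot>\<^sub>p x = 0" "d \<le> n"
  shows "of_nat (nat (residue a n)) \<cdot>\<^sub>p x = a \<cdot>\<^sub>p x"
proof -
  have "residue (of_nat (nat (residue a n)) :: 'p padic_int) d = residue a d"
    using residue_bounds[of a n] residue_mod_power[OF assms(2), of a] by (simp only: residue_of_nat nat_0_le)
  then obtain z where "of_nat (nat (residue a n)) = a + of_nat CARD('p) ^ d * z"
    unfolding residue_eq_iff by blast
  then show ?thesis
    using assms(1) by (simp add: padic_act_simps mult.commute[of "of_nat CARD('p) ^ d"])
qed

text \<open>Every torsion class of this exponent is represented by some \<open>r / p ^ d\<close>,
  and changing \<open>r\<close> by a multiple of \<open>p ^ d\<close> does not change the
  class.\<close>

lemma finite_padic_torsion: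
  "finite {x :: 'p :: prime_card padic_mod. of_nat CARD('p) ^ d \<cdot>\<^sub>p x = 0}"
proof -
  let ?P = "of_nat CARD('p) ^ d :: 'p padic_int"
  have "x \<in> (\<lambda>a. padic_class (of_padic_int (of_nat a) / of_padic_int ?P)) ` {0..<CARD('p) ^ d}"
    if x: "?P \<cdot>\<^sub>p x = 0" for x :: "'p padic_mod"
  proof -
    have P: "of_padic_int ?P \<noteq> 0"
      by (simp only: of_padic_int_eq_0_iff power_eq_0_iff) simp
    obtain y where y: "x = padic_class y"
      by (metis padic_class_lift)
    obtain a where a: "of_padic_int ?P * y = of_padic_int a"
      using x by (auto simp: y padic_act_class padic_class_eq_0_iff padic_integers_def)
    define r where "r = nat (residue a d)"
    have r: "r < CARD('p) ^ d"
      using residue_bounds[of a d] by (simp add: r_def nat_less_iff)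
    have "residue (of_nat r :: 'p padic_int) d = residue a d"
      using residue_bounds[of a d] by (simp only: residue_of_nat r_def nat_0_le residue_mod_self)
    then obtain z where z: "of_nat r = a + ?P * z"
      unfolding residue_eq_iff by blast
    have "y = of_padic_int a / of_padic_int ?P"
      using a P by (simp add: field_simps)
    then have "of_padic_int (of_nat r) / of_padic_int ?P = y + of_padic_int z"
      using P unfolding z by (simp add: add_divide_distrib)
    then have "x = padic_class (of_padic_int (of_nat r) / of_padic_int ?P)"
      by (simp add: y padic_class_add)
    with r show ?thesis
      by (auto simp del: of_padic_int_of_nat of_padic_int_power)
  qed
  then have "{x :: 'p padic_mod. ?P \<cdot>\<^sub>p x = 0}
      \<subseteq> (\<lambda>a. padic_class (of_padic_int (of_nat a) / of_padic_int ?P)) ` {0..<CARD('p) ^ d}"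
    by blast
  then show ?thesis
    by (rule finite_subset) simp
qed

text \<open>The classes of \<open>1 / p ^ n\<close> are pairwise distinct, and each
  \<open>1 / p ^ n\<close> has the form \<open>t * u\<close>. This makes the kernel of a singular
  matrix infinite.\<close>

lemma infinite_line:
  fixes u :: "'p :: prime_card padic"
  assumes "u \<noteq> 0"
  shows "infinite (range (\<lambda>t. padic_class (t * u)))"
proof -
  let ?f = "\<lambda>n. padic_class (1 / of_padic_int (of_nat CARD('p) ^ n)) :: 'p padic_mod"
  have nz: "of_padic_int (of_nat CARD('p) ^ n :: 'p padic_int) \<noteq> 0" for n
    by (simp only: of_padic_int_eq_0_iff power_eq_0_iff) simp
  have neq: "?f n \<noteq> ?f m" if "n < m" for n m
  proof
    assume "?f n = ?f m"
    then obtain a :: "'p padic_int" where a: "1 / of_padic_int (of_nat CARD('p) ^ n) - 1 / of_padic_int (of_nat CARD('p) ^ m) = of_padic_int a"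
      unfolding padic_class_eq_iff padic_integers_def by blast
    obtain j where j: "m = n + Suc j"
      using \<open>n < m\<close> less_imp_Suc_add by force
    \<comment> \<open>Clearing denominators gives $p^{j+1} - 1 = a p^m$ with positive
      \<open>m\<close>, so \<open>p\<close> would divide 1.\<close>
    have "of_padic_int (of_nat CARD('p) ^ Suc j - 1) = of_padic_int (a * of_nat CARD('p) ^ m)"
    proof -
      have "y - 1 = c * (x * y)" if "1 / x - 1 / (x * y) = c" "x \<noteq> 0" "y \<noteq> 0" for x y c :: "'p padic"
        using that by (auto simp: diff_frac_eq divide_simps)
      from this[OF a[unfolded j power_add of_padic_int_simps] nz nz] show ?thesis
        unfolding j power_add by (simp only: of_padic_int_simps)
    qed
    then have "of_nat CARD('p) ^ Suc j - 1 = a * of_nat CARD('p) ^ m"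
      by (simp only: of_padic_int_eq_iff)
    then have "1 = of_nat CARD('p) * (of_nat CARD('p) ^ j - a * of_nat CARD('p) ^ (n + j))"
      by (simp add: j algebra_simps power_add)
    then have "residue (1 :: 'p padic_int) 1 = residue (of_nat CARD('p) ^ 1 * (of_nat CARD('p) ^ j - a * of_nat CARD('p) ^ (n + j))) 1"
      by simp
    then have "residue (1 :: 'p padic_int) 1 = 0"
      by (simp only: residue_mult_eq_0)
    moreover have "1 < int CARD('p)"
      using prime_card[where 'a = 'p] prime_gt_1_nat by auto
    ultimately show False
      by (simp add: one_padic_int.rep_eq)
  qed
  then have "inj ?f"
    by (intro injI) (metis nat_neq_iff)
  then have "infinite (range ?f)"
    by (rule range_inj_infinite)
  moreover have "range ?f \<subseteq> range (\<lambda>t. padic_class (t * u))"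
  proof safe
    fix n show "?f n \<in> range (\<lambda>t. padic_class (t * u))"
      using assms by (intro image_eqI[of _ _ "1 / of_padic_int (of_nat CARD('p) ^ n) / u"]) auto
  qed
  ultimately show ?thesis
    using finite_subset by blast
qed

section \<open>The kernel of a symmetric matrix\<close>

abbreviation Qmat :: "'p :: prime_card padic_int mat \<Rightarrow> 'p padic mat" where
  "Qmat \<equiv> map_mat of_padic_int"

abbreviation cvec :: "'p :: prime_card padic vec \<Rightarrow> 'p padic_mod vec" where
  "cvec \<equiv> map_vec padic_class"

definition integral_vec :: "nat \<Rightarrow> 'p :: prime_card padic vec set" where
  "integral_vec n = {x \<in> carrier_vec n. \<forall>i<n. x $ i \<in> padic_integers}"

lemma padic_integersE: "x \<in> padic_integers \<Longrightarrow> (\<And>a. x = of_padic_int a \<Longrightarrow> P) \<Longrightarrow> P"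
  by (auto simp: padic_integers_def)

lemma of_padic_int_in [simp]: "of_padic_int a \<in> padic_integers"
  by (auto simp: padic_integers_def)

lemma padic_integers_simps:
  assumes "x \<in> padic_integers" "y \<in> padic_integers"
  shows "x + y \<in> padic_integers" "x - y \<in> padic_integers" "x * y \<in> padic_integers"
proof -
  obtain a b where "x = of_padic_int a" "y = of_padic_int b"
    using assms padic_integersE by metis
  then show "x + y \<in> padic_integers" "x - y \<in> padic_integers" "x * y \<in> padic_integers"
    using of_padic_int_in[of "a + b"] of_padic_int_in[of "a - b"] of_padic_int_in[of "a * b"]
    by simp_all
qed

lemma padic_integers_0_1 [simp]: "0 \<in> padic_integers" "1 \<in> padic_integers"
  using of_padic_int_in[of 0] of_padic_int_in[of 1] by simp_all

lemma padic_integers_uminus: "x \<in> padic_integers \<Longrightarrow> - x \<in> padic_integers"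
  using padic_integers_simps(2)[of 0 x] by simp

lemma padic_integers_sum:
  "(\<And>i. i \<in> A \<Longrightarrow> f i \<in> padic_integers) \<Longrightarrow> sum f A \<in> padic_integers"
  by (induction A rule: infinite_finite_induct) (auto intro: padic_integers_simps)

lemma integral_vec_iff_cvec: "x \<in> carrier_vec n \<Longrightarrow> x \<in> integral_vec n \<longleftrightarrow> cvec x = 0\<^sub>v n"
  by (auto simp: integral_vec_def vec_eq_iff padic_class_eq_0_iff)

lemma cvec_eq_iff:
  "x \<in> carrier_vec n \<Longrightarrow> y \<in> carrier_vec n \<Longrightarrow> cvec x = cvec y \<longleftrightarrow> x - y \<in> integral_vec n"
  by (auto simp: integral_vec_def vec_eq_iff padic_class_eq_iff)

lemma cvec_add:
  "x \<in> carrier_vec n \<Longrightarrow> y \<in> carrier_vec n \<Longrightarrow> cvec (x + y) = cvec x + cvec y"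
  by (intro eq_vecI) (auto simp: padic_class_add)

lemma cvec_lift [simp]: "cvec (map_vec padic_lift v) = v"
  by (intro eq_vecI) auto

lemma cvec_surj:
  assumes "v \<in> carrier_vec n"
  obtains x where "x \<in> carrier_vec n" "v = cvec x"
  using that[of "map_vec padic_lift v"] assms by simp

lemma integral_vec_scalar_prod:
  "x \<in> integral_vec n \<Longrightarrow> y \<in> integral_vec n \<Longrightarrow> x \<bullet> y \<in> padic_integers"
  by (auto simp: integral_vec_def scalar_prod_def intro!: padic_integers_sum padic_integers_simps)

lemma integral_vec_mult_mat:
  "A \<in> carrier_mat m n \<Longrightarrow> x \<in> integral_vec n \<Longrightarrow> Qmat A *\<^sub>v x \<in> integral_vec m"
  by (auto simp: integral_vec_def scalar_prod_def intro!: padic_integers_sum padic_integers_simps)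

lemma integral_vec_add:
  "x \<in> integral_vec n \<Longrightarrow> y \<in> integral_vec n \<Longrightarrow> x + y \<in> integral_vec n"
  by (auto simp: integral_vec_def intro!: padic_integers_simps)

lemma integral_vec_smult:
  "x \<in> integral_vec n \<Longrightarrow> of_padic_int a \<cdot>\<^sub>v x \<in> integral_vec n"
  by (auto simp: integral_vec_def intro!: padic_integers_simps)

lemma mat_act_cvec:
  assumes "A \<in> carrier_mat m n" "x \<in> carrier_vec n"
  shows "mat_act A (cvec x) = cvec (Qmat A *\<^sub>v x)"
  using assms by (intro eq_vecI)
    (auto simp: mat_act_def scalar_prod_def padic_class_sum padic_act_class atLeast0LessThan intro!: sum.cong)

text \<open>Singular matrices are included because the bordered matrix is singular for some columns,
  and its kernel has to be a group in that case too.\<close>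

locale symmetric_matrix =
  fixes M :: "'p :: prime_card padic_int mat" and n :: nat
  assumes carrier_M: "M \<in> carrier_mat n n"
    and transpose_M: "transpose_mat M = M"
begin

abbreviation K where "K \<equiv> ker_paired M"
abbreviation Q where "Q \<equiv> Qmat M"

lemma carrier_Q [simp]: "Q \<in> carrier_mat n n"
  using carrier_M by simp

lemma Q_mult_carrier [simp]: "x \<in> carrier_vec n \<Longrightarrow> Q *\<^sub>v x \<in> carrier_vec n"
  by (rule mult_mat_vec_carrier[OF carrier_Q])

lemma dim_M [simp]: "dim_row M = n" "dim_col M = n"
  using carrier_M by auto

lemma ker_simps:
  "carrier K = {v \<in> carrier_vec n. mat_act M v = 0\<^sub>v n}" "mult K = (+)" "one K = 0\<^sub>v n"
  by (simp_all add: ker_paired_def)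

lemma cvec_in_ker_iff: "x \<in> carrier_vec n \<Longrightarrow> cvec x \<in> carrier K \<longleftrightarrow> Q *\<^sub>v x \<in> integral_vec n"
  using integral_vec_iff_cvec[of "Q *\<^sub>v x" n] mult_mat_vec_carrier[OF carrier_Q, of x]
  by (simp add: ker_simps mat_act_cvec[OF carrier_M])

lemma ker_cases:
  assumes "v \<in> carrier K"
  obtains x where "x \<in> carrier_vec n" "Q *\<^sub>v x \<in> integral_vec n" "v = cvec x"
proof -
  obtain x where "x \<in> carrier_vec n" "v = cvec x"
    using assms cvec_surj by (auto simp: ker_simps)
  with assms cvec_in_ker_iff that show ?thesis
    by blast
qed

lemma scalar_prod_Q:
  assumes "x \<in> carrier_vec n" "y \<in> carrier_vec n"
  shows "x \<bullet> (Q *\<^sub>v y) = (Q *\<^sub>v x) \<bullet> y"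
proof -
  have "transpose_mat Q = Q"
    using transpose_M by (metis map_mat_transpose)
  then show ?thesis
    using transpose_vec_mult_scalar[OF carrier_Q assms(2,1)] by simp
qed

text \<open>Other lifts \<open>x'\<close>, \<open>y'\<close> alter the value by \<open>(x' - x)
  \<bullet> (Q *\<^sub>v y) + x' \<bullet> (Q *\<^sub>v (y' - y))\<close>. By symmetry the second
  term is \<open>(Q *\<^sub>v x') \<bullet> (y' - y)\<close>, so both are products of integral
  vectors.\<close>

lemma pairing_cvec:
  assumes x: "x \<in> carrier_vec n" "Q *\<^sub>v x \<in> integral_vec n"
    and y: "y \<in> carrier_vec n" "Q *\<^sub>v y \<in> integral_vec n"
  shows "pairing K (cvec x) (cvec y) = padic_class (x \<bullet> (Q *\<^sub>v y))"
proof -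
  define x' where "x' = map_vec padic_lift (cvec x)"
  define y' where "y' = map_vec padic_lift (cvec y)"
  have x': "x' \<in> carrier_vec n" and y': "y' \<in> carrier_vec n"
    using x y by (simp_all add: x'_def y'_def)
  have u: "x' - x \<in> integral_vec n" and w: "y' - y \<in> integral_vec n"
    using x y by (simp_all add: x'_def y'_def flip: cvec_eq_iff)
  have "Q *\<^sub>v x' = Q *\<^sub>v x + Q *\<^sub>v (x' - x)"
  proof -
    have "x' = x + (x' - x)"
      using x x' by (intro eq_vecI) auto
    then show ?thesis
      using x x' mult_add_distrib_mat_vec[OF carrier_Q, of x "x' - x"] by simp
  qed
  then have Qx': "Q *\<^sub>v x' \<in> integral_vec n"
    using x u by (simp add: integral_vec_add integral_vec_mult_mat[OF carrier_M])
  have Qd: "Q *\<^sub>v (y' - y) = Q *\<^sub>v y' - Q *\<^sub>v y"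
    using y y' by (simp add: mult_minus_distrib_mat_vec[OF carrier_Q])
  have "x' \<bullet> (Q *\<^sub>v y') - x \<bullet> (Q *\<^sub>v y) = (x' - x) \<bullet> (Q *\<^sub>v y) + x' \<bullet> (Q *\<^sub>v (y' - y))"
    using x y x' y'
    unfolding Qd using mult_mat_vec_carrier[OF carrier_Q y'] mult_mat_vec_carrier[OF carrier_Q y(1)]
    by (simp add: minus_scalar_prod_distrib[of _ n] scalar_prod_minus_distrib[of _ n])
  also have "x' \<bullet> (Q *\<^sub>v (y' - y)) = (Q *\<^sub>v x') \<bullet> (y' - y)"
    using x y x' y' by (intro scalar_prod_Q) auto
  finally have "x' \<bullet> (Q *\<^sub>v y') - x \<bullet> (Q *\<^sub>v y) \<in> padic_integers"
    using u w y Qx' by (auto intro!: padic_integers_simps integral_vec_scalar_prod)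
  then show ?thesis
    by (simp add: ker_paired_def padic_class_eq_iff x'_def y'_def)
qed

lemma comm_group_ker: "comm_group K"
proof (rule comm_groupI)
  fix v w
  assume v: "v \<in> carrier K" and w: "w \<in> carrier K"
  obtain x where x: "x \<in> carrier_vec n" "Q *\<^sub>v x \<in> integral_vec n" "v = cvec x"
    using v by (rule ker_cases)
  obtain y where y: "y \<in> carrier_vec n" "Q *\<^sub>v y \<in> integral_vec n" "w = cvec y"
    using w by (rule ker_cases)
  have "cvec (x + y) \<in> carrier K"
    using x y by (simp add: cvec_in_ker_iff mult_add_distrib_mat_vec[OF carrier_Q] integral_vec_add)
  then show "v \<otimes>\<^bsub>K\<^esub> w \<in> carrier K"
    using x y by (simp add: ker_simps cvec_add)
next
  show "\<one>\<^bsub>K\<^esub> \<in> carrier K"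
    using cvec_in_ker_iff[of "0\<^sub>v n"] by (auto simp: ker_simps integral_vec_def mat_act_def padic_act_simps)
next
  fix v assume "v \<in> carrier K"
  then obtain x where x: "x \<in> carrier_vec n" "Q *\<^sub>v x \<in> integral_vec n" "v = cvec x"
    by (rule ker_cases)
  have "Q *\<^sub>v (- x) = - (Q *\<^sub>v x)"
    using x by (intro eq_vecI) auto
  also have "\<dots> \<in> integral_vec n"
    using x by (auto simp: integral_vec_def intro!: padic_integers_uminus)
  finally have "cvec (- x) \<in> carrier K"
    using x by (subst cvec_in_ker_iff) auto
  moreover have "cvec (- x) + cvec x = 0\<^sub>v n"
    using x by (intro eq_vecI) (auto simp: padic_class_minus)
  ultimately show "\<exists>w\<in>carrier K. w \<otimes>\<^bsub>K\<^esub> v = \<one>\<^bsub>K\<^esub>"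
    using x by (intro bexI[of _ "cvec (- x)"]) (auto simp: ker_simps)
qed (auto simp: ker_simps assoc_add_vec[of _ n] comm_add_vec[of _ n])

sublocale K: comm_group K
  by (rule comm_group_ker)

lemma pairing_commute:
  assumes "v \<in> carrier K" "w \<in> carrier K"
  shows "pairing K v w = pairing K w v"
proof -
  obtain x where x: "x \<in> carrier_vec n" "Q *\<^sub>v x \<in> integral_vec n" "v = cvec x"
    using assms(1) by (rule ker_cases)
  obtain y where y: "y \<in> carrier_vec n" "Q *\<^sub>v y \<in> integral_vec n" "w = cvec y"
    using assms(2) by (rule ker_cases)
  show ?thesis
    using x y scalar_prod_Q[of x y] comm_scalar_prod[OF mult_mat_vec_carrier[OF carrier_Q x(1)] y(1)] by (simp add: pairing_cvec)
qed

lemma pairing_add: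
  assumes "v \<in> carrier K" "w \<in> carrier K" "u \<in> carrier K"
  shows "pairing K (v + w) u = pairing K v u + pairing K w u"
proof -
  obtain x where x: "x \<in> carrier_vec n" "Q *\<^sub>v x \<in> integral_vec n" "v = cvec x"
    using assms(1) by (rule ker_cases)
  obtain y where y: "y \<in> carrier_vec n" "Q *\<^sub>v y \<in> integral_vec n" "w = cvec y"
    using assms(2) by (rule ker_cases)
  obtain z where z: "z \<in> carrier_vec n" "Q *\<^sub>v z \<in> integral_vec n" "u = cvec z"
    using assms(3) by (rule ker_cases)
  have "pairing K (cvec (x + y)) u = pairing K v u + pairing K w u"
    using x y z add_scalar_prod_distrib[OF x(1) y(1) Q_mult_carrier[OF z(1)]]
    by (simp add: pairing_cvec mult_add_distrib_mat_vec[OF carrier_Q] integral_vec_add padic_class_add)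
  then show ?thesis
    using x y by (simp add: cvec_add)
qed

text \<open>The classes of a null line of \<open>M\<close> over $Q_p$ lie in the kernel, and a
  non-zero coordinate on that line takes infinitely many values modulo $Z_p$.\<close>

lemma infinite_ker:
  assumes "det M = 0"
  shows "infinite (carrier K)"
proof -
  have "det Q = 0"
    using assms by simp
  then obtain u where u: "u \<in> carrier_vec n" "u \<noteq> 0\<^sub>v n" "Q *\<^sub>v u = 0\<^sub>v n"
    using det_0_iff_vec_prod_zero_field[OF carrier_Q] by blast
  then obtain i where i: "i < n" "u $ i \<noteq> 0"
    by (auto simp: vec_eq_iff)
  have "cvec (t \<cdot>\<^sub>v u) \<in> carrier K" for t
  proof -
    have "Q *\<^sub>v (t \<cdot>\<^sub>v u) = t \<cdot>\<^sub>v 0\<^sub>v n"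
      using u mult_mat_vec[OF carrier_Q u(1)] by simp
    then show ?thesis
      using u by (auto simp: cvec_in_ker_iff integral_vec_def intro!: padic_integers_simps)
  qed
  then have "range (\<lambda>t. padic_class (t * u $ i)) \<subseteq> (\<lambda>v. v $ i) ` carrier K"
    using i u by (auto intro!: image_eqI[of _ _ "cvec (t \<cdot>\<^sub>v u)" for t])
  moreover have "infinite (range (\<lambda>t. padic_class (t * u $ i)))"
    by (rule infinite_line[OF i(2)])
  ultimately show ?thesis
    by (meson finite_imageI finite_subset)
qed

end

section \<open>Non-singular matrices and perfectness\<close>

locale nonsingular_symmetric_matrix = symmetric_matrix M n
  for M :: "'p :: prime_card padic_int mat" and n :: nat +
  assumes det_M: "det M \<noteq> 0"
begin

definition Qinv where "Qinv = (1 / of_padic_int (det M)) \<cdot>\<^sub>m Qmat (adj_mat M)"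

lemma carrier_Qinv [simp]: "Qinv \<in> carrier_mat n n"
  using adj_mat(1)[OF carrier_M] by (simp add: Qinv_def)

lemma dim_Qinv [simp]: "dim_row Qinv = n" "dim_col Qinv = n"
  by (rule carrier_matD[OF carrier_Qinv])+

lemma Qinv_mult_carrier [simp]: "x \<in> carrier_vec n \<Longrightarrow> Qinv *\<^sub>v x \<in> carrier_vec n"
  by (rule mult_mat_vec_carrier[OF carrier_Qinv])

lemma adj_mult: "Qmat (adj_mat M) * Q = of_padic_int (det M) \<cdot>\<^sub>m 1\<^sub>m n"
proof -
  have "Qmat (adj_mat M) * Q = Qmat (adj_mat M * M)"
    using of_padic_int.mat_hom_mult[OF adj_mat(1)[OF carrier_M] carrier_M] by simp
  also have "\<dots> = of_padic_int (det M) \<cdot>\<^sub>m 1\<^sub>m n"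
    unfolding adj_mat(3)[OF carrier_M] by (intro eq_matI) auto
  finally show ?thesis .
qed

lemma Qinv_mult: "Qinv * Q = 1\<^sub>m n"
proof -
  have "Qinv * Q = (1 / of_padic_int (det M)) \<cdot>\<^sub>m (Qmat (adj_mat M) * Q)"
    unfolding Qinv_def using adj_mat(1)[OF carrier_M] by (intro mult_smult_assoc_mat[of _ n n _ n]) auto
  also have "\<dots> = 1\<^sub>m n"
    unfolding adj_mult using det_M by (intro eq_matI) auto
  finally show ?thesis .
qed

lemma mult_Qinv: "Q * Qinv = 1\<^sub>m n"
  by (rule mat_mult_left_right_inverse[OF carrier_Qinv carrier_Q Qinv_mult])

lemma Q_Qinv [simp]: "x \<in> carrier_vec n \<Longrightarrow> Q *\<^sub>v (Qinv *\<^sub>v x) = x"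
  using assoc_mult_mat_vec[OF carrier_Q carrier_Qinv, of x] by (simp add: mult_Qinv)

lemma Qinv_Q [simp]: "x \<in> carrier_vec n \<Longrightarrow> Qinv *\<^sub>v (Q *\<^sub>v x) = x"
  using assoc_mult_mat_vec[OF carrier_Qinv carrier_Q, of x] by (simp add: Qinv_mult)

text \<open>Cramer's rule: the adjugate is integral and takes \<open>Q *\<^sub>v x\<close> to
  \<open>det M\<close> times \<open>x\<close>, so multiplication by \<open>det M\<close>, and hence
  by \<open>p ^ d\<close>, makes \<open>x\<close> integral.\<close>

lemma p_power_kills_lift:
  assumes "det M dvd of_nat CARD('p) ^ d" "x \<in> carrier_vec n" "Q *\<^sub>v x \<in> integral_vec n"
  shows "of_padic_int (of_nat CARD('p) ^ d) \<cdot>\<^sub>v x \<in> integral_vec n"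
proof -
  obtain w where w: "of_nat CARD('p) ^ d = det M * w"
    using assms(1) by blast
  have "Qmat (adj_mat M) *\<^sub>v (Q *\<^sub>v x) = of_padic_int (det M) \<cdot>\<^sub>v x"
  proof -
    have "Qmat (adj_mat M) *\<^sub>v (Q *\<^sub>v x) = (of_padic_int (det M) \<cdot>\<^sub>m 1\<^sub>m n) *\<^sub>v x"
      unfolding adj_mult[symmetric] using adj_mat(1)[OF carrier_M] assms(2) by (subst assoc_mult_mat_vec) auto
    also have "\<dots> = of_padic_int (det M) \<cdot>\<^sub>v x"
      using assms(2) by (intro eq_vecI) auto
    finally show ?thesis .
  qed
  moreover have "Qmat (adj_mat M) *\<^sub>v (Q *\<^sub>v x) \<in> integral_vec n"
    using adj_mat(1)[OF carrier_M] assms(3) by (rule integral_vec_mult_mat)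
  ultimately have "of_padic_int w \<cdot>\<^sub>v (of_padic_int (det M) \<cdot>\<^sub>v x) \<in> integral_vec n"
    using integral_vec_smult by metis
  then show ?thesis
    by (simp add: w smult_smult_assoc mult.commute del: of_padic_int_power)
qed

lemma p_power_kills:
  assumes "det M dvd of_nat CARD('p) ^ d" "v \<in> carrier K" "i < n"
  shows "of_nat CARD('p) ^ d \<cdot>\<^sub>p v $ i = 0"
proof -
  obtain x where x: "x \<in> carrier_vec n" "Q *\<^sub>v x \<in> integral_vec n" "v = cvec x"
    using assms(2) by (rule ker_cases)
  then have "of_padic_int (of_nat CARD('p) ^ d) * x $ i \<in> padic_integers"
    using p_power_kills_lift[OF assms(1) x(1,2)] assms(3) by (simp add: integral_vec_def del: of_padic_int_power)
  then show ?thesis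
    using x assms(3) by (simp add: padic_act_class padic_class_eq_0_iff del: of_padic_int_power)
qed

text \<open>All coordinates lie in the finite \<open>p ^ d\<close>-torsion of $Q_p/Z_p$.\<close>

lemma finite_ker: "finite (carrier K)"
proof -
  obtain d where d: "det M dvd of_nat CARD('p) ^ d"
    using dvd_p_power[OF det_M] by blast
  let ?T = "{x :: 'p padic_mod. of_nat CARD('p) ^ d \<cdot>\<^sub>p x = 0}"
  have "carrier K \<subseteq> vec n ` (PiE {..<n} (\<lambda>_. ?T))"
  proof
    fix v assume v: "v \<in> carrier K"
    then have "v = vec n (restrict (\<lambda>i. v $ i) {..<n})"
      by (intro eq_vecI) (auto simp: ker_simps)
    then show "v \<in> vec n ` (PiE {..<n} (\<lambda>_. ?T))"
      using p_power_kills[OF d v] by (auto intro!: image_eqI[of v _ "restrict (\<lambda>i. v $ i) {..<n}"])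
  qed
  moreover have "finite (PiE {..<n} (\<lambda>_. ?T))"
    using finite_padic_torsion by (intro finite_PiE) auto
  ultimately show ?thesis
    using finite_surj by blast
qed

lemma ker_nat_pow:
  assumes "v \<in> carrier_vec n"
  shows "v [^]\<^bsub>K\<^esub> (m :: nat) = vec n (\<lambda>i. of_nat m \<cdot>\<^sub>p v $ i)"
proof (induction m)
  case 0
  show ?case
    by (intro eq_vecI) (auto simp: ker_simps padic_act_simps)
next
  case (Suc m)
  then show ?case
    using assms by (intro eq_vecI) (auto simp: ker_simps padic_act_simps add.commute)
qed

text \<open>The action of $Z_p$ on the kernel; \<open>padic_pow_ker\<close> identifies it with
  \<open>padic_pow\<close>.\<close>

definition scale where "scale a v = vec n (\<lambda>i. a \<cdot>\<^sub>p v $ i)"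

lemma scale_eq_nat_pow:
  assumes "det M dvd of_nat CARD('p) ^ d" "v \<in> carrier K" "d \<le> m"
  shows "v [^]\<^bsub>K\<^esub> nat (residue a m) = scale a v"
proof -
  have "v \<in> carrier_vec n"
    using assms by (simp add: ker_simps)
  then have "v [^]\<^bsub>K\<^esub> nat (residue a m) = vec n (\<lambda>i. of_nat (nat (residue a m)) \<cdot>\<^sub>p v $ i)"
    by (rule ker_nat_pow)
  also have "\<dots> = scale a v"
    unfolding scale_def using p_power_kills[OF assms(1,2)] assms(3)
    by (intro eq_vecI) (auto intro!: padic_act_residue[of d])
  finally show ?thesis .
qed

lemma scale_in_ker: "v \<in> carrier K \<Longrightarrow> scale a v \<in> carrier K"
  using scale_eq_nat_pow[of _ v] dvd_p_power[OF det_M] K.nat_pow_closed by (metis order_refl)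

text \<open>The powers that define \<open>padic_pow\<close> are constant from level \<open>d\<close>
  on, so their eventual value exists and is unique.\<close>

lemma padic_pow_ker:
  assumes "v \<in> carrier K"
  shows "padic_pow K v a = scale a v"
proof -
  obtain d where d: "det M dvd of_nat CARD('p) ^ d"
    using dvd_p_power[OF det_M] by blast
  have *: "v [^]\<^bsub>K\<^esub> residue a m = scale a v" if "d \<le> m" for m
  proof -
    have "v [^]\<^bsub>K\<^esub> residue a m = v [^]\<^bsub>K\<^esub> int (nat (residue a m))"
      using residue_bounds[of a m] by simp
    also have "\<dots> = scale a v"
      by (simp only: int_pow_int scale_eq_nat_pow[OF d assms that])
    finally show ?thesis .
  qed
  show ?thesis
    unfolding padic_pow_def
  proof (rule the_equality)
    show "\<forall>\<^sub>F m in sequentially. v [^]\<^bsub>K\<^esub> residue a m = scale a v"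
      using * eventually_sequentially by blast
    fix h assume "\<forall>\<^sub>F m in sequentially. v [^]\<^bsub>K\<^esub> residue a m = h"
    then obtain N where "\<And>m. N \<le> m \<Longrightarrow> v [^]\<^bsub>K\<^esub> residue a m = h"
      unfolding eventually_sequentially by blast
    then show "h = scale a v"
      using *[of "max N d"] by (metis max.cobounded1 max.cobounded2)
  qed
qed

text \<open>A prime \<open>q\<close> dividing the order yields an element of order \<open>q\<close>;
  since \<open>p ^ d\<close> kills the group, \<open>q\<close> divides \<open>p ^ d\<close> and
  equals \<open>p\<close>.\<close>

lemma order_ker: "\<exists>m. order K = CARD('p) ^ m"
proof -
  obtain d where d: "det M dvd of_nat CARD('p) ^ d"
    using dvd_p_power[OF det_M] by blast
  have p: "prime CARD('p)"
    by (rule prime_card)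
  have pow: "v [^]\<^bsub>K\<^esub> (CARD('p) ^ d) = \<one>\<^bsub>K\<^esub>" if "v \<in> carrier K" for v
    using that p_power_kills[OF d that] ker_nat_pow[of v "CARD('p) ^ d"]
    by (auto simp: ker_simps intro!: eq_vecI)
  have "q = CARD('p)" if q: "prime q" "q dvd order K" for q
  proof -
    \<comment> \<open>With exponent 1, Sylow's theorem serves as Cauchy's: it gives a subgroup of
      order \<open>q\<close>.\<close>
    have "order K = q ^ 1 * (order K div q)"
      using q by simp
    then obtain H where H: "subgroup H K" "card H = q ^ 1"
      using sylow_thm[OF q(1) K.group_axioms _ finite_ker] by blast
    have "H \<noteq> {\<one>\<^bsub>K\<^esub>}"
      using H(2) q(1) by (auto simp: prime_nat_iff)
    then obtain x where x: "x \<in> H" "x \<noteq> \<one>\<^bsub>K\<^esub>"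
      using subgroup.one_closed[OF H(1)] by blast
    have xK: "x \<in> carrier K"
      using x(1) H(1) subgroup.mem_carrier by fastforce
    have "x [^]\<^bsub>K\<^esub> q = \<one>\<^bsub>K\<^esub>"
    proof -
      interpret H: group "K\<lparr>carrier := H\<rparr>"
        using H(1) K.group_axioms by (rule subgroup.subgroup_is_group)
      have "x [^]\<^bsub>K\<lparr>carrier := H\<rparr>\<^esub> order (K\<lparr>carrier := H\<rparr>) = \<one>\<^bsub>K\<lparr>carrier := H\<rparr>\<^esub>"
        using x(1) by (intro H.pow_order_eq_1) simp
      then show ?thesis
        using H(2) by (simp add: order_def nat_pow_def)
    qed
    then have "K.ord x dvd q"
      using K.pow_eq_id[OF xK] by blast
    moreover have "K.ord x \<noteq> 1"
      using K.ord_eq_1[OF xK] x(2) by blast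
    ultimately have "K.ord x = q"
      using q(1) unfolding prime_nat_iff by metis
    moreover have "K.ord x dvd CARD('p) ^ d"
      using K.pow_eq_id[OF xK] pow[OF xK] by blast
    ultimately have "q dvd CARD('p)"
      using q(1) prime_dvd_power by blast
    then show ?thesis
      using p q(1) primes_dvd_imp_eq by blast
  qed
  moreover have "order K > 0"
    using finite_ker K.order_gt_0_iff_finite by blast
  ultimately have "prime_factors (order K) \<subseteq> {CARD('p)}"
    by (auto simp: prime_factors_dvd)
  have "order K = (\<Prod>q\<in>prime_factors (order K). q ^ multiplicity q (order K))"
    using \<open>order K > 0\<close> by (intro prime_factorization_nat)
  \<comment> \<open>In a trivial group there are no prime factors; the factor added for
    \<open>CARD('p)\<close> then has exponent 0.\<close>
  also have "\<dots> = (\<Prod>q\<in>{CARD('p)}. q ^ multiplicity q (order K))"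
    using \<open>prime_factors (order K) \<subseteq> {CARD('p)}\<close> \<open>order K > 0\<close> p
    by (intro prod.mono_neutral_left) (auto simp: prime_factors_multiplicity)
  finally show ?thesis
    by (intro exI[of _ "multiplicity CARD('p) (order K)"]) simp
qed

text \<open>
  Pairing with these elements reads off coordinates, so the element that represents a
  homomorphism to $\mathbb{Q}_p/\mathbb{Z}_p$ is the vector of its values on them.
\<close>

definition dual_basis where "dual_basis i = cvec (Qinv *\<^sub>v unit_vec n i)"

lemma unit_vec_integral: "(unit_vec n i :: 'p padic vec) \<in> integral_vec n"
  by (auto simp: integral_vec_def unit_vec_def)

lemma dual_basis_in_ker: "dual_basis i \<in> carrier K"
  unfolding dual_basis_def using unit_vec_integral by (subst cvec_in_ker_iff) auto

lemma pairing_dual_basis: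
  assumes "v \<in> carrier K" "i < n"
  shows "pairing K v (dual_basis i) = v $ i"
proof -
  obtain x where x: "x \<in> carrier_vec n" "Q *\<^sub>v x \<in> integral_vec n" "v = cvec x"
    using assms(1) by (rule ker_cases)
  have e: "Qinv *\<^sub>v unit_vec n i \<in> carrier_vec n"
    by simp
  have "pairing K (cvec x) (dual_basis i) = padic_class (x \<bullet> (Q *\<^sub>v (Qinv *\<^sub>v unit_vec n i)))"
    unfolding dual_basis_def using x e unit_vec_integral by (intro pairing_cvec) auto
  then show ?thesis
    using assms(2) x by simp
qed

text \<open>The dual basis generates the kernel over $Z_p$: a lift \<open>x\<close> with
  \<open>Q *\<^sub>v x\<close> equal to \<open>a\<close> is the combination of the
  \<open>Qinv *\<^sub>v unit_vec n i\<close> with coefficients \<open>a i\<close>. So \<phi> is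
  determined by its values there, and the vector of these values is the only candidate. It lies in
  the kernel because \<phi> respects the relations among the generators.\<close>

lemma perfect_ker: "perfect_paired_p_group K"
proof -
  have "\<exists>!x. x \<in> carrier K \<and> (\<forall>y\<in>carrier K. pairing K x y = \<phi> y)"
    if "\<forall>x\<in>carrier K. \<forall>y\<in>carrier K. \<phi> (x \<otimes>\<^bsub>K\<^esub> y) = \<phi> x + \<phi> y" for \<phi>
  proof -
    have add: "\<phi> (x \<otimes>\<^bsub>K\<^esub> y) = \<phi> x + \<phi> y" if "x \<in> carrier K" "y \<in> carrier K" for x y
      using \<open>\<forall>x\<in>carrier K. \<forall>y\<in>carrier K. \<phi> (x \<otimes>\<^bsub>K\<^esub> y) = \<phi> x + \<phi> y\<close> that by blast
    have zero: "\<phi> \<one>\<^bsub>K\<^esub> = 0"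
      using add[of "\<one>\<^bsub>K\<^esub>" "\<one>\<^bsub>K\<^esub>"] by simp
    have pow: "\<phi> (x [^]\<^bsub>K\<^esub> (m :: nat)) = of_nat m \<cdot>\<^sub>p \<phi> x" if "x \<in> carrier K" for x m
      using that by (induction m) (auto simp: zero add padic_act_simps add.commute)
    obtain d where d: "det M dvd of_nat CARD('p) ^ d"
      using dvd_p_power[OF det_M] by blast
    \<comment> \<open>Additivity of \<phi> alone gives natural multiples; torsion upgrades it to
      $Z_p$-linearity.\<close>
    have scale: "\<phi> (scale a x) = a \<cdot>\<^sub>p \<phi> x" if x: "x \<in> carrier K" for a x
    proof -
      have "x [^]\<^bsub>K\<^esub> (CARD('p) ^ d) = vec n (\<lambda>i. of_nat CARD('p) ^ d \<cdot>\<^sub>p x $ i)"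
        using x ker_nat_pow[of x "CARD('p) ^ d"] by (simp add: ker_simps)
      also have "\<dots> = \<one>\<^bsub>K\<^esub>"
        using p_power_kills[OF d x] by (auto simp: ker_simps intro!: eq_vecI)
      finally have "of_nat CARD('p) ^ d \<cdot>\<^sub>p \<phi> x = 0"
        using pow[OF x, of "CARD('p) ^ d"] by (simp add: zero)
      then show ?thesis
        using pow[OF x, of "nat (residue a d)"] by (simp add: scale_eq_nat_pow[OF d x] padic_act_residue)
    qed
    have expand: "\<phi> (cvec x) = (\<Sum>i<n. a i \<cdot>\<^sub>p \<phi> (dual_basis i))"
      if x: "x \<in> carrier_vec n" and a: "Q *\<^sub>v x = vec n (\<lambda>i. of_padic_int (a i))" for x a
    proof -
      \<comment> \<open>\<open>u m\<close> keeps the first \<open>m\<close> coordinates of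
        \<open>Q *\<^sub>v x\<close>, so the induction adds one generator at a time.\<close>
      define u where "u m = vec n (\<lambda>i. if i < m then of_padic_int (a i) else 0)" for m
      have u: "u m \<in> carrier_vec n" "u m \<in> integral_vec n" for m
        by (auto simp: u_def integral_vec_def)
      have u_in: "cvec (Qinv *\<^sub>v u m) \<in> carrier K" for m
        using u by (subst cvec_in_ker_iff) auto
      have "\<phi> (cvec (Qinv *\<^sub>v u m)) = (\<Sum>i<m. a i \<cdot>\<^sub>p \<phi> (dual_basis i))" if "m \<le> n" for m
        using that
      proof (induction m)
        case 0
        have "Qinv *\<^sub>v u 0 = 0\<^sub>v n"
          by (intro eq_vecI) (auto simp: u_def scalar_prod_def)
        moreover have "cvec (0\<^sub>v n) = \<one>\<^bsub>K\<^esub>"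
          by (intro eq_vecI) (auto simp: ker_simps)
        ultimately show ?case
          using zero by simp
      next
        case (Suc m)
        have "u (Suc m) = u m + of_padic_int (a m) \<cdot>\<^sub>v unit_vec n m"
          by (intro eq_vecI) (auto simp: u_def unit_vec_def less_Suc_eq)
        then have "Qinv *\<^sub>v u (Suc m) = Qinv *\<^sub>v u m + of_padic_int (a m) \<cdot>\<^sub>v (Qinv *\<^sub>v unit_vec n m)"
          using u by (simp add: mult_add_distrib_mat_vec[OF carrier_Qinv] mult_mat_vec[OF carrier_Qinv])
        moreover have "cvec (of_padic_int (a m) \<cdot>\<^sub>v (Qinv *\<^sub>v unit_vec n m)) = scale (a m) (dual_basis m)"
          using carrier_Qinv by (intro eq_vecI) (auto simp: scale_def dual_basis_def padic_act_class)
        ultimately have "cvec (Qinv *\<^sub>v u (Suc m)) = cvec (Qinv *\<^sub>v u m) \<otimes>\<^bsub>K\<^esub> scale (a m) (dual_basis m)"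
          using u by (simp add: ker_simps cvec_add[of _ n])
        then show ?case
          using Suc by (simp add: add[OF u_in scale_in_ker[OF dual_basis_in_ker]] scale[OF dual_basis_in_ker])
      qed
      from this[of n] have "\<phi> (cvec (Qinv *\<^sub>v u n)) = (\<Sum>i<n. a i \<cdot>\<^sub>p \<phi> (dual_basis i))"
        by simp
      moreover have "u n = Q *\<^sub>v x"
        unfolding a by (auto simp: u_def)
      ultimately show ?thesis
        using x by simp
    qed
    define x where "x = vec n (\<lambda>i. \<phi> (dual_basis i))"
    have x_carrier: "x \<in> carrier_vec n"
      by (simp add: x_def)
    have "mat_act M x $ i = 0" if i: "i < n" for i
    proof -
      \<comment> \<open>A unit vector is zero in the kernel, while its expansion has column
        \<open>i\<close> of \<open>M\<close> as coefficients. By symmetry of \<open>M\<close> this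
        is row \<open>i\<close> of the equation for \<open>x\<close>.\<close>
      have "Q *\<^sub>v unit_vec n i = vec n (\<lambda>j. of_padic_int (M $$ (j, i)))"
        using i by (intro eq_vecI) auto
      from expand[OF _ this] have "(\<Sum>j<n. M $$ (j, i) \<cdot>\<^sub>p \<phi> (dual_basis j)) = \<phi> (cvec (unit_vec n i))"
        by simp
      also have "cvec (unit_vec n i) = \<one>\<^bsub>K\<^esub>"
        using unit_vec_integral integral_vec_iff_cvec[of "unit_vec n i :: 'p padic vec" n] by (simp add: ker_simps)
      finally have "(\<Sum>j<n. M $$ (j, i) \<cdot>\<^sub>p x $ j) = 0"
        by (simp add: zero x_def)
      moreover have "M $$ (j, i) = M $$ (i, j)" if "j < n" for j
        using transpose_M i that dim_M by (metis index_transpose_mat(1))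
      ultimately show ?thesis
        using i by (simp add: mat_act_def)
    qed
    then have x_ker: "x \<in> carrier K"
      using x_carrier by (auto simp: ker_simps mat_act_def intro!: eq_vecI)
    have "pairing K x y = \<phi> y" if y: "y \<in> carrier K" for y
    proof -
      obtain y' where y': "y' \<in> carrier_vec n" "Q *\<^sub>v y' \<in> integral_vec n" "y = cvec y'"
        using y by (rule ker_cases)
      obtain x' where x': "x' \<in> carrier_vec n" "Q *\<^sub>v x' \<in> integral_vec n" "x = cvec x'"
        using x_ker by (rule ker_cases)
      have "\<forall>i. \<exists>a. i < n \<longrightarrow> (Q *\<^sub>v y') $ i = of_padic_int a"
        using y'(2) unfolding integral_vec_def padic_integers_def by blast
      then obtain a where a: "\<And>i. i < n \<Longrightarrow> (Q *\<^sub>v y') $ i = of_padic_int (a i)"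
        by metis
      have Qy: "Q *\<^sub>v y' = vec n (\<lambda>i. of_padic_int (a i))"
        using y'(1) a by (intro eq_vecI) auto
      have "pairing K x y = padic_class (\<Sum>i<n. of_padic_int (a i) * x' $ i)"
        using pairing_cvec[OF x'(1,2) y'(1,2)]
        by (simp add: x'(3) y'(3) Qy scalar_prod_def atLeast0LessThan mult.commute)
      also have "\<dots> = (\<Sum>i<n. a i \<cdot>\<^sub>p x $ i)"
        using x' by (simp add: padic_class_sum padic_act_class)
      also have "\<dots> = \<phi> y"
        using expand[OF y'(1) Qy] by (simp add: y'(3) x_def)
      finally show ?thesis .
    qed
    moreover have "x' = x" if x': "x' \<in> carrier K" "\<forall>y\<in>carrier K. pairing K x' y = \<phi> y" for x'
    proof (rule eq_vecI)
      show "dim_vec x' = dim_vec x"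
        using x' by (simp add: ker_simps x_def)
      fix i assume "i < dim_vec x"
      then have "i < n"
        by (simp add: x_def)
      then show "x' $ i = x $ i"
        using pairing_dual_basis[OF x'(1), of i] x'(2) dual_basis_in_ker by (simp add: x_def)
    qed
    ultimately show ?thesis
      using x_ker by blast
  qed
  then show ?thesis
    unfolding perfect_paired_p_group_def
    using comm_group_ker finite_ker order_ker pairing_commute pairing_add by (simp add: ker_simps(2))
qed

end

section \<open>Isomorphism classes\<close>

lemma paired_iso_finite:
  "paired_iso G H \<Longrightarrow> finite (carrier G) \<longleftrightarrow> finite (carrier H)"
  by (auto simp: paired_iso_def iso_def dest: bij_betw_finite)

lemma iso_class_infinite: "infinite (carrier G) \<Longrightarrow> iso_class G = {}"
  using paired_iso_finite by (auto simp: iso_class_def)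

text \<open>Extends \<open>iso_class_eq_iff\<close> to infinite groups, for which both classes are
  empty. Columns with a singular bordered matrix need this case.\<close>

lemma iso_class_cong:
  fixes G :: "('a, 'p :: prime_card) paired_group" and H :: "('b, 'p) paired_group"
  assumes "group G" "group H" "paired_iso G H"
  shows "iso_class G = iso_class H"
proof -
  have eq: "finite (carrier G) \<longleftrightarrow> finite (carrier H)"
    using assms(3) by (rule paired_iso_finite)
  show ?thesis
  proof (cases "finite (carrier G)")
    case True
    then show ?thesis
      using assms eq iso_class_eq_iff by blast
  next
    case False
    then show ?thesis
      using eq iso_class_infinite[of G] iso_class_infinite[of H] by simp
  qed
qed

lemma perfect_transfer:
  fixes G :: "('a, 'p :: prime_card) paired_group" and H :: "('b, 'p) paired_group"
  assumes G: "perfect_paired_p_group G" and H: "monoid H" and iso: "h \<in> iso G H"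
    and pairing: "\<And>x y. x \<in> carrier G \<Longrightarrow> y \<in> carrier G \<Longrightarrow> pairing H (h x) (h y) = pairing G x y"
  shows "perfect_paired_p_group H"
proof -
  interpret G: comm_group G
    using G by (simp add: perfect_paired_p_group_def)
  note G' = G[unfolded perfect_paired_p_group_def]
  have fin: "finite (carrier G)" and ord: "\<exists>m. order G = CARD('p) ^ m"
    using G' by simp_all
  have sym: "pairing G x y = pairing G y x" if "x \<in> carrier G" "y \<in> carrier G" for x y
    using G' that by simp
  have add: "pairing G (x \<otimes>\<^bsub>G\<^esub> y) z = pairing G x z + pairing G y z"
    if "x \<in> carrier G" "y \<in> carrier G" "z \<in> carrier G" for x y z
    using G'[THEN conjunct2, THEN conjunct2, THEN conjunct2, THEN conjunct2, THEN conjunct1] that by simp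
  note dual = G'[THEN conjunct2, THEN conjunct2, THEN conjunct2, THEN conjunct2, THEN conjunct2, THEN spec, THEN mp]
  have bij: "bij_betw h (carrier G) (carrier H)" 
    and mult: "\<And>x y. x \<in> carrier G \<Longrightarrow> y \<in> carrier G \<Longrightarrow> h (x \<otimes>\<^bsub>G\<^esub> y) = h x \<otimes>\<^bsub>H\<^esub> h y"
    using iso by (auto simp: iso_def hom_def)
  have H_eq: "carrier H = h ` carrier G"
    using bij by (simp add: bij_betw_def)
  have comm: "comm_group H"
    using G.iso_imp_comm_group[OF _ H] iso by (auto simp: is_iso_def)
  have "\<exists>!x. x \<in> carrier H \<and> (\<forall>y\<in>carrier H. pairing H x y = \<phi> y)"
    if \<phi>: "\<forall>x\<in>carrier H. \<forall>y\<in>carrier H. \<phi> (x \<otimes>\<^bsub>H\<^esub> y) = \<phi> x + \<phi> y" for \<phi>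
  proof -
    have "\<forall>x\<in>carrier G. \<forall>y\<in>carrier G. \<phi> (h (x \<otimes>\<^bsub>G\<^esub> y)) = \<phi> (h x) + \<phi> (h y)"
      using \<phi> by (simp add: H_eq mult)
    from dual[OF this] obtain x where x: "x \<in> carrier G" "\<forall>y\<in>carrier G. pairing G x y = \<phi> (h y)"
      and uniq: "\<And>x'. x' \<in> carrier G \<Longrightarrow> \<forall>y\<in>carrier G. pairing G x' y = \<phi> (h y) \<Longrightarrow> x' = x"
      by blast
    show ?thesis
    proof (intro ex1I[of _ "h x"] conjI)
      show "h x \<in> carrier H" "\<forall>y\<in>carrier H. pairing H (h x) y = \<phi> y"
        using x by (auto simp: H_eq pairing)
      fix z assume z: "z \<in> carrier H \<and> (\<forall>y\<in>carrier H. pairing H z y = \<phi> y)"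
      then obtain x' where x': "x' \<in> carrier G" "z = h x'"
        by (auto simp: H_eq)
      then have "\<forall>y\<in>carrier G. pairing G x' y = \<phi> (h y)"
        using z by (auto simp: H_eq pairing)
      then show "z = h x"
        using uniq x' by simp
    qed
  qed
  moreover have "order H = order G"
    using bij by (simp add: order_def bij_betw_same_card)
  moreover have "pairing H x y = pairing H y x" if xy: "x \<in> carrier H" "y \<in> carrier H" for x y
  proof -
    obtain x' y' where "x = h x'" "y = h y'" "x' \<in> carrier G" "y' \<in> carrier G"
      using xy by (auto simp: H_eq)
    then show ?thesis
      using sym[of x' y'] by (simp add: pairing)
  qed
  moreover have "pairing H (x \<otimes>\<^bsub>H\<^esub> y) z = pairing H x z + pairing H y z"
    if xyz: "x \<in> carrier H" "y \<in> carrier H" "z \<in> carrier H" for x y z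
  proof -
    obtain x' y' z' where "x = h x'" "y = h y'" "z = h z'" "x' \<in> carrier G" "y' \<in> carrier G" "z' \<in> carrier G"
      using xyz by (auto simp: H_eq)
    then show ?thesis
      using add[of x' y' z'] by (simp add: pairing flip: mult)
  qed
  moreover have "finite (carrier H)"
    using fin by (simp add: H_eq)
  ultimately show ?thesis
    unfolding perfect_paired_p_group_def using comm ord
    by (intro conjI ballI allI impI) simp_all
qed

text \<open>\<open>perfect_classes\<close> is built from groups on natural numbers, so the group is
  first copied along an injection and perfectness is carried over to the copy.\<close>

lemma perfect_iso_class:
  fixes G :: "('a, 'p :: prime_card) paired_group"
  assumes G: "perfect_paired_p_group G"
  shows "iso_class G \<in> perfect_classes"
proof -
  interpret G: comm_group G
    using G by (simp add: perfect_paired_p_group_def)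
  have fin: "finite (carrier G)"
    using G by (simp add: perfect_paired_p_group_def)
  obtain f :: "'a \<Rightarrow> nat" where f: "inj_on f (carrier G)"
    using finite_imp_inj_to_nat_seg[OF fin] by blast
  define g where "g = inv_into (carrier G) f"
  have g: "g (f x) = x" if "x \<in> carrier G" for x
    using f that by (simp add: g_def)
  define H :: "(nat, 'p) paired_group" where
    "H = \<lparr>carrier = f ` carrier G, mult = (\<lambda>x y. f (g x \<otimes>\<^bsub>G\<^esub> g y)), one = f \<one>\<^bsub>G\<^esub>,
          pairing = (\<lambda>x y. pairing G (g x) (g y))\<rparr>"
  have "group H"
  proof (rule groupI)
    fix x assume "x \<in> carrier H"
    then obtain a where a: "a \<in> carrier G" "x = f a"
      by (auto simp: H_def)
    then show "\<exists>y\<in>carrier H. y \<otimes>\<^bsub>H\<^esub> x = \<one>\<^bsub>H\<^esub>"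
      by (intro bexI[of _ "f (inv\<^bsub>G\<^esub> a)"]) (auto simp: H_def g)
  qed (auto simp: H_def g G.m_assoc)
  then interpret H: group H .
  have iso: "f \<in> iso G H"
    using f by (auto simp: iso_def hom_def H_def bij_betw_def g)
  have pairing: "pairing H (f x) (f y) = pairing G x y" if "x \<in> carrier G" "y \<in> carrier G" for x y
    using that by (simp add: H_def g)
  have "perfect_paired_p_group H"
    using G H.monoid_axioms iso pairing by (rule perfect_transfer)
  moreover have "iso_class G = iso_class H"
    using iso pairing by (intro iso_class_cong) (auto simp: paired_iso_def)
  ultimately show ?thesis
    unfolding perfect_classes_def by blast
qed

section \<open>Stability of the kernel under small perturbations\<close>

lemma residue_eq_iff_dvd:
  fixes x y :: "'p :: prime_card padic_int"
  shows "residue y m = residue x m \<longleftrightarrow> of_nat CARD('p) ^ m dvd y - x"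
  unfolding residue_eq_iff dvd_def by (auto simp: algebra_simps)

lemma dvd_diff_prod:
  fixes f g :: "'b \<Rightarrow> 'a :: comm_ring_1"
  assumes "\<And>i. i \<in> A \<Longrightarrow> q dvd f i - g i"
  shows "q dvd prod f A - prod g A"
  using assms
proof (induction A rule: infinite_finite_induct)
  case (insert i A)
  have "f i * prod f A - g i * prod g A = (f i - g i) * prod f A + g i * (prod f A - prod g A)"
    by (simp add: algebra_simps)
  then show ?case
    using insert by simp
qed simp_all

text \<open>By the Leibniz formula the determinant is an integral polynomial in the entries, so it
  respects congruences.\<close>

lemma dvd_diff_det:
  fixes A B :: "'a :: comm_ring_1 mat"
  assumes AB: "A \<in> carrier_mat n n" "B \<in> carrier_mat n n"
    and dvd: "\<And>i j. i < n \<Longrightarrow> j < n \<Longrightarrow> q dvd A $$ (i, j) - B $$ (i, j)"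
  shows "q dvd det A - det B"
proof -
  have "det A - det B = (\<Sum>\<pi>\<in>{\<pi>. \<pi> permutes {0..<n}}.
      signof \<pi> * ((\<Prod>i = 0..<n. A $$ (i, \<pi> i)) - (\<Prod>i = 0..<n. B $$ (i, \<pi> i))))"
    by (simp add: det_def'[OF AB(1)] det_def'[OF AB(2)] right_diff_distrib sum_subtractf)
  moreover have "q dvd (\<Prod>i = 0..<n. A $$ (i, \<pi> i)) - (\<Prod>i = 0..<n. B $$ (i, \<pi> i))"
    if "\<pi> permutes {0..<n}" for \<pi>
    using permutes_in_image[OF that] by (intro dvd_diff_prod dvd) auto
  ultimately show ?thesis
    by (auto intro!: dvd_sum)
qed

context nonsingular_symmetric_matrix
begin

text \<open>
  Both kernels are killed by \<open>p ^ d\<close>, so a perturbation by multiples of \<open>p ^ N\<close> with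
  \<open>N > 2 * d\<close> changes neither the kernel nor the pairing on it.
\<close>

lemma ker_locally_constant:
  assumes d: "det M dvd of_nat CARD('p) ^ d" and N: "2 * d < N"
    and sym: "symmetric_matrix M' n"
    and res: "\<And>i j. i < n \<Longrightarrow> j < n \<Longrightarrow> residue (M' $$ (i, j)) N = residue (M $$ (i, j)) N"
  shows "det M' \<noteq> 0" "iso_class (ker_paired M') = iso_class (ker_paired M)"
proof -
  interpret M': symmetric_matrix M' n
    by (fact sym)
  let ?P = "of_nat CARD('p) :: 'p padic_int"
  have dvd: "?P ^ N dvd M' $$ (i, j) - M $$ (i, j)" if "i < n" "j < n" for i j
    using res[OF that] by (simp add: residue_eq_iff_dvd)
  have "?P ^ N dvd det M' - det M"
    by (rule dvd_diff_det[OF M'.carrier_M carrier_M dvd])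
  then obtain e where e: "det M' = det M + ?P ^ N * e"
    by (metis diff_eq_eq dvd_def add.commute)
  obtain w where w: "?P ^ d = det M * w"
    using d by blast
  \<comment> \<open>Because \<open>N\<close> exceeds \<open>d\<close>, a factor \<open>p\<close> is
    left over once \<open>det M\<close> is split off \<open>p ^ N\<close>: the two determinants
    differ by a factor that is 1 modulo \<open>p\<close>, a unit.\<close>
  obtain j where j: "N = d + Suc j"
    using N less_imp_Suc_add[of d N] by auto
  have "det M' = det M * (1 + ?P * (w * ?P ^ j * e))"
    by (simp add: e j power_add w algebra_simps)
  moreover obtain u where "(1 + ?P * (w * ?P ^ j * e)) * u = 1"
    using one_plus_p_is_unit by blast
  ultimately have u: "det M' * u = det M"
    by (simp add: mult.assoc)
  then show nz: "det M' \<noteq> 0"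
    using det_M by auto
  interpret M': nonsingular_symmetric_matrix M' n
    by standard (fact nz)
  \<comment> \<open>The determinants are associated, so the same exponent \<open>d\<close> kills
    both kernels.\<close>
  have d': "det M' dvd ?P ^ d"
    using d u by (metis dvd_mult_left)
  obtain E where E: "\<And>i j. i < n \<Longrightarrow> j < n \<Longrightarrow> M' $$ (i, j) = M $$ (i, j) + ?P ^ N * E i j"
  proof -
    have "\<forall>i j. \<exists>c. i < n \<longrightarrow> j < n \<longrightarrow> M' $$ (i, j) = M $$ (i, j) + ?P ^ N * c"
      using dvd by (metis diff_eq_eq dvd_def add.commute)
    then show ?thesis
      using that by metis
  qed
  have act: "mat_act M' v = mat_act M v" if v: "\<And>i. i < n \<Longrightarrow> ?P ^ d \<cdot>\<^sub>p v $ i = 0" for v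
  proof -
    have "M' $$ (i, j) \<cdot>\<^sub>p v $ j = M $$ (i, j) \<cdot>\<^sub>p v $ j" if "i < n" "j < n" for i j
    proof -
      have "?P ^ N * E i j = ?P ^ (N - d) * E i j * ?P ^ d"
        using N by (simp add: mult.commute mult.left_commute flip: power_add)
      then have "(?P ^ N * E i j) \<cdot>\<^sub>p v $ j = (?P ^ (N - d) * E i j) \<cdot>\<^sub>p (?P ^ d \<cdot>\<^sub>p v $ j)"
        by (simp only: padic_act_simps(3))
      then show ?thesis
        unfolding v[OF that(2)] by (simp add: E[OF that] padic_act_simps(2,6))
    qed
    then show ?thesis
      by (auto simp: mat_act_def intro!: eq_vecI)
  qed
  have carrier: "carrier (ker_paired M') = carrier K"
  proof (intro equalityI subsetI)
    fix v assume v: "v \<in> carrier K"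
    have "mat_act M' v = mat_act M v"
      by (rule act) (rule p_power_kills[OF d v])
    with v show "v \<in> carrier (ker_paired M')"
      by (simp add: ker_simps M'.ker_simps)
  next
    fix v assume v: "v \<in> carrier (ker_paired M')"
    have "mat_act M' v = mat_act M v"
      by (rule act) (rule M'.p_power_kills[OF d' v])
    with v show "v \<in> carrier K"
      by (simp add: ker_simps M'.ker_simps)
  qed
  have pairing: "pairing (ker_paired M') v w = pairing K v w" if v: "v \<in> carrier K" and w: "w \<in> carrier K" for v w
  proof -
    obtain x where x: "x \<in> carrier_vec n" "Q *\<^sub>v x \<in> integral_vec n" "v = cvec x"
      using v by (rule ker_cases)
    obtain y where y: "y \<in> carrier_vec n" "Q *\<^sub>v y \<in> integral_vec n" "w = cvec y"
      using w by (rule ker_cases)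
    have x': "M'.Q *\<^sub>v x \<in> integral_vec n" and y': "M'.Q *\<^sub>v y \<in> integral_vec n"
      using v w x y carrier M'.cvec_in_ker_iff by auto
    let ?E = "Qmat (mat n n (\<lambda>(i, j). E i j))"
    let ?q = "of_padic_int (?P ^ d)"
    have E_carrier: "?E \<in> carrier_mat n n"
      by simp
    have "M'.Q *\<^sub>v y = Q *\<^sub>v y + of_padic_int (?P ^ N) \<cdot>\<^sub>v (?E *\<^sub>v y)"
      using y(1) by (intro eq_vecI) (auto simp: scalar_prod_def E sum_distrib_left algebra_simps sum.distrib
          simp del: of_padic_int_power intro!: sum.cong)
    then have "x \<bullet> (M'.Q *\<^sub>v y) - x \<bullet> (Q *\<^sub>v y) = of_padic_int (?P ^ N) * (x \<bullet> (?E *\<^sub>v y))"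
      using x(1) y(1) mult_mat_vec_carrier[OF E_carrier y(1)]
      by (simp add: scalar_prod_add_distrib[of _ n] scalar_prod_smult_distrib[of _ n] del: of_padic_int_power)
    \<comment> \<open>The pairing has two arguments, and each needs its own \<open>p ^ d\<close> to
      become integral; this is the source of \<open>2 * d\<close>.\<close>
    also have "\<dots> = of_padic_int (?P ^ (N - 2 * d)) * ((?q \<cdot>\<^sub>v x) \<bullet> (?E *\<^sub>v (?q \<cdot>\<^sub>v y)))"
    proof -
      have "?P ^ N = ?P ^ (N - 2 * d) * ?P ^ d * ?P ^ d"
        using N by (simp flip: power_add)
      then have "of_padic_int (?P ^ N) = of_padic_int (?P ^ (N - 2 * d)) * ?q * ?q"
        by (simp only: of_padic_int_simps)
      then show ?thesis
        using x(1) y(1) mult_mat_vec_carrier[OF E_carrier y(1)]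
        by (simp add: mult_mat_vec[OF E_carrier y(1)] smult_scalar_prod_distrib[of _ n] scalar_prod_smult_distrib[of _ n] 
          mult_ac del: of_padic_int_power)
    qed
    also have "\<dots> \<in> padic_integers"
      using p_power_kills_lift[OF d x(1,2)] p_power_kills_lift[OF d y(1,2)]
      by (intro padic_integers_simps(3) integral_vec_scalar_prod[of _ n] integral_vec_mult_mat[of _ n n])
        (auto simp del: of_padic_int_power)
    finally show ?thesis
      using M'.pairing_cvec[OF x(1) x' y(1) y'] pairing_cvec[OF x(1,2) y(1,2)]
      by (simp add: x(3) y(3) padic_class_eq_iff)
  qed
  have "id \<in> iso (ker_paired M') K"
    by (auto simp: iso_def hom_def carrier ker_simps(2) M'.ker_simps(2))
  then have "paired_iso (ker_paired M') K"
    unfolding paired_iso_def using pairing carrier by (intro bexI[of _ id]) auto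
  then show "iso_class (ker_paired M') = iso_class K"
    using M'.K.group_axioms K.group_axioms by (intro iso_class_cong)
qed

end

section \<open>Bordering a matrix\<close>

definition snoc_vec :: "'a vec \<Rightarrow> 'a \<Rightarrow> 'a vec" where
  "snoc_vec x s = vec (Suc (dim_vec x)) (\<lambda>i. if i < dim_vec x then x $ i else s)"

lemma snoc_vec_carrier [simp]: "x \<in> carrier_vec n \<Longrightarrow> snoc_vec x s \<in> carrier_vec (Suc n)"
  by (auto simp: snoc_vec_def)

lemma snoc_vec_index [simp]:
  "i < dim_vec x \<Longrightarrow> snoc_vec x s $ i = x $ i" "snoc_vec x s $ dim_vec x = s"
  "dim_vec (snoc_vec x s) = Suc (dim_vec x)"
  by (auto simp: snoc_vec_def)

lemma snoc_vec_cases: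
  assumes "z \<in> carrier_vec (Suc n)"
  obtains x s where "x \<in> carrier_vec n" "z = snoc_vec x s"
proof
  show "vec n (\<lambda>i. z $ i) \<in> carrier_vec n"
    by simp
  show "z = snoc_vec (vec n (\<lambda>i. z $ i)) (z $ n)"
    using assms by (intro eq_vecI) (auto simp: snoc_vec_def less_Suc_eq)
qed

lemma snoc_vec_add:
  "x \<in> carrier_vec n \<Longrightarrow> y \<in> carrier_vec n \<Longrightarrow> snoc_vec x s + snoc_vec y t = snoc_vec (x + y) (s + t)"
  by (intro eq_vecI) (auto simp: snoc_vec_def)

lemma snoc_vec_diff:
  "x \<in> carrier_vec n \<Longrightarrow> y \<in> carrier_vec n \<Longrightarrow> snoc_vec x s - snoc_vec y t = snoc_vec (x - y) (s - t)"
  by (intro eq_vecI) (auto simp: snoc_vec_def)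

lemma snoc_vec_scalar_prod:
  "x \<in> carrier_vec n \<Longrightarrow> y \<in> carrier_vec n \<Longrightarrow> snoc_vec x s \<bullet> snoc_vec y t = x \<bullet> y + s * t"
  by (auto simp: scalar_prod_def snoc_vec_def)

lemma snoc_vec_integral:
  "x \<in> carrier_vec n \<Longrightarrow>
    snoc_vec x s \<in> integral_vec (Suc n) \<longleftrightarrow> x \<in> integral_vec n \<and> s \<in> padic_integers"
  by (auto simp: integral_vec_def snoc_vec_def less_Suc_eq)

text \<open>Turns well-definedness on a pair of cosets into the singleton that
  \<open>the_elem\<close> in \<open>perp_quotient\<close> expects.\<close>

lemma Collect_constant:
  assumes "\<And>u w. u \<in> X \<Longrightarrow> w \<in> Y \<Longrightarrow> f u w = c" "X \<noteq> {}" "Y \<noteq> {}"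
  shows "{f u w |u w. u \<in> X \<and> w \<in> Y} = {c}"
proof -
  obtain u w where "u \<in> X" "w \<in> Y"
    using assms(2,3) by blast
  with assms(1)[OF this] show ?thesis
    using assms(1) by (auto intro!: exI[of _ u] exI[of _ w])
qed

text \<open>\<open>perp_quotient\<close> copies the fields of a factor group into a record of
  another type; the group axioms refer to these fields only.\<close>

lemma group_cong:
  assumes "group G" "carrier H = carrier G" "mult H = mult G" "one H = one G"
  shows "group H"
  using assms unfolding group_def monoid_def group_axioms_def Units_def by simp

section \<open>The product of a group with $Q_p$\<close>

lemma carrier_ext_group: "carrier (ext_group G) = carrier G \<times> UNIV"
  by (simp add: ext_group_def padic_group_def)

lemma mult_ext_group: "(x, s) \<otimes>\<^bsub>ext_group G\<^esub> (y, t) = (x \<otimes>\<^bsub>G\<^esub> y, s + t)"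
  by (simp add: ext_group_def padic_group_def)

lemma group_padic_group: "group (padic_group :: 'p :: prime_card padic monoid)"
  by (rule groupI) (auto simp: padic_group_def add.assoc intro: exI[of _ "- x" for x])

lemma group_ext_group: "group G \<Longrightarrow> group (ext_group G)"
  unfolding ext_group_def by (rule DirProd_group[OF _ group_padic_group])

locale bordered_matrix = nonsingular_symmetric_matrix M n
  for M :: "'p :: prime_card padic_int mat" and n :: nat +
  fixes v :: "nat \<Rightarrow> 'p padic_int"
begin

definition b where "b = vec n (\<lambda>i. of_padic_int (v i))"
definition c where "c = of_padic_int (v n)"
definition h where "h = Qinv *\<^sub>v b"
definition g where "g = cvec h"
text \<open>The Schur complement of \<open>M\<close> in the bordered matrix:
  \<open>h \<bullet> b\<close> is $h^T M h$, since \<open>Q *\<^sub>v h = b\<close>.\<close>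

definition q where "q = c - h \<bullet> b"

abbreviation M' where "M' \<equiv> bordered_mat n M v"
abbreviation K' where "K' \<equiv> ker_paired M'"

lemma b_carrier [simp]: "b \<in> carrier_vec n"
  by (simp add: b_def)

lemma b_integral: "b \<in> integral_vec n"
  by (simp add: b_def integral_vec_def)

lemma h_carrier [simp]: "h \<in> carrier_vec n"
  by (simp add: h_def)

lemma dim_b_h [simp]: "dim_vec b = n" "dim_vec h = n"
  by (rule carrier_vecD, simp)+

lemma Q_h [simp]: "Q *\<^sub>v h = b"
  by (simp add: h_def)

lemma g_in_ker: "g \<in> carrier K"
  using b_integral by (simp add: g_def cvec_in_ker_iff)

sublocale M': symmetric_matrix M' "Suc n"
proof
  show "M' \<in> carrier_mat (Suc n) (Suc n)"
    by (simp add: bordered_mat_def)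
  have "M $$ (i, j) = M $$ (j, i)" if "i < n" "j < n" for i j
    using transpose_M that dim_M by (metis index_transpose_mat(1))
  then show "transpose_mat M' = M'"
    by (intro eq_matI) (auto simp: bordered_mat_def)
qed

lemma bordered_mult:
  assumes "x \<in> carrier_vec n"
  shows "M'.Q *\<^sub>v snoc_vec x s = snoc_vec (Q *\<^sub>v x + s \<cdot>\<^sub>v b) (x \<bullet> b + c * s)"
  using assms
  by (intro eq_vecI)
    (auto simp: snoc_vec_def bordered_mat_def scalar_prod_def b_def c_def less_Suc_eq mult.commute intro!: sum.cong)

text \<open>Block elimination: the shift cancels \<open>s \<cdot>\<^sub>v b\<close> in the upper
  block. The last entry is what \<open>(x, s)\<close> pairs to with \<open>(h, 1)\<close>, so its
  integrality is the orthogonality to \<open>(g, 1)\<close> in \<open>ext_perp_iff\<close>.\<close>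

lemma bordered_mult_shift:
  assumes x: "x \<in> carrier_vec n"
  shows "M'.Q *\<^sub>v snoc_vec (x - s \<cdot>\<^sub>v h) s = snoc_vec (Q *\<^sub>v x) (x \<bullet> b + q * s)"
proof -
  have "Q *\<^sub>v (x - s \<cdot>\<^sub>v h) = Q *\<^sub>v x - s \<cdot>\<^sub>v b"
    using x by (simp add: mult_minus_distrib_mat_vec[OF carrier_Q] mult_mat_vec[OF carrier_Q])
  moreover have "Q *\<^sub>v x - s \<cdot>\<^sub>v b + s \<cdot>\<^sub>v b = Q *\<^sub>v x"
    using x by (intro eq_vecI) (auto simp: b_def)
  moreover have "(x - s \<cdot>\<^sub>v h) \<bullet> b + c * s = x \<bullet> b + q * s"
  proof -
    have "(x - s \<cdot>\<^sub>v h) \<bullet> b = x \<bullet> b - s * (h \<bullet> b)"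
      using x by (simp add: minus_scalar_prod_distrib[of _ n] smult_scalar_prod_distrib[of _ n])
    then show ?thesis
      by (simp only: q_def) (simp add: algebra_simps)
  qed
  ultimately show ?thesis
    using x bordered_mult[of "x - s \<cdot>\<^sub>v h" s] by simp
qed

lemma ext_pairing_cvec:
  assumes x: "x \<in> carrier_vec n" "Q *\<^sub>v x \<in> integral_vec n"
    and y: "y \<in> carrier_vec n" "Q *\<^sub>v y \<in> integral_vec n"
  shows "ext_pairing K q (cvec x, s) (cvec y, t) = padic_class (x \<bullet> (Q *\<^sub>v y) + q * s * t)"
  using pairing_cvec[OF x y] by (simp add: ext_pairing_def padic_class_add)

lemma ext_perp_iff:
  assumes x: "x \<in> carrier_vec n"
  shows "(cvec x, s) \<in> ext_perp K q g \<longleftrightarrow> Q *\<^sub>v x \<in> integral_vec n \<and> x \<bullet> b + q * s \<in> padic_integers"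
proof -
  have "(cvec x, s) \<in> ext_perp K q g \<longleftrightarrow>
      Q *\<^sub>v x \<in> integral_vec n \<and> ext_pairing K q (cvec x, s) (cvec h, 1) = 0"
    using x by (simp add: ext_perp_def carrier_ext_group g_def cvec_in_ker_iff)
  also have "\<dots> \<longleftrightarrow> Q *\<^sub>v x \<in> integral_vec n \<and> x \<bullet> b + q * s \<in> padic_integers"
    using x ext_pairing_cvec[of x h s 1] b_integral by (auto simp: padic_class_eq_0_iff)
  finally show ?thesis .
qed

lemma ext_perp_cases:
  assumes "u \<in> ext_perp K q g"
  obtains x s where "x \<in> carrier_vec n" "Q *\<^sub>v x \<in> integral_vec n" "x \<bullet> b + q * s \<in> padic_integers"
    "u = (cvec x, s)"
proof -
  obtain w s where u: "u = (w, s)"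
    by (cases u)
  have "w \<in> carrier K"
    using assms by (simp add: ext_perp_def carrier_ext_group u)
  then obtain x where "x \<in> carrier_vec n" "w = cvec x"
    by (rule ker_cases)
  with assms u show ?thesis
    using ext_perp_iff[of x s] by (intro that[of x s]) auto
qed

text \<open>\<open>h\<close> has to be a vector over $Q_p$ here: as \<open>s\<close> need not be
  integral, the class \<open>g\<close> does not determine \<open>s \<cdot>\<^sub>v h\<close> modulo
  $Z_p$. The lift of \<open>fst u\<close> is harmless by \<open>shift_cvec\<close>.\<close>

definition shift where
  "shift u = cvec (snoc_vec (map_vec padic_lift (fst u) - snd u \<cdot>\<^sub>v h) (snd u))"

lemma shift_cvec:
  assumes x: "x \<in> carrier_vec n"
  shows "shift (cvec x, s) = cvec (snoc_vec (x - s \<cdot>\<^sub>v h) s)"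
proof -
  let ?x = "map_vec padic_lift (cvec x)"
  have x': "?x \<in> carrier_vec n" "?x - x \<in> integral_vec n"
    using x by (simp_all flip: cvec_eq_iff)
  have "snoc_vec (?x - s \<cdot>\<^sub>v h) s - snoc_vec (x - s \<cdot>\<^sub>v h) s
      = snoc_vec ((?x - s \<cdot>\<^sub>v h) - (x - s \<cdot>\<^sub>v h)) (s - s)"
    using x x' by (intro snoc_vec_diff[of _ n]) auto
  also have "(?x - s \<cdot>\<^sub>v h) - (x - s \<cdot>\<^sub>v h) = ?x - x"
    using x x' by (intro eq_vecI) auto
  finally show ?thesis
    using x x' by (simp add: shift_def cvec_eq_iff[of _ "Suc n"] snoc_vec_integral)
qed

abbreviation P where "P \<equiv> ext_group K\<lparr>carrier := ext_perp K q g\<rparr>"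

lemma subgroup_ext_perp: "subgroup (ext_perp K q g) (ext_group K)"
proof (rule group.subgroupI[OF group_ext_group[OF K.group_axioms]])
  show "ext_perp K q g \<subseteq> carrier (ext_group K)"
    by (auto simp: ext_perp_def)
  have "(cvec (0\<^sub>v n), 0) \<in> ext_perp K q g"
    using ext_perp_iff[of "0\<^sub>v n" 0] carrier_Q
    by (auto simp: integral_vec_def scalar_prod_def)
  then show "ext_perp K q g \<noteq> {}"
    by blast
next
  interpret E: group "ext_group K"
    by (rule group_ext_group[OF K.group_axioms])
  fix u assume "u \<in> ext_perp K q g"
  then obtain x s where x: "x \<in> carrier_vec n" "Q *\<^sub>v x \<in> integral_vec n" "x \<bullet> b + q * s \<in> padic_integers"
    "u = (cvec x, s)"
    by (rule ext_perp_cases)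
  have "Q *\<^sub>v (- x) = - (Q *\<^sub>v x)"
    using x by (intro eq_vecI) auto
  also have "\<dots> \<in> integral_vec n"
    using x by (auto simp: integral_vec_def intro!: padic_integers_uminus)
  finally have Q: "Q *\<^sub>v (- x) \<in> integral_vec n" .
  have "(- x) \<bullet> b + q * (- s) = - (x \<bullet> b + q * s)"
    using x(1) by simp
  then have "(- x) \<bullet> b + q * (- s) \<in> padic_integers"
    using padic_integers_uminus[OF x(3)] by (simp only:)
  with x Q have perp: "(cvec (- x), - s) \<in> ext_perp K q g"
    by (subst ext_perp_iff) simp_all
  have "cvec (- x) + cvec x = 0\<^sub>v n"
    using x by (intro eq_vecI) (auto simp: padic_class_minus)
  then have "(cvec (- x), - s) \<otimes>\<^bsub>ext_group K\<^esub> u = \<one>\<^bsub>ext_group K\<^esub>"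
    by (simp add: x(4) mult_ext_group ker_simps) (simp add: ext_group_def padic_group_def ker_simps)
  moreover have "u \<in> carrier (ext_group K)" "(cvec (- x), - s) \<in> carrier (ext_group K)"
    using \<open>u \<in> ext_perp K q g\<close> perp by (auto simp: ext_perp_def)
  ultimately have "inv\<^bsub>ext_group K\<^esub> u = (cvec (- x), - s)"
    using E.inv_equality by blast
  with perp show "inv\<^bsub>ext_group K\<^esub> u \<in> ext_perp K q g"
    by simp
next
  fix u w assume u: "u \<in> ext_perp K q g" and w: "w \<in> ext_perp K q g"
  obtain x s where x: "x \<in> carrier_vec n" "Q *\<^sub>v x \<in> integral_vec n" "x \<bullet> b + q * s \<in> padic_integers"
    "u = (cvec x, s)"
    using u by (rule ext_perp_cases)
  obtain y t where y: "y \<in> carrier_vec n" "Q *\<^sub>v y \<in> integral_vec n" "y \<bullet> b + q * t \<in> padic_integers"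
    "w = (cvec y, t)"
    using w by (rule ext_perp_cases)
  have "u \<otimes>\<^bsub>ext_group K\<^esub> w = (cvec (x + y), s + t)"
    using x y by (simp add: mult_ext_group ker_simps cvec_add)
  moreover have "(x + y) \<bullet> b + q * (s + t) = (x \<bullet> b + q * s) + (y \<bullet> b + q * t)"
    using x y by (simp add: add_scalar_prod_distrib[of _ n] algebra_simps)
  then have "(x + y) \<bullet> b + q * (s + t) \<in> padic_integers"
    using x(3) y(3) by (simp only: padic_integers_simps)
  then have "(cvec (x + y), s + t) \<in> ext_perp K q g"
    using x y by (subst ext_perp_iff)
      (auto simp: mult_add_distrib_mat_vec[OF carrier_Q] integral_vec_add)
  ultimately show "u \<otimes>\<^bsub>ext_group K\<^esub> w \<in> ext_perp K q g"
    by simp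
qed

lemma group_P: "group P"
  by (rule subgroup.subgroup_is_group[OF subgroup_ext_perp group_ext_group[OF K.group_axioms]])

lemma shift_in_ker:
  assumes "u \<in> ext_perp K q g"
  shows "shift u \<in> carrier K'"
proof -
  obtain x s where x: "x \<in> carrier_vec n" "Q *\<^sub>v x \<in> integral_vec n" "x \<bullet> b + q * s \<in> padic_integers"
    "u = (cvec x, s)"
    using assms by (rule ext_perp_cases)
  have "M'.Q *\<^sub>v snoc_vec (x - s \<cdot>\<^sub>v h) s \<in> integral_vec (Suc n)"
    using x by (simp add: bordered_mult_shift snoc_vec_integral)
  then show ?thesis
    using x by (simp add: shift_cvec M'.cvec_in_ker_iff)
qed

lemma shift_hom: "shift \<in> hom P K'"
proof (rule homI)
  fix u assume "u \<in> carrier P"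
  then show "shift u \<in> carrier K'"
    by (simp add: shift_in_ker)
next
  fix u w assume "u \<in> carrier P" "w \<in> carrier P"
  then have u: "u \<in> ext_perp K q g" and w: "w \<in> ext_perp K q g"
    by simp_all
  obtain x s where x: "x \<in> carrier_vec n" "Q *\<^sub>v x \<in> integral_vec n" "x \<bullet> b + q * s \<in> padic_integers"
    "u = (cvec x, s)"
    using u by (rule ext_perp_cases)
  obtain y t where y: "y \<in> carrier_vec n" "Q *\<^sub>v y \<in> integral_vec n" "y \<bullet> b + q * t \<in> padic_integers"
    "w = (cvec y, t)"
    using w by (rule ext_perp_cases)
  have "u \<otimes>\<^bsub>P\<^esub> w = (cvec (x + y), s + t)"
    using x y by (simp add: mult_ext_group ker_simps cvec_add)
  then have "shift (u \<otimes>\<^bsub>P\<^esub> w) = cvec (snoc_vec (x + y - (s + t) \<cdot>\<^sub>v h) (s + t))"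
    using x y by (simp add: shift_cvec)
  also have "x + y - (s + t) \<cdot>\<^sub>v h = (x - s \<cdot>\<^sub>v h) + (y - t \<cdot>\<^sub>v h)"
    using x y by (intro eq_vecI) (auto simp: algebra_simps)
  also have "snoc_vec \<dots> (s + t) = snoc_vec (x - s \<cdot>\<^sub>v h) s + snoc_vec (y - t \<cdot>\<^sub>v h) t"
    using x y by (simp add: snoc_vec_add[of _ n])
  also have "cvec \<dots> = shift u \<otimes>\<^bsub>K'\<^esub> shift w"
    using x y by (simp add: shift_cvec M'.ker_simps cvec_add[of _ "Suc n"])
  finally show "shift (u \<otimes>\<^bsub>P\<^esub> w) = shift u \<otimes>\<^bsub>K'\<^esub> shift w" .
qed

sublocale shift: group_hom P K' shift
  by (intro group_hom.intro group_hom_axioms.intro group_P M'.K.group_axioms shift_hom)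

lemma shift_surj: "shift ` carrier P = carrier K'"
proof (intro equalityI subsetI)
  fix w assume "w \<in> carrier K'"
  then obtain z where z: "z \<in> carrier_vec (Suc n)" "M'.Q *\<^sub>v z \<in> integral_vec (Suc n)" "w = cvec z"
    by (rule M'.ker_cases)
  obtain y s where y: "y \<in> carrier_vec n" "z = snoc_vec y s"
    using z(1) by (rule snoc_vec_cases)
  \<comment> \<open>The inverse of the shear.\<close>
  define x where "x = y + s \<cdot>\<^sub>v h"
  have x: "x \<in> carrier_vec n"
    using y by (simp add: x_def)
  have yx: "y = x - s \<cdot>\<^sub>v h"
    using y by (intro eq_vecI) (auto simp: x_def)
  have "snoc_vec (Q *\<^sub>v x) (x \<bullet> b + q * s) \<in> integral_vec (Suc n)"
    using z(2) bordered_mult_shift[OF x, of s] by (simp add: y(2) yx)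
  then have "(cvec x, s) \<in> ext_perp K q g"
    using x by (simp add: snoc_vec_integral ext_perp_iff)
  moreover have "shift (cvec x, s) = w"
    using x by (simp add: shift_cvec z(3) y(2) yx)
  ultimately show "w \<in> shift ` carrier P"
    by (auto intro!: image_eqI[of _ _ "(cvec x, s)"])
qed (auto simp: shift_in_ker)

text \<open>\<open>x - s \<cdot>\<^sub>v h\<close> and \<open>s\<close> are both integral exactly
  when \<open>s\<close> is some p-adic integer \<open>a\<close> and \<open>x\<close> is congruent to
  \<open>a\<close> times \<open>h\<close>, that is, when the pair is \<open>a\<close> times
  \<open>(g, 1)\<close>.\<close>

lemma kernel_shift: "kernel P K' shift = ext_span K g"
proof (intro equalityI subsetI)
  fix u assume "u \<in> kernel P K' shift"
  then have u: "u \<in> ext_perp K q g" "shift u = 0\<^sub>v (Suc n)"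
    by (simp_all add: kernel_def M'.ker_simps)
  obtain x s where x: "x \<in> carrier_vec n" "Q *\<^sub>v x \<in> integral_vec n" "x \<bullet> b + q * s \<in> padic_integers"
    "u = (cvec x, s)"
    using u(1) by (rule ext_perp_cases)
  have "snoc_vec (x - s \<cdot>\<^sub>v h) s \<in> integral_vec (Suc n)"
    using x u(2) by (simp add: shift_cvec integral_vec_iff_cvec[of _ "Suc n"])
  then have xs: "x - s \<cdot>\<^sub>v h \<in> integral_vec n" "s \<in> padic_integers"
    using x by (simp_all add: snoc_vec_integral)
  obtain a where a: "s = of_padic_int a"
    using xs(2) by (rule padic_integersE)
  have "cvec x = cvec (s \<cdot>\<^sub>v h)"
    using x xs by (subst cvec_eq_iff[of _ n]) auto
  also have "\<dots> = padic_pow K g a"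
    unfolding padic_pow_ker[OF g_in_ker]
    by (intro eq_vecI) (auto simp: scale_def g_def padic_act_class a)
  finally show "u \<in> ext_span K g"
    unfolding ext_span_def x(4) a by blast
next
  fix u assume "u \<in> ext_span K g"
  then obtain a where "u = (padic_pow K g a, of_padic_int a)"
    by (auto simp: ext_span_def)
  also have "padic_pow K g a = cvec (of_padic_int a \<cdot>\<^sub>v h)"
    unfolding padic_pow_ker[OF g_in_ker]
    by (intro eq_vecI) (auto simp: scale_def g_def padic_act_class)
  finally have u: "u = (cvec (of_padic_int a \<cdot>\<^sub>v h), of_padic_int a)" .
  have "Q *\<^sub>v (of_padic_int a \<cdot>\<^sub>v h) \<in> integral_vec n"
    using b_integral by (simp add: mult_mat_vec[OF carrier_Q] integral_vec_smult)
  \<comment> \<open>Here \<open>h \<bullet> b + q = c\<close> is integral, which is the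
    self-orthogonality of \<open>(g, 1)\<close>.\<close>
  moreover have "(of_padic_int a \<cdot>\<^sub>v h) \<bullet> b + q * of_padic_int a = of_padic_int (a * v n)"
    by (simp add: smult_scalar_prod_distrib[of _ n] q_def c_def algebra_simps)
  then have "(of_padic_int a \<cdot>\<^sub>v h) \<bullet> b + q * of_padic_int a \<in> padic_integers"
    by (simp only: of_padic_int_in)
  ultimately have "u \<in> ext_perp K q g"
    by (simp add: u ext_perp_iff)
  moreover have "shift u = cvec (snoc_vec (0\<^sub>v n) (of_padic_int a))"
  proof -
    have "of_padic_int a \<cdot>\<^sub>v h - of_padic_int a \<cdot>\<^sub>v h = 0\<^sub>v n"
      by (intro eq_vecI) auto
    moreover have "shift u = cvec (snoc_vec (of_padic_int a \<cdot>\<^sub>v h - of_padic_int a \<cdot>\<^sub>v h) (of_padic_int a))"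
      unfolding u by (rule shift_cvec) simp
    ultimately show ?thesis
      by (simp only:)
  qed
  then have "shift u = 0\<^sub>v (Suc n)"
    by (intro eq_vecI) (auto simp: snoc_vec_def)
  ultimately show "u \<in> kernel P K' shift"
    by (simp add: kernel_def M'.ker_simps)
qed

text \<open>The shear is an isometry already over $Q_p$: by symmetry
  \<open>h \<bullet> (Q *\<^sub>v y)\<close> equals \<open>y \<bullet> b\<close>, and the cross
  terms cancel.\<close>

lemma pairing_shift:
  assumes u: "u \<in> ext_perp K q g" and w: "w \<in> ext_perp K q g"
  shows "pairing K' (shift u) (shift w) = ext_pairing K q u w"
proof -
  obtain x s where x: "x \<in> carrier_vec n" "Q *\<^sub>v x \<in> integral_vec n" "x \<bullet> b + q * s \<in> padic_integers"
    "u = (cvec x, s)"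
    using u by (rule ext_perp_cases)
  obtain y t where y: "y \<in> carrier_vec n" "Q *\<^sub>v y \<in> integral_vec n" "y \<bullet> b + q * t \<in> padic_integers"
    "w = (cvec y, t)"
    using w by (rule ext_perp_cases)
  have "pairing K' (shift u) (shift w)
      = padic_class (snoc_vec (x - s \<cdot>\<^sub>v h) s \<bullet> snoc_vec (Q *\<^sub>v y) (y \<bullet> b + q * t))"
    using x y by (simp add: shift_cvec M'.pairing_cvec bordered_mult_shift snoc_vec_integral)
  also have "snoc_vec (x - s \<cdot>\<^sub>v h) s \<bullet> snoc_vec (Q *\<^sub>v y) (y \<bullet> b + q * t)
      = x \<bullet> (Q *\<^sub>v y) - s * (h \<bullet> (Q *\<^sub>v y)) + s * (y \<bullet> b + q * t)"
    using x y by (simp add: snoc_vec_scalar_prod[of _ n] minus_scalar_prod_distrib[of _ n] smult_scalar_prod_distrib[of _ n])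
  also have "h \<bullet> (Q *\<^sub>v y) = y \<bullet> b"
    using scalar_prod_Q[OF h_carrier y(1)] comm_scalar_prod[OF b_carrier y(1)] by simp
  also have "x \<bullet> (Q *\<^sub>v y) - s * (y \<bullet> b) + s * (y \<bullet> b + q * t) = x \<bullet> (Q *\<^sub>v y) + q * s * t"
    by (simp add: algebra_simps)
  also have "padic_class \<dots> = ext_pairing K q u w"
    using ext_pairing_cvec[OF x(1,2) y(1,2)] by (simp add: x(4) y(4))
  finally show ?thesis .
qed

text \<open>First isomorphism theorem for \<open>shift\<close>. As \<open>shift\<close> is constant
  on cosets, \<open>pairing_shift\<close> makes \<open>ext_pairing\<close> constant on pairs of
  cosets, with the pairing of the images as its value.\<close>

lemma perp_quotient_iso:
  "paired_iso (perp_quotient K g q) K'" "group (perp_quotient K g q)"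
proof -
  let ?F = "P Mod ext_span K g"
  let ?f = "\<lambda>X. the_elem (shift ` X)"
  have simps: "carrier (perp_quotient K g q) = carrier ?F" "mult (perp_quotient K g q) = mult ?F"
    "one (perp_quotient K g q) = one ?F"
    by (simp_all add: perp_quotient_def Let_def)
  have "group ?F"
    using normal.factorgroup_is_group[OF shift.normal_kernel] by (simp add: kernel_shift)
  then show "group (perp_quotient K g q)"
    by (rule group_cong) (simp_all add: simps)
  have "?f \<in> iso ?F K'"
    using shift.FactGroup_iso_set[OF shift_surj] by (simp add: kernel_shift)
  then have iso: "?f \<in> iso (perp_quotient K g q) K'"
    by (simp add: iso_def hom_def simps)
  have const: "X \<noteq> {} \<and> X \<subseteq> ext_perp K q g \<and> (\<forall>u\<in>X. shift u = ?f X)" if X: "X \<in> carrier ?F" for X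
  proof -
    have X': "X \<in> carrier (P Mod kernel P K' shift)"
      using X by (simp add: kernel_shift)
    obtain u where u: "u \<in> carrier P" "X = kernel P K' shift #>\<^bsub>P\<^esub> u"
      using X' by (auto simp: FactGroup_def RCOSETS_def)
    have "shift z = shift u" "z \<in> ext_perp K q g" if "z \<in> X" for z
    proof -
      obtain y where y: "y \<in> kernel P K' shift" "z = y \<otimes>\<^bsub>P\<^esub> u"
        using \<open>z \<in> X\<close> unfolding u(2) r_coset_def by blast
      then have yP: "y \<in> carrier P" "shift y = \<one>\<^bsub>K'\<^esub>"
        by (simp_all add: kernel_def)
      show "shift z = shift u"
        using yP u(1) y(2) shift.hom_mult[OF yP(1) u(1)] M'.K.l_one[OF shift.hom_closed[OF u(1)]] by simp
      have "z \<in> carrier P"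
        unfolding y(2) using yP(1) u(1) by (rule shift.m_closed)
      then show "z \<in> ext_perp K q g"
        by simp
    qed
    moreover have "X \<noteq> {}"
      using shift.FactGroup_nonempty[OF X'] .
    ultimately have "shift ` X = {shift u}"
      by auto
    then show ?thesis
      using \<open>X \<noteq> {}\<close> \<open>\<And>z. z \<in> X \<Longrightarrow> z \<in> ext_perp K q g\<close> by auto
  qed
  have "pairing K' (?f X) (?f Y) = pairing (perp_quotient K g q) X Y"
    if X: "X \<in> carrier ?F" and Y: "Y \<in> carrier ?F" for X Y
  proof -
    have "{ext_pairing K q u w |u w. u \<in> X \<and> w \<in> Y} = {pairing K' (?f X) (?f Y)}"
    proof -
      have "ext_pairing K q u w = pairing K' (?f X) (?f Y)" if "u \<in> X" "w \<in> Y" for u w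
      proof -
        have "shift u = ?f X" "shift w = ?f Y" "u \<in> ext_perp K q g" "w \<in> ext_perp K q g"
          using const[OF X] const[OF Y] that by blast+
        then show ?thesis
          using pairing_shift[of u w] by metis
      qed
      then show ?thesis
        using const[OF X] const[OF Y] by (intro Collect_constant) simp_all
    qed
    then show ?thesis
      by (simp add: perp_quotient_def Let_def)
  qed
  then show "paired_iso (perp_quotient K g q) K'"
    unfolding paired_iso_def using iso by (intro bexI[of _ ?f]) (auto simp: simps)
qed

text \<open>If the bordered matrix is singular, both carriers are infinite and both classes are
  empty.\<close>

lemma iso_class_perp_quotient: "iso_class (perp_quotient K g q) = iso_class K'"
  using perp_quotient_iso M'.K.group_axioms by (intro iso_class_cong)

text \<open>Condition (B) in the definition of \<open>Delta_S\<close>: \<open>h \<bullet> b\<close>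
  represents the pairing of \<open>g\<close> with itself, and \<open>c\<close> is integral.\<close>

lemma class_q: "padic_class q = - pairing K g g"
proof -
  have "pairing K g g = padic_class (h \<bullet> b)"
    using b_integral by (simp add: g_def pairing_cvec)
  then show ?thesis
    by (simp add: q_def padic_class_diff c_def)
qed

end

section \<open>Haar measure\<close>

lemma
  shows sets_padic_haar [measurable_cong]: "sets (padic_haar :: 'p :: prime_card padic_int measure) = sets borel"
    and prob_space_padic_haar: "prob_space (padic_haar :: 'p padic_int measure)"
    and padic_haar_translate: "distr padic_haar borel (\<lambda>x. a + x) = (padic_haar :: 'p padic_int measure)"
  using normalized_haar_padic_haar[where 'p = 'p] by (simp_all add: normalized_haar_def)

lemma space_padic_haar [simp]: "space padic_haar = UNIV"
  using sets_eq_imp_space_eq[OF sets_padic_haar] by simp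

interpretation haar: prob_space "padic_haar :: 'p :: prime_card padic_int measure"
  by (rule prob_space_padic_haar)

interpretation haar_PiM: product_sigma_finite "\<lambda>_. padic_haar :: 'p :: prime_card padic_int measure"
  by (intro product_sigma_finite.intro haar.sigma_finite_measure_axioms)

lemma measurable_add_haar: "(\<lambda>x. a + x) \<in> padic_haar \<rightarrow>\<^sub>M padic_haar"
  using measurable_padic_add[of a] by (simp cong: measurable_cong_sets add: sets_padic_haar)

text \<open>A point lies in cylinders of measure $p^{-m}$ for every \<open>m\<close>.\<close>

lemma emeasure_haar_singleton: "emeasure padic_haar {x :: 'p :: prime_card padic_int} = 0"
proof (rule ccontr)
  assume "emeasure padic_haar {x} \<noteq> 0"
  then have pos: "0 < haar.prob {x}"
    by (simp add: haar.emeasure_eq_measure zero_less_measure_iff)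
  have p: "1 / real CARD('p) < 1"
    using prime_card[where 'a = 'p] prime_gt_1_nat by simp
  obtain m where m: "(1 / real CARD('p)) ^ m < haar.prob {x}"
    using real_arch_pow_inv[OF pos p] by blast
  have "ennreal (haar.prob {x}) \<le> emeasure padic_haar {y :: 'p padic_int. residue y m = residue x m}"
    unfolding haar.emeasure_eq_measure[symmetric]
    by (intro emeasure_mono) (auto simp: sets_padic_haar open_cylinder)
  also have "\<dots> = 1 / of_nat (CARD('p) ^ m)"
    using residue_bounds by (intro emeasure_haar_cylinder normalized_haar_padic_haar)
  also have "\<dots> = ennreal ((1 / real CARD('p)) ^ m)"
    by (simp add: ennreal_of_nat_eq_real_of_nat divide_ennreal power_one_over flip: ennreal_1 of_nat_power)
  finally show False
    using m by (simp add: ennreal_le_iff)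
qed

text \<open>An open set is the union of the cylinders it contains, and there are only countably many
  cylinders.\<close>

lemma sets_PiM_haar:
  fixes A :: "('i \<Rightarrow> 'p :: prime_card padic_int) set"
  assumes I: "finite I" and A: "A \<subseteq> space (\<Pi>\<^sub>M i\<in>I. padic_haar)"
    and loc: "\<And>v. v \<in> A \<Longrightarrow> \<exists>N. \<forall>w\<in>space (\<Pi>\<^sub>M i\<in>I. padic_haar).
      (\<forall>i\<in>I. residue (w i) N = residue (v i) N) \<longrightarrow> w \<in> A"
  shows "A \<in> sets (\<Pi>\<^sub>M i\<in>I. padic_haar)"
proof -
  let ?C = "\<lambda>(N, r). PiE I (\<lambda>i. {x :: 'p padic_int. residue x N = r i})"
  \<comment> \<open>Taking \<open>r\<close> extensional on the finite set \<open>I\<close> keeps the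
    set of codes countable.\<close>
  let ?X = "{Nr \<in> UNIV \<times> PiE I (\<lambda>_. UNIV). ?C Nr \<subseteq> A}"
  have "countable (PiE I (\<lambda>_. UNIV :: int set))"
    using I by (intro countable_PiE) auto
  then have "countable ?X"
    by (intro countable_subset[of ?X "(UNIV :: nat set) \<times> PiE I (\<lambda>_. UNIV)"] countable_SIGMA) auto
  moreover have "?C Nr \<in> sets (\<Pi>\<^sub>M i\<in>I. padic_haar)" for Nr
    using I by (cases Nr) (auto intro!: sets_PiM_I_finite simp: sets_padic_haar open_cylinder)
  ultimately have "(\<Union>Nr\<in>?X. ?C Nr) \<in> sets (\<Pi>\<^sub>M i\<in>I. padic_haar)"
    by (intro sets.countable_UN') auto
  moreover have "A = (\<Union>Nr\<in>?X. ?C Nr)"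
  proof (intro equalityI subsetI)
    fix v assume v: "v \<in> A"
    then obtain N where N: "\<And>w. w \<in> space (\<Pi>\<^sub>M i\<in>I. padic_haar) \<Longrightarrow>
        (\<And>i. i \<in> I \<Longrightarrow> residue (w i) N = residue (v i) N) \<Longrightarrow> w \<in> A"
      using loc by metis
    have vS: "v \<in> PiE I (\<lambda>_. UNIV)"
      using v A by (auto simp: space_PiM)
    have "?C (N, \<lambda>i\<in>I. residue (v i) N) \<subseteq> A"
      by (auto intro!: N simp: space_PiM PiE_iff)
    moreover have "v \<in> ?C (N, \<lambda>i\<in>I. residue (v i) N)"
      using vS by auto
    ultimately show "v \<in> (\<Union>Nr\<in>?X. ?C Nr)"
      by (intro UN_I[of "(N, \<lambda>i\<in>I. residue (v i) N)"]) auto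
  qed auto
  ultimately show ?thesis
    by simp
qed

text \<open>It suffices to compare the measures of boxes, where invariance holds factor by
  factor.\<close>

lemma PiM_haar_translate:
  fixes a :: "'i \<Rightarrow> 'p :: prime_card padic_int"
  assumes I: "finite I"
  shows "(\<lambda>v. \<lambda>i\<in>I. a i + v i) \<in> (\<Pi>\<^sub>M i\<in>I. padic_haar) \<rightarrow>\<^sub>M (\<Pi>\<^sub>M i\<in>I. padic_haar)"
    and "distr (\<Pi>\<^sub>M i\<in>I. padic_haar) (\<Pi>\<^sub>M i\<in>I. padic_haar) (\<lambda>v. \<lambda>i\<in>I. a i + v i) = (\<Pi>\<^sub>M i\<in>I. padic_haar)"
proof -
  let ?T = "\<lambda>v. \<lambda>i\<in>I. a i + v i"
  let ?M = "\<Pi>\<^sub>M i\<in>I. (padic_haar :: 'p padic_int measure)"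
  show T: "?T \<in> ?M \<rightarrow>\<^sub>M ?M"
    using measurable_compose[of "\<lambda>v. v i" ?M padic_haar "\<lambda>x. a i + x" padic_haar for i,
        OF measurable_component_singleton measurable_add_haar]
    by (intro measurable_restrict) auto
  show "distr ?M ?M ?T = ?M"
  proof (rule haar_PiM.PiM_eqI[OF I])
    fix X :: "'i \<Rightarrow> 'p padic_int set"
    assume X: "\<And>i. i \<in> I \<Longrightarrow> X i \<in> sets padic_haar"
    have pre: "(\<lambda>x. a i + x) -` X i \<in> sets padic_haar" if "i \<in> I" for i
      using measurable_sets[OF measurable_add_haar X[OF that], of "a i"] by simp
    have "emeasure (distr ?M ?M ?T) (Pi\<^sub>E I X) = emeasure ?M (?T -` Pi\<^sub>E I X \<inter> space ?M)"
      using T X I by (intro emeasure_distr sets_PiM_I_finite) auto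
    also have "?T -` Pi\<^sub>E I X \<inter> space ?M = Pi\<^sub>E I (\<lambda>i. (\<lambda>x. a i + x) -` X i)"
      by (auto simp: space_PiM PiE_iff)
    also have "emeasure ?M \<dots> = (\<Prod>i\<in>I. emeasure padic_haar ((\<lambda>x. a i + x) -` X i))"
      using I pre by (intro haar_PiM.emeasure_PiM) auto
    also have "\<dots> = (\<Prod>i\<in>I. emeasure padic_haar (X i))"
    proof (rule prod.cong)
      fix i assume "i \<in> I"
      have "emeasure (distr padic_haar borel (\<lambda>x. a i + x)) (X i)
          = emeasure padic_haar ((\<lambda>x. a i + x) -` X i \<inter> space padic_haar)"
        using X[OF \<open>i \<in> I\<close>] measurable_add_haar[of "a i"]
        by (intro emeasure_distr) (auto simp: sets_padic_haar cong: measurable_cong_sets)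
      then show "emeasure padic_haar ((\<lambda>x. a i + x) -` X i) = emeasure padic_haar (X i)"
        by (simp add: padic_haar_translate)
    qed simp
    finally show "emeasure (distr ?M ?M ?T) (Pi\<^sub>E I X) = (\<Prod>i\<in>I. emeasure padic_haar (X i))" .
  qed (auto intro: haar.sigma_finite_measure_axioms)
qed

section \<open>Haar measure on a coset of $Z_p$ in $Q_p$\<close>

lemma padic_haar_coset_map_measurable:
  "(\<lambda>z. padic_lift x + of_padic_int z)
    \<in> padic_haar \<rightarrow>\<^sub>M restrict_space padic_borel {y :: 'p :: prime_card padic. padic_class y = x}"
proof (rule measurable_restrict_space2)
  show "(\<lambda>z. padic_lift x + of_padic_int z) \<in> space padic_haar \<rightarrow> {y. padic_class y = x}"
    by (simp add: padic_class_add)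
  show "(\<lambda>z. padic_lift x + of_padic_int z) \<in> padic_haar \<rightarrow>\<^sub>M padic_borel"
    unfolding padic_borel_def
  proof (rule measurable_measure_of)
    fix U :: "'p padic set"
    assume "U \<in> {U. padic_open U}"
    then have "open ((\<lambda>z. padic_lift x + of_padic_int z) -` U)"
      unfolding open_padic_int_def padic_open_def
      by (simp add: add.assoc[symmetric] del: of_padic_int_power)
    then show "(\<lambda>z. padic_lift x + of_padic_int z) -` U \<inter> space padic_haar \<in> sets padic_haar"
      by (simp add: sets_padic_haar)
  qed auto
qed

lemma sets_padic_haar_coset [measurable_cong]:
  "sets (padic_haar_coset x) = sets (restrict_space padic_borel {y. padic_class y = x})"
  by (simp add: padic_haar_coset_def)

lemma prob_space_padic_haar_coset: "prob_space (padic_haar_coset x)"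
  unfolding padic_haar_coset_def
  by (intro prob_space.prob_space_distr prob_space_padic_haar padic_haar_coset_map_measurable)

text \<open>Recovers the corner entry from the parameter \<open>q\<close>: with the norm $h^T M h$
  as \<open>y\<close>, the sum \<open>q + y\<close> is \<open>c\<close>.\<close>

lemma measurable_shift_to_padic_int:
  fixes y :: "'p :: prime_card padic"
  shows "(\<lambda>q. inv_into UNIV of_padic_int (q + y))
    \<in> restrict_space padic_borel {q. padic_class q = - padic_class y} \<rightarrow>\<^sub>M borel"
proof (rule borel_measurableI)
  fix U :: "'p padic_int set"
  assume U: "open U"
  let ?\<Omega> = "{q. padic_class q = - padic_class y}"
  let ?V = "{q. q + y \<in> of_padic_int ` U}"
  have inj: "inj (of_padic_int :: 'p padic_int \<Rightarrow> _)"
    by (auto intro: injI)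
  have "padic_open ?V"
    unfolding padic_open_def
  proof
    fix q assume "q \<in> ?V"
    then obtain a where a: "q + y = of_padic_int a" "a \<in> U"
      by blast
    then obtain m where m: "\<And>z. a + of_nat CARD('p) ^ m * z \<in> U"
      using U unfolding open_padic_int_def by blast
    have "q + of_padic_int (of_nat CARD('p) ^ m * z) \<in> ?V" for z
    proof -
      have "q + of_padic_int (of_nat CARD('p) ^ m * z) + y = of_padic_int (a + of_nat CARD('p) ^ m * z)"
        using a(1) by (simp only: of_padic_int_simps flip: a(1)) (simp add: algebra_simps)
      then show ?thesis
        using m[of z] by blast
    qed
    then show "\<exists>m. \<forall>z. q + of_padic_int (of_nat CARD('p) ^ m * z) \<in> ?V"
      by blast
  qed
  then have "?V \<in> sets padic_borel"
    unfolding padic_borel_def by (auto simp: sets_measure_of)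
  moreover have "(\<lambda>q. inv_into UNIV of_padic_int (q + y)) -` U \<inter> space (restrict_space padic_borel ?\<Omega>) = ?\<Omega> \<inter> ?V"
  proof -
    have space: "space (restrict_space padic_borel ?\<Omega>) = ?\<Omega>"
      by (simp add: space_restrict_space padic_borel_def space_measure_of)
    \<comment> \<open>On this coset \<open>q + y\<close> is integral, so \<open>inv_into\<close> is
      a true inverse there.\<close>
    have "inv_into UNIV of_padic_int (q + y) \<in> U \<longleftrightarrow> q + y \<in> of_padic_int ` U" if "q \<in> ?\<Omega>" for q
    proof -
      have "padic_class (q + y) = 0"
        using that by (simp add: padic_class_add)
      then obtain a where "q + y = of_padic_int a"
        by (auto simp: padic_class_eq_0_iff elim: padic_integersE)
      then show ?thesis
        using inj by (auto simp: inv_f_f)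
    qed
    then show ?thesis
      unfolding space by auto
  qed
  ultimately show "(\<lambda>q. inv_into UNIV of_padic_int (q + y)) -` U \<inter> space (restrict_space padic_borel ?\<Omega>)
      \<in> sets (restrict_space padic_borel ?\<Omega>)"
    by (auto simp: sets_restrict_space)
qed

text \<open>The bind in \<open>Delta_S\<close> formally ranges over every \<open>g\<close> of the
  type, also outside the carrier, where the class map is not known to be measurable. For arbitrary
  \<open>f\<close> the total mass of \<open>distr\<close> is that of the source or 0.\<close>

lemma subprob_space_distr_count_space:
  assumes "prob_space M"
  shows "subprob_space (distr M (count_space UNIV) f)"
proof (rule subprob_spaceI)
  interpret prob_space M
    by fact
  have "emeasure (distr M (count_space UNIV) f) UNIV \<le> emeasure M (f -` UNIV \<inter> space M)"
    unfolding distr_def by (simp add: emeasure_measure_of_conv)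
  also have "\<dots> \<le> 1"
    by (simp add: emeasure_space_1)
  finally show "emeasure (distr M (count_space UNIV) f) (space (distr M (count_space UNIV) f)) \<le> 1"
    by simp
qed simp

section \<open>The distribution of the bordered kernel\<close>

context nonsingular_symmetric_matrix
begin

text \<open>\<open>h\<close>, \<open>g\<close> and $h^T M h$ again, now as functions of the column,
  because \<open>v\<close> becomes the variable of integration.\<close>

definition border_lift where "border_lift v = Qinv *\<^sub>v vec n (\<lambda>i. of_padic_int (v i))"
definition border_elem where "border_elem v = cvec (border_lift v)"
definition border_norm where "border_norm v = border_lift v \<bullet> vec n (\<lambda>i. of_padic_int (v i))"

lemma border_lift_carrier [simp]: "border_lift v \<in> carrier_vec n"
  by (simp add: border_lift_def)

lemma border_elem_in_ker: "border_elem v \<in> carrier K"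
  unfolding border_elem_def by (subst cvec_in_ker_iff) (auto simp: border_lift_def integral_vec_def)

text \<open>Only the entries below \<open>n\<close> enter, so the last entry can be integrated out
  while \<open>g\<close> stays fixed.\<close>

lemma border_lift_upd [simp]: "border_lift (v(n := c)) = border_lift v"
  by (auto simp: border_lift_def intro!: arg_cong[where f = "\<lambda>x. Qinv *\<^sub>v x"])

lemma border_elem_upd [simp]: "border_elem (v(n := c)) = border_elem v"
  by (simp add: border_elem_def)

lemma border_norm_upd [simp]: "border_norm (v(n := c)) = border_norm v"
proof -
  have "vec n (\<lambda>i. of_padic_int ((v(n := c)) i)) = vec n (\<lambda>i. of_padic_int (v i))"
    by auto
  then show ?thesis
    by (simp only: border_norm_def border_lift_upd)
qed

lemma class_border_norm: "padic_class (border_norm v) = pairing K (border_elem v) (border_elem v)"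
  and iso_class_bordered:
    "iso_class (ker_paired (bordered_mat n M v))
      = iso_class (perp_quotient K (border_elem v) (of_padic_int (v n) - border_norm v))"
proof -
  interpret B: bordered_matrix M n v
    by unfold_locales
  have B: "B.h = border_lift v" "B.g = border_elem v" "B.q = of_padic_int (v n) - border_norm v"
    by (simp_all add: B.h_def B.b_def B.g_def B.q_def B.c_def border_lift_def border_elem_def border_norm_def)
  show "padic_class (border_norm v) = pairing K (border_elem v) (border_elem v)"
    using B.class_q unfolding B by (simp add: padic_class_diff)
  show "iso_class (ker_paired (bordered_mat n M v))
      = iso_class (perp_quotient K (border_elem v) (of_padic_int (v n) - border_norm v))"
    using B.iso_class_perp_quotient unfolding B by simp
qed

lemma iso_class_perp_quotient_eq:
  assumes "q + border_norm v = of_padic_int a"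
  shows "iso_class (perp_quotient K (border_elem v) q) = iso_class (ker_paired (bordered_mat n M (v(n := a))))"
proof -
  have "q = of_padic_int a - border_norm v"
    using assms by (simp add: algebra_simps)
  then show ?thesis
    by (simp add: iso_class_bordered)
qed

lemma symmetric_bordered: "symmetric_matrix (bordered_mat n M v) (Suc n)"
proof -
  interpret B: bordered_matrix M n v
    by unfold_locales
  show ?thesis
    by (rule B.M'.symmetric_matrix_axioms)
qed

text \<open>In the expansion along the last row no cofactor contains the corner entry.\<close>

lemma det_bordered_upd:
  "det (bordered_mat n M (v(n := a))) - det (bordered_mat n M (v(n := a'))) = (a - a') * det M"
proof -
  let ?B = "\<lambda>a. bordered_mat n M (v(n := a))"
  have B: "?B a \<in> carrier_mat (Suc n) (Suc n)" for a
    by (simp add: bordered_mat_def)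
  have cof: "cofactor (?B a) n j = cofactor (?B a') n j" if "j < Suc n" for j
  proof -
    have "mat_delete (?B a) n j = mat_delete (?B a') n j"
      using that by (intro eq_matI) (auto simp: mat_delete_def bordered_mat_def)
    then show ?thesis
      by (simp add: cofactor_def)
  qed
  have "mat_delete (?B a) n n = M"
    by (intro eq_matI) (auto simp: mat_delete_def bordered_mat_def)
  \<comment> \<open>The sign of this cofactor is \<open>(-1) ^ (n + n)\<close>.\<close>
  then have cofn: "cofactor (?B a) n n = det M"
    by (simp add: cofactor_def flip: mult_2)
  have expand: "det (?B a) = (\<Sum>j<n. v j * cofactor (?B a) n j) + a * cofactor (?B a) n n" for a
    by (subst laplace_expansion_row[OF B, of n]) (auto simp: bordered_mat_def intro!: sum.cong)
  show ?thesis
    using cof cofn unfolding expand by (simp add: algebra_simps)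
qed

section \<open>Measurability of the isomorphism class\<close>

definition bordered_class where "bordered_class v = iso_class (ker_paired (bordered_mat n M v))"

lemma bordered_mat_cong: "(\<And>i. i \<le> n \<Longrightarrow> v i = w i) \<Longrightarrow> bordered_mat n M v = bordered_mat n M w"
  by (intro eq_matI) (auto simp: bordered_mat_def)

text \<open>The set is open: by \<open>ker_locally_constant\<close> the residues of the column at a
  level above \<open>2 * d\<close> fix both non-singularity and the class.\<close>

lemma sets_nonsingular:
  "{v \<in> space (\<Pi>\<^sub>M i\<in>{..n}. padic_haar). det (bordered_mat n M v) \<noteq> 0 \<and> bordered_class v \<in> A}
    \<in> sets (\<Pi>\<^sub>M i\<in>{..n}. padic_haar)"
proof (rule sets_PiM_haar)
  fix v assume "v \<in> {v \<in> space (\<Pi>\<^sub>M i\<in>{..n}. padic_haar). det (bordered_mat n M v) \<noteq> 0 \<and> bordered_class v \<in> A}"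
  then have v: "det (bordered_mat n M v) \<noteq> 0" "bordered_class v \<in> A"
    by simp_all
  interpret B: nonsingular_symmetric_matrix "bordered_mat n M v" "Suc n"
    using symmetric_bordered v(1)
    by (simp add: nonsingular_symmetric_matrix_def nonsingular_symmetric_matrix_axioms_def)
  obtain d where d: "det (bordered_mat n M v) dvd of_nat CARD('p) ^ d"
    using dvd_p_power[OF v(1)] by blast
  define N where "N = Suc (2 * d)"
  have N: "2 * d < N"
    by (simp add: N_def)
  have near: "det (bordered_mat n M w) \<noteq> 0" "bordered_class w = bordered_class v"
    if w: "\<forall>i\<in>{..n}. residue (w i) N = residue (v i) N" for w :: "nat \<Rightarrow> 'p padic_int"
  proof -
    have w': "residue (w i) N = residue (v i) N" if "i < Suc n" for i
      using w that by simp
    have res: "residue (bordered_mat n M w $$ (i, j)) N = residue (bordered_mat n M v $$ (i, j)) N"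
      if "i < Suc n" "j < Suc n" for i j
      using that by (simp add: bordered_mat_def w')
    show "det (bordered_mat n M w) \<noteq> 0"
      by (rule B.ker_locally_constant(1)[OF d N symmetric_bordered res])
    show "bordered_class w = bordered_class v"
      unfolding bordered_class_def by (rule B.ker_locally_constant(2)[OF d N symmetric_bordered res])
  qed
  show "\<exists>N. \<forall>w\<in>space (\<Pi>\<^sub>M i\<in>{..n}. padic_haar). (\<forall>i\<in>{..n}. residue (w i) N = residue (v i) N) \<longrightarrow>
      w \<in> {v \<in> space (\<Pi>\<^sub>M i\<in>{..n}. padic_haar). det (bordered_mat n M v) \<noteq> 0 \<and> bordered_class v \<in> A}"
  proof (intro exI[of _ N] ballI impI CollectI conjI)
    fix w :: "nat \<Rightarrow> 'p padic_int" assume w: "\<forall>i\<in>{..n}. residue (w i) N = residue (v i) N"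
    show "det (bordered_mat n M w) \<noteq> 0"
      by (rule near(1)[OF w])
    show "bordered_class w \<in> A"
      unfolding near(2)[OF w] by (rule v(2))
  qed
qed simp_all

lemma bordered_class_singular:
  assumes "det (bordered_mat n M v) = 0"
  shows "bordered_class v = {}"
proof -
  interpret B: symmetric_matrix "bordered_mat n M v" "Suc n"
    by (rule symmetric_bordered)
  show ?thesis
    unfolding bordered_class_def using B.infinite_ker[OF assms] by (rule iso_class_infinite)
qed

text \<open>On the singular columns the class is constantly \<open>{}\<close>, so a preimage is an
  open set, together with the closed set of singular columns if \<open>{}\<close> belongs to
  \<open>A\<close>.\<close>

lemma bordered_class_measurable: "bordered_class \<in> (\<Pi>\<^sub>M i\<in>{..n}. padic_haar) \<rightarrow>\<^sub>M count_space UNIV"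
proof (rule measurableI)
  let ?M = "\<Pi>\<^sub>M i\<in>{..n}. (padic_haar :: 'p padic_int measure)"
  let ?S = "\<lambda>A. {v \<in> space ?M. det (bordered_mat n M v) \<noteq> 0 \<and> bordered_class v \<in> A}"
  fix A
  have "bordered_class -` A \<inter> space ?M = ?S A \<union> (if {} \<in> A then space ?M - ?S UNIV else {})"
    using bordered_class_singular by auto
  also have "\<dots> \<in> sets ?M"
    using sets_nonsingular[of A] sets_nonsingular[of UNIV] by auto
  finally show "bordered_class -` A \<inter> space ?M \<in> sets ?M" .
qed simp

lemma bordered_class_upd_measurable: "(\<lambda>a. bordered_class (v(n := a))) \<in> padic_haar \<rightarrow>\<^sub>M count_space UNIV"
proof -
  have "(\<lambda>a. (v(n := a)) i) \<in> padic_haar \<rightarrow>\<^sub>M padic_haar" for i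
    by (cases "i = n") simp_all
  \<comment> \<open>\<open>v\<close> is arbitrary beyond \<open>n\<close>, so it is restricted to
    land in the product space; \<open>bordered_mat\<close> reads the entries up to \<open>n\<close>
    only.\<close>
  then have "(\<lambda>a. \<lambda>i\<in>{..n}. (v(n := a)) i) \<in> padic_haar \<rightarrow>\<^sub>M (\<Pi>\<^sub>M i\<in>{..n}. padic_haar)"
    by (intro measurable_restrict)
  from measurable_compose[OF this bordered_class_measurable] show ?thesis
    unfolding bordered_class_def by (rule back_subst[of "\<lambda>f. f \<in> _"])
      (intro ext arg_cong[where f = "\<lambda>x. iso_class (ker_paired x)"] bordered_mat_cong, simp)
qed

abbreviation coset_measure where "coset_measure g \<equiv> padic_haar_coset (- pairing K g g)"

text \<open>Along the coset, the class at \<open>q\<close> is that of the bordered matrix with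
  corner \<open>q + border_norm v\<close>. So the coset measure becomes a translate of the Haar
  measure on $Z_p$, which is the Haar measure itself.\<close>

lemma
  shows perp_class_measurable: "(\<lambda>q. iso_class (perp_quotient K (border_elem v) q))
      \<in> coset_measure (border_elem v) \<rightarrow>\<^sub>M count_space UNIV" (is "?G \<in> _")
    and distr_perp_class: "distr (coset_measure (border_elem v)) (count_space UNIV) (\<lambda>q. iso_class (perp_quotient K (border_elem v) q))
      = distr padic_haar (count_space UNIV) (\<lambda>a. bordered_class (v(n := a)))"
proof -
  let ?y = "border_norm v"
  let ?x = "- padic_class ?y"
  let ?R = "restrict_space padic_borel {q. padic_class q = ?x}"
  let ?\<tau> = "\<lambda>z. padic_lift ?x + of_padic_int z"
  have coset: "coset_measure (border_elem v) = padic_haar_coset ?x"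
    by (simp add: class_border_norm)
  have inj: "inj (of_padic_int :: 'p padic_int \<Rightarrow> _)"
    by (auto intro: injI)
  have G: "?G q = bordered_class (v(n := inv_into UNIV of_padic_int (q + ?y)))" if "padic_class q = ?x" for q
  proof -
    have "padic_class (q + ?y) = 0"
      using that by (simp add: padic_class_add)
    then obtain a where a: "q + ?y = of_padic_int a"
      by (auto simp: padic_class_eq_0_iff elim: padic_integersE)
    then show ?thesis
      using iso_class_perp_quotient_eq[OF a] inv_f_f[OF inj, of a] by (simp add: bordered_class_def)
  qed
  have "(\<lambda>q. inv_into UNIV of_padic_int (q + ?y)) \<in> ?R \<rightarrow>\<^sub>M padic_haar"
    using measurable_shift_to_padic_int[of ?y] by (simp cong: measurable_cong_sets add: sets_padic_haar)
  from measurable_compose[OF this bordered_class_upd_measurable]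
  have GR: "?G \<in> ?R \<rightarrow>\<^sub>M count_space UNIV"
    by (rule measurable_cong[THEN iffD1, rotated]) (simp add: space_restrict_space G)
  then show "?G \<in> coset_measure (border_elem v) \<rightarrow>\<^sub>M count_space UNIV"
    unfolding coset by (simp cong: measurable_cong_sets add: sets_padic_haar_coset)
  \<comment> \<open>The representative chosen by \<open>padic_lift\<close> differs from
    \<open>- ?y\<close> by a p-adic integer \<open>a\<close>, which is the translation between the
    two parametrizations of the coset.\<close>
  have "padic_class (padic_lift ?x + ?y) = 0"
    by (simp add: padic_class_add)
  then obtain a where a: "padic_lift ?x + ?y = of_padic_int a"
    by (auto simp: padic_class_eq_0_iff elim: padic_integersE)
  have "distr (coset_measure (border_elem v)) (count_space UNIV) ?G = distr padic_haar (count_space UNIV) (?G \<circ> ?\<tau>)"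
    unfolding coset unfolding padic_haar_coset_def using GR padic_haar_coset_map_measurable by (rule distr_distr)
  also have "?G \<circ> ?\<tau> = (\<lambda>a. bordered_class (v(n := a))) \<circ> (\<lambda>z. a + z)"
  proof
    fix z
    have "?\<tau> z + ?y = of_padic_int (a + z)"
      using a by (simp add: algebra_simps)
    from iso_class_perp_quotient_eq[OF this]
    show "(?G \<circ> ?\<tau>) z = ((\<lambda>a. bordered_class (v(n := a))) \<circ> (\<lambda>z. a + z)) z"
      by (simp add: bordered_class_def)
  qed
  also have "distr padic_haar (count_space UNIV) \<dots>
      = distr (distr padic_haar padic_haar (\<lambda>z. a + z)) (count_space UNIV) (\<lambda>a. bordered_class (v(n := a)))"
    using bordered_class_upd_measurable measurable_add_haar by (rule distr_distr[symmetric])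
  also have "distr padic_haar padic_haar (\<lambda>z. a + z) = distr padic_haar borel (\<lambda>z. a + z)"
    by (rule distr_cong) (simp_all add: sets_padic_haar)
  also have "\<dots> = padic_haar"
    by (rule padic_haar_translate)
  finally show "distr (coset_measure (border_elem v)) (count_space UNIV) ?G
      = distr padic_haar (count_space UNIV) (\<lambda>a. bordered_class (v(n := a)))" .
qed

lemma border_elem_surj:
  assumes "u \<in> carrier K"
  obtains v where "border_elem v = u"
proof -
  obtain x where x: "x \<in> carrier_vec n" "Q *\<^sub>v x \<in> integral_vec n" "u = cvec x"
    using assms by (rule ker_cases)
  have "\<forall>i. \<exists>a. i < n \<longrightarrow> (Q *\<^sub>v x) $ i = of_padic_int a"
    using x(2) unfolding integral_vec_def padic_integers_def by blast
  then obtain a where a: "\<And>i. i < n \<Longrightarrow> (Q *\<^sub>v x) $ i = of_padic_int (a i)"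
    by metis
  \<comment> \<open>The column is read off from \<open>Q *\<^sub>v x\<close>, as \<open>Qinv\<close>
    recovers the lift \<open>x\<close> from it.\<close>
  have "vec n (\<lambda>i. of_padic_int (a i)) = Q *\<^sub>v x"
    using x(1) a by (intro eq_vecI) auto
  then have "border_elem a = u"
    using x by (simp add: border_elem_def border_lift_def)
  then show ?thesis
    by (rule that)
qed

text \<open>The sum is restricted to \<open>{..<n}\<close> to match the translations in
  \<open>PiM_haar_translate\<close>.\<close>

lemma border_elem_add: "border_elem (\<lambda>i\<in>{..<n}. v i + w i) = border_elem v + border_elem w"
proof -
  have "vec n (\<lambda>i. of_padic_int ((\<lambda>i\<in>{..<n}. v i + w i) i))
      = vec n (\<lambda>i. of_padic_int (v i)) + vec n (\<lambda>i. of_padic_int (w i))"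
    by (intro eq_vecI) auto
  then have "border_lift (\<lambda>i\<in>{..<n}. v i + w i) = border_lift v + border_lift w"
    unfolding border_lift_def by (simp add: mult_add_distrib_mat_vec[OF carrier_Qinv])
  then show ?thesis
    by (simp add: border_elem_def cvec_add[of _ n])
qed

text \<open>Changing $b$ by \<open>p ^ d\<close> times an integral vector changes $h$ by
  \<open>p ^ d\<close> times a lift of a kernel element, which is integral.\<close>

lemma border_elem_cong:
  assumes d: "det M dvd of_nat CARD('p) ^ d"
    and res: "\<And>i. i < n \<Longrightarrow> residue (w i) d = residue (v i) d"
  shows "border_elem w = border_elem v"
proof -
  have "\<forall>i. \<exists>e. i < n \<longrightarrow> w i = v i + of_nat CARD('p) ^ d * e"
    using res unfolding residue_eq_iff by blast
  then obtain e where e: "\<And>i. i < n \<Longrightarrow> w i = v i + of_nat CARD('p) ^ d * e i"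
    by metis
  let ?q = "of_padic_int (of_nat CARD('p) ^ d) :: 'p padic"
  have "vec n (\<lambda>i. of_padic_int (w i)) = vec n (\<lambda>i. of_padic_int (v i)) + ?q \<cdot>\<^sub>v vec n (\<lambda>i. of_padic_int (e i))"
    by (intro eq_vecI) (auto simp: e)
  then have "border_lift w = border_lift v + ?q \<cdot>\<^sub>v border_lift e"
    unfolding border_lift_def by (simp add: mult_add_distrib_mat_vec[OF carrier_Qinv] mult_mat_vec[OF carrier_Qinv]
      del: of_padic_int_power)
  moreover have "border_lift v + ?q \<cdot>\<^sub>v border_lift e - border_lift v = ?q \<cdot>\<^sub>v border_lift e"
  proof (rule eq_vecI)
    have dims: "dim_vec (border_lift x) = n" for x
      by (rule carrier_vecD) simp
    show "dim_vec (border_lift v + ?q \<cdot>\<^sub>v border_lift e - border_lift v) = dim_vec (?q \<cdot>\<^sub>v border_lift e)"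
      by (simp add: dims)
    show "(border_lift v + ?q \<cdot>\<^sub>v border_lift e - border_lift v) $ i = (?q \<cdot>\<^sub>v border_lift e) $ i"
      if "i < dim_vec (?q \<cdot>\<^sub>v border_lift e)" for i
      using that by (simp add: dims)
  qed
  moreover have "?q \<cdot>\<^sub>v border_lift e \<in> integral_vec n"
    by (rule p_power_kills_lift[OF d]) (auto simp: border_lift_def integral_vec_def)
  ultimately show ?thesis
    unfolding border_elem_def by (subst cvec_eq_iff[of _ n]) auto
qed

abbreviation V where "V \<equiv> \<Pi>\<^sub>M i\<in>{..<n}. (padic_haar :: 'p padic_int measure)"

lemma sets_border_elem: "{v \<in> space V. border_elem v = u} \<in> sets V"
proof (rule sets_PiM_haar)
  fix v assume v: "v \<in> {v \<in> space V. border_elem v = u}"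
  obtain d where "det M dvd of_nat CARD('p) ^ d"
    using dvd_p_power[OF det_M] by blast
  note d = this
  show "\<exists>N. \<forall>w\<in>space V. (\<forall>i\<in>{..<n}. residue (w i) N = residue (v i) N) \<longrightarrow> w \<in> {v \<in> space V. border_elem v = u}"
  proof (intro exI[of _ d] ballI impI CollectI conjI)
    fix w :: "nat \<Rightarrow> 'p padic_int"
    assume w: "\<forall>i\<in>{..<n}. residue (w i) d = residue (v i) d"
    have "border_elem w = border_elem v"
      by (rule border_elem_cong[OF d]) (use w in simp)
    then show "border_elem w = u"
      using v by simp
  qed
qed simp_all

text \<open>Translation by a preimage of \<open>u\<close> carries the fibre over the identity to the
  fibre over \<open>u\<close>, so the fibres share the total mass 1 equally.\<close>

lemma emeasure_border_elem:
  assumes u: "u \<in> carrier K"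
  shows "emeasure V {v \<in> space V. border_elem v = u} = 1 / of_nat (card (carrier K))"
proof -
  let ?S = "\<lambda>u. {v \<in> space V. border_elem v = u}"
  interpret V: prob_space V
    by (intro prob_space_PiM prob_space_padic_haar)
  have eq: "emeasure V (?S u) = emeasure V (?S \<one>\<^bsub>K\<^esub>)" if u: "u \<in> carrier K" for u
  proof -
    obtain a where a: "border_elem a = u"
      using u by (rule border_elem_surj)
    let ?T = "\<lambda>v. \<lambda>i\<in>{..<n}. a i + v i"
    have "border_elem a + border_elem v = u \<longleftrightarrow> border_elem v = \<one>\<^bsub>K\<^esub>" for v
      using K.l_cancel_one'[of u "border_elem v"] u border_elem_in_ker[of v] by (auto simp: a ker_simps(2))
    then have "?T -` ?S u \<inter> space V = ?S \<one>\<^bsub>K\<^esub>"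
      by (auto simp: border_elem_add space_PiM)
    moreover have "emeasure (distr V V ?T) (?S u) = emeasure V (?T -` ?S u \<inter> space V)"
      using PiM_haar_translate(1) sets_border_elem by (intro emeasure_distr) auto
    ultimately show ?thesis
      by (simp add: PiM_haar_translate(2))
  qed
  have "1 = emeasure V (\<Union>u\<in>carrier K. ?S u)"
  proof -
    have "(\<Union>u\<in>carrier K. ?S u) = space V"
      using border_elem_in_ker by auto
    then show ?thesis
      by (simp only: V.emeasure_space_1)
  qed
  also have "\<dots> = (\<Sum>u\<in>carrier K. emeasure V (?S u))"
    using finite_ker sets_border_elem by (intro sum_emeasure[symmetric]) (auto simp: disjoint_family_on_def)
  also have "\<dots> = (\<Sum>u\<in>carrier K. emeasure V (?S \<one>\<^bsub>K\<^esub>))"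
    by (rule sum.cong[OF refl eq])
  finally have *: "of_nat (card (carrier K)) * emeasure V (?S \<one>\<^bsub>K\<^esub>) = 1"
    by (simp only: sum_constant)
  define N :: ennreal where "N = of_nat (card (carrier K))"
  have "N \<noteq> 0" "N \<noteq> \<top>"
    using finite_ker K.one_closed by (auto simp: N_def card_eq_0_iff)
  then have "emeasure V (?S u) * N / N = emeasure V (?S u)"
    by (rule ennreal_mult_divide_eq)
  moreover have "emeasure V (?S u) * N = 1"
    unfolding eq[OF u] using * by (simp only: N_def mult.commute)
  ultimately show ?thesis
    by (simp only: N_def)
qed

lemma AE_nonsingular: "AE v in (\<Pi>\<^sub>M i\<in>{..n}. padic_haar). det (bordered_mat n M v) \<noteq> 0"
proof -
  let ?M = "\<Pi>\<^sub>M i\<in>{..n}. (padic_haar :: 'p padic_int measure)"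
  let ?Z = "space ?M - {v \<in> space ?M. det (bordered_mat n M v) \<noteq> 0 \<and> bordered_class v \<in> UNIV}"
  have Z: "?Z \<in> sets ?M"
    using sets_nonsingular[of UNIV] by blast
  have ins: "{..n} = insert n {..<n}"
    by auto
  have "emeasure ?M ?Z = (\<integral>\<^sup>+ v. indicator ?Z v \<partial>?M)"
    using Z by simp
  also have "\<dots> = (\<integral>\<^sup>+ v. (\<integral>\<^sup>+ a. indicator ?Z (v(n := a)) \<partial>padic_haar) \<partial>V)"
    using Z unfolding ins by (intro haar_PiM.product_nn_integral_insert) auto
  also have "\<dots> = (\<integral>\<^sup>+ v. 0 \<partial>V)"
  proof (rule nn_integral_cong)
    fix v assume "v \<in> space V"
    show "(\<integral>\<^sup>+ a. indicator ?Z (v(n := a)) \<partial>padic_haar) = 0"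
    \<comment> \<open>By \<open>det_bordered_upd\<close> and \<open>det M \<noteq> 0\<close>, at
      most one corner entry makes the matrix singular, and a point is a null set.\<close>
    proof (cases "\<exists>a0. det (bordered_mat n M (v(n := a0))) = 0")
      case True
      then obtain a0 where a0: "det (bordered_mat n M (v(n := a0))) = 0"
        by blast
      have "a = a0" if "det (bordered_mat n M (v(n := a))) = 0" for a
        using det_bordered_upd[of v a a0] that a0 det_M by simp
      then have "(\<integral>\<^sup>+ a. indicator ?Z (v(n := a)) \<partial>padic_haar) \<le> (\<integral>\<^sup>+ a. indicator {a0} a \<partial>padic_haar)"
        by (intro nn_integral_mono) (auto simp: indicator_def)
      also have "\<dots> = emeasure padic_haar {a0}"
      proof (rule nn_integral_indicator)
        have "{a0} = (\<Inter>m. {a. residue a m = residue a0 m})"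
          by (auto intro: padic_int_eqI)
        also have "\<dots> \<in> sets padic_haar"
          by (intro sets.countable_INT) (auto simp: sets_padic_haar open_cylinder)
        finally show "{a0} \<in> sets padic_haar" .
      qed
      finally show ?thesis
        by (simp add: emeasure_haar_singleton)
    next
      case False
      then have "(\<lambda>a. indicator ?Z (v(n := a)) :: ennreal) = (\<lambda>_. 0)"
        by (auto simp: indicator_def)
      then show ?thesis
        by simp
    qed
  qed
  finally have "emeasure ?M ?Z = 0"
    by simp
  with Z show ?thesis
    by (intro AE_I[of _ _ ?Z]) auto
qed

text \<open>For each set of classes, the average over \<open>g\<close> becomes an integral over the
  first \<open>n\<close> entries and the coset measure an integral over the last one; Fubini joins
  them.\<close>

lemma Delta_S_ker:
  "Delta_S K = distr (\<Pi>\<^sub>M i\<in>{..n}. padic_haar) (count_space UNIV) bordered_class"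
proof (rule measure_eqI)
  let ?M = "\<Pi>\<^sub>M i\<in>{..n}. (padic_haar :: 'p padic_int measure)"
  let ?D = "\<lambda>g. distr (coset_measure g) (count_space UNIV) (\<lambda>q. iso_class (perp_quotient K g q))"
  let ?P = "measure_pmf (pmf_of_set (carrier K))"
  \<comment> \<open>The source is discrete, so only the subprobability bound has to be
    checked.\<close>
  have D: "?D \<in> ?P \<rightarrow>\<^sub>M subprob_algebra (count_space UNIV)"
    by (simp add: space_subprob_algebra subprob_space_distr_count_space[OF prob_space_padic_haar_coset])
  have ne: "carrier K \<noteq> {}"
    using K.one_closed by blast
  have ins: "{..n} = insert n {..<n}"
    by auto
  show "sets (Delta_S K) = sets (distr ?M (count_space UNIV) bordered_class)"
    unfolding Delta_S_def using D by (subst sets_bind[of _ _ "count_space UNIV"]) auto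
  fix A
  let ?\<psi> = "\<lambda>g. emeasure (?D g) A"
  have "emeasure (Delta_S K) A = (\<integral>\<^sup>+ g. ?\<psi> g \<partial>?P)"
    unfolding Delta_S_def using D by (intro emeasure_bind) auto
  also have "\<dots> = (\<Sum>g\<in>carrier K. ?\<psi> g) / of_nat (card (carrier K))"
    using ne finite_ker by (rule nn_integral_pmf_of_set)
  \<comment> \<open>The weight of each \<open>g\<close> is exchanged for the measure of its fibre
    under \<open>border_elem\<close>.\<close>
  also have "\<dots> = (\<Sum>g\<in>carrier K. ?\<psi> g * emeasure V {v \<in> space V. border_elem v = g})"
    by (simp add: emeasure_border_elem divide_ennreal_def sum_distrib_right)
  also have "\<dots> = (\<Sum>g\<in>carrier K. (\<integral>\<^sup>+ v. ?\<psi> g * indicator {v \<in> space V. border_elem v = g} v \<partial>V))"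
    using sets_border_elem by (intro sum.cong) (simp_all add: nn_integral_cmult_indicator)
  also have "\<dots> = (\<integral>\<^sup>+ v. (\<Sum>g\<in>carrier K. ?\<psi> g * indicator {v \<in> space V. border_elem v = g} v) \<partial>V)"
    using sets_border_elem by (intro nn_integral_sum[symmetric]) auto
  \<comment> \<open>The fibres partition the space, so exactly one summand survives at each
    \<open>v\<close>.\<close>
  also have "\<dots> = (\<integral>\<^sup>+ v. ?\<psi> (border_elem v) \<partial>V)"
  proof (rule nn_integral_cong)
    fix v assume v: "v \<in> space V"
    have "(\<Sum>g\<in>carrier K. ?\<psi> g * indicator {v \<in> space V. border_elem v = g} v)
        = (\<Sum>g\<in>carrier K. if g = border_elem v then ?\<psi> g else 0)"
      using v by (intro sum.cong) auto
    then show "(\<Sum>g\<in>carrier K. ?\<psi> g * indicator {v \<in> space V. border_elem v = g} v) = ?\<psi> (border_elem v)"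
      using border_elem_in_ker finite_ker by (simp add: sum.delta)
  qed
  also have "\<dots> = (\<integral>\<^sup>+ v. (\<integral>\<^sup>+ a. indicator (bordered_class -` A \<inter> space ?M) (v(n := a)) \<partial>padic_haar) \<partial>V)"
  proof (rule nn_integral_cong)
    fix v assume v: "v \<in> space V"
    have in_space: "v(n := a) \<in> space ?M" for a
      using v unfolding ins by (auto simp: space_PiM PiE_iff extensional_def)
    have "?\<psi> (border_elem v) = emeasure padic_haar ((\<lambda>a. bordered_class (v(n := a))) -` A \<inter> space padic_haar)"
      unfolding distr_perp_class using bordered_class_upd_measurable by (rule emeasure_distr) simp
    also have "\<dots> = (\<integral>\<^sup>+ a. indicator ((\<lambda>a. bordered_class (v(n := a))) -` A \<inter> space padic_haar) a \<partial>padic_haar)"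
      using measurable_sets[OF bordered_class_upd_measurable, of A v] by simp
    also have "\<dots> = (\<integral>\<^sup>+ a. indicator (bordered_class -` A \<inter> space ?M) (v(n := a)) \<partial>padic_haar)"
      using in_space by (intro nn_integral_cong) (auto simp: indicator_def)
    finally show "?\<psi> (border_elem v) = (\<integral>\<^sup>+ a. indicator (bordered_class -` A \<inter> space ?M) (v(n := a)) \<partial>padic_haar)" .
  qed
  also have "\<dots> = (\<integral>\<^sup>+ v. indicator (bordered_class -` A \<inter> space ?M) v \<partial>?M)"
    using measurable_sets[OF bordered_class_measurable, of A] unfolding ins
    by (intro haar_PiM.product_nn_integral_insert[symmetric]) auto
  also have "\<dots> = emeasure (distr ?M (count_space UNIV) bordered_class) A"
    using measurable_sets[OF bordered_class_measurable, of A] bordered_class_measurable by (simp add: emeasure_distr)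
  finally show "emeasure (Delta_S K) A = emeasure (distr ?M (count_space UNIV) bordered_class) A" .
qed

lemma AE_bordered_class: "AE v in (\<Pi>\<^sub>M i\<in>{..n}. padic_haar). bordered_class v \<in> perfect_classes"
  using AE_nonsingular
proof eventually_elim
  fix v assume "det (bordered_mat n M v) \<noteq> 0"
  then interpret B: nonsingular_symmetric_matrix "bordered_mat n M v" "Suc n"
    using symmetric_bordered
    by (simp add: nonsingular_symmetric_matrix_def nonsingular_symmetric_matrix_axioms_def)
  show "bordered_class v \<in> perfect_classes"
    unfolding bordered_class_def using B.perfect_ker by (rule perfect_iso_class)
qed

end

text \<open>The two measurability clauses ensure that the \<open>distr\<close> on the right and
  those inside \<open>Delta_S\<close> are true image measures.\<close>

theorem theorem2:
  fixes M :: "'p :: prime_card padic_int mat" and k :: nat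
  assumes "M \<in> carrier_mat k k"
    and "transpose_mat M = M"
    and "det M \<noteq> 0"
  shows
    "(\<lambda>v. iso_class (ker_paired (bordered_mat k M v)))
        \<in> measurable (\<Pi>\<^sub>M i\<in>{..k}. padic_haar) (count_space UNIV)
     \<and> (\<forall>g\<in>carrier (ker_paired M). (\<lambda>q. iso_class (perp_quotient (ker_paired M) g q))
        \<in> measurable (padic_haar_coset (- pairing (ker_paired M) g g)) (count_space UNIV))
     \<and> (AE v in (\<Pi>\<^sub>M i\<in>{..k}. padic_haar).
          iso_class (ker_paired (bordered_mat k M v)) \<in> perfect_classes)
     \<and> (AE C in Delta_S (ker_paired M). C \<in> perfect_classes)
     \<and> Delta_S (ker_paired M)
        = distr (\<Pi>\<^sub>M i\<in>{..k}. padic_haar) (count_space UNIV)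
            (\<lambda>v. iso_class (ker_paired (bordered_mat k M v)))"
proof -
  interpret nonsingular_symmetric_matrix M k
    by standard fact+
  have bordered_class: "bordered_class = (\<lambda>v. iso_class (ker_paired (bordered_mat k M v)))"
    by (simp add: bordered_class_def fun_eq_iff)
  have "(\<lambda>q. iso_class (perp_quotient K g q)) \<in> coset_measure g \<rightarrow>\<^sub>M count_space UNIV"
    if g: "g \<in> carrier K" for g
  proof -
    \<comment> \<open>Measurability is known for elements of the form \<open>border_elem v\<close>,
      which exhaust the kernel.\<close>
    obtain v where "border_elem v = g"
      using g by (rule border_elem_surj)
    then show ?thesis
      using perp_class_measurable[of v] by simp
  qed
  moreover have "AE C in Delta_S K. C \<in> perfect_classes"
    unfolding Delta_S_ker using bordered_class_measurable AE_bordered_class by (subst AE_distr_iff) auto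
  ultimately show ?thesis
    using bordered_class_measurable AE_bordered_class Delta_S_ker unfolding bordered_class by blast
qed

end
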